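(* Let $\mathfrak g$ be a restricted Lie algebra, let $r,j$ be positive integers with $j\le(p-1)r$, and let $M$ be a finite dimensional $\mathfrak u(\mathfrak g)$-module of constant $(r,j)$-radical rank (respectively, of constant $(r,j)$-socle rank). Then the coherent sheaf $\mathcal{I}m^{j,\mathbb E(r,\mathfrak g)}(M)$ (respectively, $\mathcal{K}er^{j,\mathbb E(r,\mathfrak g)}(M)$) is an algebraic vector bundle on $\mathbb E(r,\mathfrak g)$. Moreover, the fiber of $\mathcal{I}m^{j,\mathbb E(r,\mathfrak g)}(M)$ (respectively, $\mathcal{K}er^{j,\mathbb E(r,\mathfrak g)}(M)$) at $\epsilon\in\mathbb E(r,\mathfrak g)$ is naturally identified with $\operatorname{Rad}^j(\epsilon^*M)$ (respectively, $\operatorname{Soc}^j(\epsilon^*M)$).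
   Context: Let $k$ be an algebraically closed field of characteristic $p>0$. Lie algebras are finite dimensional restricted Lie algebras over $k$ with $p$-operation $(-)^{[p]}$; $\mathfrak u(\mathfrak g)$ is the restricted enveloping algebra. An elementary subalgebra of $\mathfrak g$ is an abelian Lie subalgebra $\epsilon$ with $x^{[p]}=0$ for all $x\in\epsilon$. For $0<r<\dim\mathfrak g$, $\mathbb E(r,\mathfrak g)\subset\operatorname{Grass}(r,\mathfrak g)$ is the closed subvariety of $r$-dimensional elementary subalgebras. $\epsilon^*M$ is the restriction of $M$ to $\epsilon$; $\operatorname{Rad}^j(\epsilon^*M)=J^jM$ and $\operatorname{Soc}^j(\epsilon^*M)=\{m\in M:J^jm=0\}$, where $J$ is the Jacobson radical of $\mathfrak u(\epsilon)$. $M$ has constant $(r,j)$-radical rank (respectively, constant $(r,j)$-socle rank) if $\dim\operatorname{Rad}^j(\epsilon^*M)$ (respectively, $\dim\operatorname{Soc}^j(\epsilon^*M)$) is independent of $\epsilon\in\mathbb E(r,\mathfrak g)$. Image and kernel sheaves. Let $\mathcal C^o$ be the quasi-projective variety of linearly independent $r$-tuples $(X_1,\dots,X_r)$ of pairwise commuting elements of $\mathfrak g$ with $X_s^{[p]}=0$; sending a tuple to its span gives a $\mathrm{GL}_r$-torsor $q:\mathcal C^o\to\mathbb E(r,\mathfrak g)$. Fix a basis $x_1,\dots,x_n$ of $\mathfrak g$ and let $Y_{i,s}$ be the function on $\mathcal C^o$ giving the $i$-th coordinate of $X_s$. Let $\Theta_s:M\otimes\mathcal O_{\mathcal C^o}\to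 M\otimes\mathcal O_{\mathcal C^o}$, $m\otimes f\mapsto\sum_i x_im\otimes Y_{i,s}f$. For $1\le j\le(p-1)r$, the sum of the images of all $\Theta_1^{j_1}\cdots\Theta_r^{j_r}$ with $j_1+\dots+j_r=j$, $j_\ell\ge0$, and the intersection of the kernels of these operators, are $\mathrm{GL}_r$-invariant coherent subsheaves of $M\otimes\mathcal O_{\mathcal C^o}$; by descent along $q$ they are the pull-backs of unique coherent subsheaves $\mathcal{I}m^{j,\mathbb E(r,\mathfrak g)}(M)$ and $\mathcal{K}er^{j,\mathbb E(r,\mathfrak g)}(M)$ of $M\otimes\mathcal O_{\mathbb E(r,\mathfrak g)}$. *)

theory Defs
  imports
    "HOL-Analysis.Abstract_Topology"
    "HOL-Library.FuncSet"
    "HOL-Computational_Algebra.Polynomial"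
    "HOL-Algebra.QuotRing"
    "HOL-Algebra.Ideal_Product"
    "Jordan_Normal_Form.Determinant"
begin

section \<open>Restricted Lie algebras\<close>

record ('k, 'g) lie =
  lscale :: "'k \<Rightarrow> 'g \<Rightarrow> 'g"
  lbasis :: "'g set"
  lbracket :: "'g \<Rightarrow> 'g \<Rightarrow> 'g"
  lpow :: "'g \<Rightarrow> 'g"

text \<open>\<open>jacobson_coeff L x y m i\<close> is the coefficient of \<open>t ^ i\<close> in \<open>ad(t x + y) ^ m (x)\<close>,
  an element of the Lie algebra tensored with the polynomial ring in \<open>t\<close>.\<close>

primrec jacobson_coeff :: "('k, 'g::ab_group_add) lie \<Rightarrow> 'g \<Rightarrow> 'g \<Rightarrow> nat \<Rightarrow> nat \<Rightarrow> 'g" where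
  "jacobson_coeff L x y 0 = (\<lambda>i. if i = 0 then x else 0)"
| "jacobson_coeff L x y (Suc m) = (\<lambda>i.
     lbracket L y (jacobson_coeff L x y m i) +
     (if i = 0 then 0 else lbracket L x (jacobson_coeff L x y m (i - 1))))"

text \<open>In the last clause \<open>i s\<^sub>i(x,y)\<close> is the coefficient of \<open>t ^ (i - 1)\<close> in
  \<open>ad(t x + y) ^ (p - 1) (x)\<close>, where \<open>p\<close> is the characteristic of the field.\<close>

definition restricted_lie_algebra :: "('k::field, 'g::ab_group_add) lie \<Rightarrow> bool" where
  "restricted_lie_algebra L \<longleftrightarrow>
     finite_dimensional_vector_space (lscale L) (lbasis L) \<and>
     (\<forall>x y z. lbracket L (x + y) z = lbracket L x z + lbracket L y z) \<and>
     (\<forall>x y z. lbracket L x (y + z) = lbracket L x y + lbracket L x z) \<and>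
     (\<forall>a x y. lbracket L (lscale L a x) y = lscale L a (lbracket L x y)) \<and>
     (\<forall>a x y. lbracket L x (lscale L a y) = lscale L a (lbracket L x y)) \<and>
     (\<forall>x. lbracket L x x = 0) \<and>
     (\<forall>x y z. lbracket L x (lbracket L y z) + lbracket L y (lbracket L z x)
              + lbracket L z (lbracket L x y) = 0) \<and>
     (\<forall>x y. lbracket L (lpow L x) y = (lbracket L x ^^ CHAR('k)) y) \<and>
     (\<forall>a x. lpow L (lscale L a x) = lscale L (a ^ CHAR('k)) (lpow L x)) \<and>
     (\<forall>x y. lpow L (x + y) = lpow L x + lpow L y +
        (\<Sum>i = 1..<CHAR('k). lscale L (1 / of_nat i)
           (jacobson_coeff L x y (CHAR('k) - 1) (i - 1))))"

definition elementary_subalgebra :: "('k::field, 'g::ab_group_add) lie \<Rightarrow> 'g set \<Rightarrow> bool" where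
  "elementary_subalgebra L \<epsilon> \<longleftrightarrow> module.subspace (lscale L) \<epsilon> \<and>
     (\<forall>x\<in>\<epsilon>. \<forall>y\<in>\<epsilon>. lbracket L x y = 0) \<and> (\<forall>x\<in>\<epsilon>. lpow L x = 0)"

definition elementary_subalgebras :: "('k::field, 'g::ab_group_add) lie \<Rightarrow> nat \<Rightarrow> 'g set set" where
  "elementary_subalgebras L r =
     {\<epsilon>. elementary_subalgebra L \<epsilon> \<and> vector_space.dim (lscale L) \<epsilon> = r}"


section \<open>Restricted enveloping algebras and their modules\<close>

text \<open>Noncommutative polynomials in letters from \<open>S\<close>: finitely supported coefficient
  functions on the words over \<open>S\<close>, with the concatenation product.\<close>

definition free_algebra :: "'g set \<Rightarrow> ('g list \<Rightarrow> 'k::field) ring" where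
  "free_algebra S =
     \<lparr>carrier = {f. finite {w. f w \<noteq> 0} \<and> {w. f w \<noteq> 0} \<subseteq> lists S},
      monoid.mult = (\<lambda>f h w. \<Sum>i\<le>length w. f (take i w) * h (drop i w)),
      one = (\<lambda>w. if w = [] then 1 else 0),
      zero = (\<lambda>w. 0),
      add = (\<lambda>f h w. f w + h w)\<rparr>"

definition monomial_word :: "'g list \<Rightarrow> 'g list \<Rightarrow> 'k::field" where
  "monomial_word v = (\<lambda>w. if w = v then 1 else 0)"

text \<open>The first two families of relations turn the free algebra on the set \<open>S\<close> into the tensor
  algebra of the vector space \<open>S\<close>; the other two are \<open>x y - y x = [x, y]\<close> and
  \<open>x ^ p = x\<^sup>[\<^sup>p\<^sup>]\<close>.\<close>

definition u_relations :: "('k::field, 'g::ab_group_add) lie \<Rightarrow> 'g set \<Rightarrow> ('g list \<Rightarrow> 'k) set" where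
  "u_relations L S =
     {\<lambda>w. monomial_word [x + y] w - monomial_word [x] w - monomial_word [y] w
        | x y. x \<in> S \<and> y \<in> S} \<union>
     {\<lambda>w. monomial_word [lscale L a x] w - a * monomial_word [x] w | a x. x \<in> S} \<union>
     {\<lambda>w. monomial_word [x, y] w - monomial_word [y, x] w - monomial_word [lbracket L x y] w
        | x y. x \<in> S \<and> y \<in> S} \<union>
     {\<lambda>w. monomial_word (replicate CHAR('k) x) w - monomial_word [lpow L x] w | x. x \<in> S}"

definition u_ideal :: "('k::field, 'g::ab_group_add) lie \<Rightarrow> 'g set \<Rightarrow> ('g list \<Rightarrow> 'k) set" where
  "u_ideal L S = genideal (free_algebra S) (u_relations L S)"

text \<open>The restricted enveloping algebra of the restricted subalgebra \<open>S\<close>; the case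
  \<open>S = UNIV\<close> is that of the whole Lie algebra.\<close>

definition u_algebra :: "('k::field, 'g::ab_group_add) lie \<Rightarrow> 'g set \<Rightarrow> ('g list \<Rightarrow> 'k) set ring" where
  "u_algebra L S = free_algebra S Quot u_ideal L S"

definition u_class :: "('k::field, 'g::ab_group_add) lie \<Rightarrow> ('g list \<Rightarrow> 'k) \<Rightarrow> ('g list \<Rightarrow> 'k) set" where
  "u_class L f = u_ideal L UNIV +>\<^bsub>free_algebra UNIV\<^esub> f"

definition u_gen :: "('k::field, 'g::ab_group_add) lie \<Rightarrow> 'g \<Rightarrow> ('g list \<Rightarrow> 'k) set" where
  "u_gen L x = u_class L (monomial_word [x])"

record ('k, 'g, 'm) umod =
  mscale :: "'k \<Rightarrow> 'm \<Rightarrow> 'm"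
  mbasis :: "'m set"
  mact :: "('g list \<Rightarrow> 'k) set \<Rightarrow> 'm \<Rightarrow> 'm"

definition u_module :: "('k::field, 'g::ab_group_add) lie \<Rightarrow> ('k, 'g, 'm::ab_group_add) umod \<Rightarrow> bool" where
  "u_module L M \<longleftrightarrow>
     finite_dimensional_vector_space (mscale M) (mbasis M) \<and>
     (\<forall>a\<in>carrier (u_algebra L UNIV). \<forall>m n. mact M a (m + n) = mact M a m + mact M a n) \<and>
     (\<forall>a\<in>carrier (u_algebra L UNIV). \<forall>b\<in>carrier (u_algebra L UNIV). \<forall>m.
        mact M (a \<oplus>\<^bsub>u_algebra L UNIV\<^esub> b) m = mact M a m + mact M b m \<and>
        mact M (a \<otimes>\<^bsub>u_algebra L UNIV\<^esub> b) m = mact M a (mact M b m)) \<and>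
     (\<forall>m. mact M \<one>\<^bsub>u_algebra L UNIV\<^esub> m = m) \<and>
     (\<forall>c m. mact M (u_class L (\<lambda>w. c * monomial_word [] w)) m = mscale M c m)"

text \<open>Action of the enveloping algebra of a subalgebra \<open>\<epsilon>\<close> by restriction. Its elements are cosets
  of \<open>u_ideal L \<epsilon>\<close>, and \<open>C \<mapsto> u_ideal L UNIV + C\<close> is the canonical map to the enveloping
  algebra of the whole Lie algebra, sending the class of \<open>f\<close> to the class of \<open>f\<close>.\<close>

definition restrict_act :: "('k::field, 'g::ab_group_add) lie \<Rightarrow> ('k, 'g, 'm::ab_group_add) umod \<Rightarrow>
    ('g list \<Rightarrow> 'k) set \<Rightarrow> 'm \<Rightarrow> 'm" where
  "restrict_act L M C m = mact M (u_ideal L UNIV <+>\<^bsub>free_algebra UNIV\<^esub> C) m"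

definition left_ideal :: "('a, 'b) ring_scheme \<Rightarrow> 'a set \<Rightarrow> bool" where
  "left_ideal R I \<longleftrightarrow> additive_subgroup I R \<and> (\<forall>a\<in>carrier R. \<forall>x\<in>I. a \<otimes>\<^bsub>R\<^esub> x \<in> I)"

definition maximal_left_ideal :: "('a, 'b) ring_scheme \<Rightarrow> 'a set \<Rightarrow> bool" where
  "maximal_left_ideal R I \<longleftrightarrow> left_ideal R I \<and> I \<noteq> carrier R \<and>
     (\<forall>K. left_ideal R K \<and> I \<subseteq> K \<longrightarrow> K = I \<or> K = carrier R)"

definition jacobson_radical :: "('a, 'b) ring_scheme \<Rightarrow> 'a set" where
  "jacobson_radical R = {a \<in> carrier R. \<forall>I. maximal_left_ideal R I \<longrightarrow> a \<in> I}"

primrec ideal_power :: "('a, 'b) ring_scheme \<Rightarrow> 'a set \<Rightarrow> nat \<Rightarrow> 'a set" where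
  "ideal_power R I 0 = carrier R"
| "ideal_power R I (Suc n) = ideal_prod R I (ideal_power R I n)"

definition Rad :: "('k::field, 'g::ab_group_add) lie \<Rightarrow> ('k, 'g, 'm::ab_group_add) umod \<Rightarrow>
    nat \<Rightarrow> 'g set \<Rightarrow> 'm set" where
  "Rad L M j \<epsilon> = module.span (mscale M)
     {restrict_act L M a m | a m.
        a \<in> ideal_power (u_algebra L \<epsilon>) (jacobson_radical (u_algebra L \<epsilon>)) j}"

definition Soc :: "('k::field, 'g::ab_group_add) lie \<Rightarrow> ('k, 'g, 'm::ab_group_add) umod \<Rightarrow>
    nat \<Rightarrow> 'g set \<Rightarrow> 'm set" where
  "Soc L M j \<epsilon> =
     {m. \<forall>a \<in> ideal_power (u_algebra L \<epsilon>) (jacobson_radical (u_algebra L \<epsilon>)) j.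
        restrict_act L M a m = 0}"

definition constant_radical_rank :: "('k::field, 'g::ab_group_add) lie \<Rightarrow>
    ('k, 'g, 'm::ab_group_add) umod \<Rightarrow> nat \<Rightarrow> nat \<Rightarrow> bool" where
  "constant_radical_rank L M r j \<longleftrightarrow>
     (\<forall>\<epsilon>\<in>elementary_subalgebras L r. \<forall>\<epsilon>'\<in>elementary_subalgebras L r.
        vector_space.dim (mscale M) (Rad L M j \<epsilon>) = vector_space.dim (mscale M) (Rad L M j \<epsilon>'))"

definition constant_socle_rank :: "('k::field, 'g::ab_group_add) lie \<Rightarrow>
    ('k, 'g, 'm::ab_group_add) umod \<Rightarrow> nat \<Rightarrow> nat \<Rightarrow> bool" where
  "constant_socle_rank L M r j \<longleftrightarrow>
     (\<forall>\<epsilon>\<in>elementary_subalgebras L r. \<forall>\<epsilon>'\<in>elementary_subalgebras L r.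
        vector_space.dim (mscale M) (Soc L M j \<epsilon>) = vector_space.dim (mscale M) (Soc L M j \<epsilon>'))"


section \<open>Varieties and subsheaves of \<open>M \<otimes> \<O>\<close>\<close>

text \<open>A variety is its set of closed points with the Zariski topology and the sheaf of regular
  functions. Throughout, a section over \<open>U\<close> is a function on all points that vanishes outside
  \<open>U\<close>, so that \<open>restr V\<close> is the restriction to an open subset \<open>V\<close>, sums and products of sections
  are pointwise, and a product with a section over \<open>V\<close> is a section over \<open>V\<close>.\<close>

record ('x, 'k) variety =
  zariski :: "'x topology"
  regular :: "'x set \<Rightarrow> ('x \<Rightarrow> 'k) set"

definition restr :: "'x set \<Rightarrow> ('x \<Rightarrow> 'a::zero) \<Rightarrow> 'x \<Rightarrow> 'a" where
  "restr V s = (\<lambda>x. if x \<in> V then s x else 0)"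

definition lincomb :: "('k \<Rightarrow> 'm \<Rightarrow> 'm) \<Rightarrow> nat \<Rightarrow> (nat \<Rightarrow> 'x \<Rightarrow> 'k) \<Rightarrow> (nat \<Rightarrow> 'x \<Rightarrow> 'm) \<Rightarrow>
    'x \<Rightarrow> 'm::ab_group_add" where
  "lincomb sc n f e = (\<lambda>x. \<Sum>i<n. sc (f i x) (e i x))"

text \<open>The elements \<open>\<Sum> b \<otimes> f\<^sub>b\<close> of \<open>M \<otimes> \<O>(U)\<close>, for \<open>b\<close> in a basis \<open>B\<close> of \<open>M\<close>, as \<open>M\<close>-valued
  functions.\<close>

definition tensor_sections :: "('k \<Rightarrow> 'm \<Rightarrow> 'm) \<Rightarrow> 'm set \<Rightarrow> ('x, 'k) variety \<Rightarrow> 'x set \<Rightarrow>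
    ('x \<Rightarrow> 'm::ab_group_add) set" where
  "tensor_sections sc B X U = {\<lambda>x. \<Sum>b\<in>B. sc (f b x) b | f. \<forall>b\<in>B. f b \<in> regular X U}"

text \<open>Sheaves of \<open>\<O>\<close>-submodules of \<open>M \<otimes> \<O>\<close>. The first clause only normalises the value on sets
  that are not open.\<close>

definition submodule_sheaf :: "('k \<Rightarrow> 'm \<Rightarrow> 'm) \<Rightarrow> 'm set \<Rightarrow> ('x, 'k) variety \<Rightarrow>
    ('x set \<Rightarrow> ('x \<Rightarrow> 'm::ab_group_add) set) \<Rightarrow> bool" where
  "submodule_sheaf sc B X F \<longleftrightarrow>
     (\<forall>U. \<not> openin (zariski X) U \<longrightarrow> F U = {}) \<and>
     (\<forall>U. openin (zariski X) U \<longrightarrow>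
        F U \<subseteq> tensor_sections sc B X U \<and>
        (\<lambda>x. 0) \<in> F U \<and>
        (\<forall>s\<in>F U. \<forall>t\<in>F U. (\<lambda>x. s x + t x) \<in> F U) \<and>
        (\<forall>f\<in>regular X U. \<forall>s\<in>F U. (\<lambda>x. sc (f x) (s x)) \<in> F U) \<and>
        (\<forall>V s. openin (zariski X) V \<and> V \<subseteq> U \<and> s \<in> F U \<longrightarrow> restr V s \<in> F V) \<and>
        (\<forall>s\<in>tensor_sections sc B X U.
           (\<forall>x\<in>U. \<exists>V. openin (zariski X) V \<and> x \<in> V \<and> V \<subseteq> U \<and> restr V s \<in> F V) \<longrightarrow> s \<in> F U))"

text \<open>A submodule sheaf of \<open>M \<otimes> \<O>\<close> is coherent iff locally it is the subsheaf generated by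
  finitely many sections, \<open>\<O>\<close> being noetherian.\<close>

definition coherent_subsheaf :: "('k \<Rightarrow> 'm \<Rightarrow> 'm) \<Rightarrow> 'm set \<Rightarrow> ('x, 'k) variety \<Rightarrow>
    ('x set \<Rightarrow> ('x \<Rightarrow> 'm::ab_group_add) set) \<Rightarrow> bool" where
  "coherent_subsheaf sc B X F \<longleftrightarrow> submodule_sheaf sc B X F \<and>
     (\<forall>x\<in>topspace (zariski X). \<exists>U n e. openin (zariski X) U \<and> x \<in> U \<and> (\<forall>i<n. e i \<in> F U) \<and>
        (\<forall>V s. openin (zariski X) V \<and> V \<subseteq> U \<and> s \<in> F V \<longrightarrow>
           (\<forall>y\<in>V. \<exists>W f. openin (zariski X) W \<and> y \<in> W \<and> W \<subseteq> V \<and>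
              (\<forall>i<n. f i \<in> regular X W) \<and> restr W s = lincomb sc n f e)))"

text \<open>Algebraic vector bundle: locally free of finite rank. The bijection is the isomorphism
  from \<open>\<O>\<^sup>n\<close> to \<open>F\<close> over \<open>U\<close> that sends the standard basis to \<open>e\<close>.\<close>

definition vector_bundle :: "('k \<Rightarrow> 'm \<Rightarrow> 'm) \<Rightarrow> 'm set \<Rightarrow> ('x, 'k) variety \<Rightarrow>
    ('x set \<Rightarrow> ('x \<Rightarrow> 'm::ab_group_add) set) \<Rightarrow> bool" where
  "vector_bundle sc B X F \<longleftrightarrow> submodule_sheaf sc B X F \<and>
     (\<forall>x\<in>topspace (zariski X). \<exists>U n e. openin (zariski X) U \<and> x \<in> U \<and> (\<forall>i<n. e i \<in> F U) \<and>
        (\<forall>V. openin (zariski X) V \<and> V \<subseteq> U \<longrightarrow>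
           bij_betw (\<lambda>f. lincomb sc n f e) ({..<n} \<rightarrow>\<^sub>E regular X V) (F V)))"

text \<open>The fibre \<open>F\<^sub>x / \<mm>\<^sub>x F\<^sub>x\<close>: local sections at \<open>x\<close>, identified when near \<open>x\<close> their difference is
  \<open>\<Sum> f\<^sub>i u\<^sub>i\<close> with \<open>f\<^sub>i(x) = 0\<close> and \<open>u\<^sub>i\<close> sections of \<open>F\<close>.\<close>

definition local_sections :: "('x, 'k) variety \<Rightarrow> ('x set \<Rightarrow> ('x \<Rightarrow> 'm) set) \<Rightarrow> 'x \<Rightarrow>
    ('x set \<times> ('x \<Rightarrow> 'm)) set" where
  "local_sections X F x = {(U, s). openin (zariski X) U \<and> x \<in> U \<and> s \<in> F U}"

definition fiber_rel :: "('k::zero \<Rightarrow> 'm \<Rightarrow> 'm) \<Rightarrow> ('x, 'k) variety \<Rightarrow>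
    ('x set \<Rightarrow> ('x \<Rightarrow> 'm::ab_group_add) set) \<Rightarrow> 'x \<Rightarrow>
    (('x set \<times> ('x \<Rightarrow> 'm)) \<times> ('x set \<times> ('x \<Rightarrow> 'm))) set" where
  "fiber_rel sc X F x = {((U, s), (V, t)).
     (U, s) \<in> local_sections X F x \<and> (V, t) \<in> local_sections X F x \<and>
     (\<exists>W n f u. openin (zariski X) W \<and> x \<in> W \<and> W \<subseteq> U \<inter> V \<and>
        (\<forall>i<n. f i \<in> regular X W \<and> f i x = 0 \<and> u i \<in> F W) \<and>
        (\<forall>y\<in>W. s y - t y = lincomb sc n f u y))}"

definition fiber :: "('k::zero \<Rightarrow> 'm \<Rightarrow> 'm) \<Rightarrow> ('x, 'k) variety \<Rightarrow>
    ('x set \<Rightarrow> ('x \<Rightarrow> 'm::ab_group_add) set) \<Rightarrow> 'x \<Rightarrow> ('x set \<times> ('x \<Rightarrow> 'm)) set set" where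
  "fiber sc X F x = local_sections X F x // fiber_rel sc X F x"

definition fiber_add :: "('k::zero \<Rightarrow> 'm \<Rightarrow> 'm) \<Rightarrow> ('x, 'k) variety \<Rightarrow>
    ('x set \<Rightarrow> ('x \<Rightarrow> 'm::ab_group_add) set) \<Rightarrow> 'x \<Rightarrow>
    ('x set \<times> ('x \<Rightarrow> 'm)) set \<Rightarrow> ('x set \<times> ('x \<Rightarrow> 'm)) set \<Rightarrow> ('x set \<times> ('x \<Rightarrow> 'm)) set" where
  "fiber_add sc X F x C D = (\<Union>(U, s)\<in>C. \<Union>(V, t)\<in>D.
     fiber_rel sc X F x `` {(U \<inter> V, restr (U \<inter> V) (\<lambda>y. s y + t y))})"

definition fiber_scale :: "('k::zero \<Rightarrow> 'm \<Rightarrow> 'm) \<Rightarrow> ('x, 'k) variety \<Rightarrow>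
    ('x set \<Rightarrow> ('x \<Rightarrow> 'm::ab_group_add) set) \<Rightarrow> 'x \<Rightarrow>
    'k \<Rightarrow> ('x set \<times> ('x \<Rightarrow> 'm)) set \<Rightarrow> ('x set \<times> ('x \<Rightarrow> 'm)) set" where
  "fiber_scale sc X F x c C = (\<Union>(U, s)\<in>C. fiber_rel sc X F x `` {(U, \<lambda>y. sc c (s y))})"

text \<open>The natural map from the fibre of \<open>F\<close> at \<open>x\<close> to the fibre \<open>M\<close> of \<open>M \<otimes> \<O>\<close>, induced by the
  inclusion, sends the class of a section \<open>s\<close> to \<open>s(x)\<close>. It is required to be a well defined
  linear isomorphism onto the subspace \<open>N\<close>.\<close>

definition fiber_naturally_identified :: "('k::zero \<Rightarrow> 'm \<Rightarrow> 'm) \<Rightarrow> ('x, 'k) variety \<Rightarrow>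
    ('x set \<Rightarrow> ('x \<Rightarrow> 'm::ab_group_add) set) \<Rightarrow> 'x \<Rightarrow> 'm set \<Rightarrow> bool" where
  "fiber_naturally_identified sc X F x N \<longleftrightarrow>
     (\<exists>\<phi>. (\<forall>(U, s)\<in>local_sections X F x. \<phi> (fiber_rel sc X F x `` {(U, s)}) = s x) \<and>
          bij_betw \<phi> (fiber sc X F x) N \<and>
          (\<forall>C\<in>fiber sc X F x. \<forall>D\<in>fiber sc X F x.
             fiber_add sc X F x C D \<in> fiber sc X F x \<and>
             \<phi> (fiber_add sc X F x C D) = \<phi> C + \<phi> D) \<and>
          (\<forall>c. \<forall>C\<in>fiber sc X F x.
             fiber_scale sc X F x c C \<in> fiber sc X F x \<and>
             \<phi> (fiber_scale sc X F x c C) = sc c (\<phi> C)))"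

text \<open>Pull-back of a subsheaf along a morphism \<open>q\<close>: the subsheaf of \<open>M \<otimes> \<O>\<close> on the source
  generated by the pulled back sections, i.e. the image of \<open>q\<^sup>*F\<close> in \<open>q\<^sup>*(M \<otimes> \<O>)\<close>. It is \<open>q\<^sup>*F\<close>
  itself when \<open>q\<close> is flat.\<close>

definition pullback :: "('k \<Rightarrow> 'm \<Rightarrow> 'm) \<Rightarrow> 'm set \<Rightarrow> ('y, 'k) variety \<Rightarrow> ('x, 'k) variety \<Rightarrow>
    ('y \<Rightarrow> 'x) \<Rightarrow> ('x set \<Rightarrow> ('x \<Rightarrow> 'm::ab_group_add) set) \<Rightarrow> 'y set \<Rightarrow> ('y \<Rightarrow> 'm) set" where
  "pullback sc B Y X q F V = (if \<not> openin (zariski Y) V then {} else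
     {t \<in> tensor_sections sc B Y V.
        \<forall>y\<in>V. \<exists>W U n h s. openin (zariski Y) W \<and> y \<in> W \<and> W \<subseteq> V \<and>
          openin (zariski X) U \<and> q ` W \<subseteq> U \<and>
          (\<forall>i<n. h i \<in> regular Y W \<and> s i \<in> F U) \<and>
          restr W t = lincomb sc n h (\<lambda>i. s i \<circ> q)})"


section \<open>The variety of elementary subalgebras and its torsor of frames\<close>

text \<open>Polynomials, resp. homogeneous polynomials of a given degree, in the functions from \<open>C\<close>.\<close>

inductive_set polynomials :: "('x \<Rightarrow> 'k::field) set \<Rightarrow> ('x \<Rightarrow> 'k) set" for C where
  const: "(\<lambda>x. c) \<in> polynomials C"
| coord: "y \<in> C \<Longrightarrow> y \<in> polynomials C"
| add: "P \<in> polynomials C \<Longrightarrow> Q \<in> polynomials C \<Longrightarrow> (\<lambda>x. P x + Q x) \<in> polynomials C"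
| mult: "P \<in> polynomials C \<Longrightarrow> Q \<in> polynomials C \<Longrightarrow> (\<lambda>x. P x * Q x) \<in> polynomials C"

inductive homogeneous :: "('x \<Rightarrow> 'k::field) set \<Rightarrow> nat \<Rightarrow> ('x \<Rightarrow> 'k) \<Rightarrow> bool" for C where
  const: "homogeneous C 0 (\<lambda>x. c)"
| coord: "y \<in> C \<Longrightarrow> homogeneous C 1 y"
| add: "homogeneous C d P \<Longrightarrow> homogeneous C d Q \<Longrightarrow> homogeneous C d (\<lambda>x. P x + Q x)"
| mult: "homogeneous C d P \<Longrightarrow> homogeneous C e Q \<Longrightarrow> homogeneous C (d + e) (\<lambda>x. P x * Q x)"

text \<open>\<open>r\<close>-tuples of elements are lists of length \<open>r\<close>, indexed from \<open>0\<close>;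
  \<open>coord_fun L x s\<close> is the function \<open>Y\<^sub>i\<^sub>,\<^sub>s\<close> for the basis element \<open>x = x\<^sub>i\<close>.\<close>

definition coord_fun :: "('k::field, 'g::ab_group_add) lie \<Rightarrow> 'g \<Rightarrow> nat \<Rightarrow> 'g list \<Rightarrow> 'k" where
  "coord_fun L x s X = module.representation (lscale L) (lbasis L) (X ! s) x"

definition coord_funs :: "('k::field, 'g::ab_group_add) lie \<Rightarrow> nat \<Rightarrow> ('g list \<Rightarrow> 'k) set" where
  "coord_funs L r = {coord_fun L x s | x s. x \<in> lbasis L \<and> s < r}"

definition frames :: "('k::field, 'g::ab_group_add) lie \<Rightarrow> nat \<Rightarrow> 'g list set" where
  "frames L r = {X. length X = r \<and> distinct X \<and> \<not> module.dependent (lscale L) (set X)}"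

text \<open>Pluecker coordinates of the span of a frame, determined up to a common factor. Listing them
  for all \<open>r\<close>-tuples \<open>b\<close> of basis elements, not only the increasing ones, merely adds zeros and
  signs.\<close>

definition pluecker :: "('k::field, 'g::ab_group_add) lie \<Rightarrow> nat \<Rightarrow> 'g list \<Rightarrow> 'g list \<Rightarrow> 'k" where
  "pluecker L r b X = Determinant.det (Matrix.mat r r (\<lambda>(s, i). coord_fun L (b ! i) s X))"

definition pluecker_funs :: "('k::field, 'g::ab_group_add) lie \<Rightarrow> nat \<Rightarrow> ('g list \<Rightarrow> 'k) set" where
  "pluecker_funs L r = {pluecker L r b | b. b \<in> lists (lbasis L) \<and> length b = r}"

definition frame_span :: "('k::field, 'g::ab_group_add) lie \<Rightarrow> 'g list \<Rightarrow> 'g set" where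
  "frame_span L X = module.span (lscale L) (set X)"

text \<open>A locally closed set \<open>Z\<close> of \<open>r\<close>-tuples as a subvariety of affine space.\<close>

definition tuple_variety :: "('k::field, 'g::ab_group_add) lie \<Rightarrow> nat \<Rightarrow> 'g list set \<Rightarrow>
    ('g list, 'k) variety" where
  "tuple_variety L r Z =
     (let T = topology_generated_by {{X \<in> Z. P X \<noteq> 0} | P. P \<in> polynomials (coord_funs L r)} in
      \<lparr>zariski = T,
       regular = (\<lambda>U. {f. (\<forall>X. X \<notin> U \<longrightarrow> f X = 0) \<and>
         (\<forall>X\<in>U. \<exists>W P Q. openin T W \<and> X \<in> W \<and> W \<subseteq> U \<and>
            P \<in> polynomials (coord_funs L r) \<and> Q \<in> polynomials (coord_funs L r) \<and>
            (\<forall>X'\<in>W. Q X' \<noteq> 0 \<and> f X' = P X' / Q X'))})\<rparr>)"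

text \<open>A locally closed set \<open>Z\<close> of \<open>r\<close>-dimensional subspaces as a subvariety of the Grassmannian,
  hence of projective space through the Pluecker embedding: open sets are given by nonvanishing of
  homogeneous polynomials, regular functions are locally quotients of homogeneous polynomials of
  the same degree. Both are evaluated at any frame of the subspace.\<close>

definition grassmannian_subvariety :: "('k::field, 'g::ab_group_add) lie \<Rightarrow> nat \<Rightarrow> 'g set set \<Rightarrow>
    ('g set, 'k) variety" where
  "grassmannian_subvariety L r Z =
     (let T = topology_generated_by
        {{\<epsilon> \<in> Z. \<exists>X\<in>frames L r. frame_span L X = \<epsilon> \<and> P X \<noteq> 0}
           | P d. homogeneous (pluecker_funs L r) d P} in
      \<lparr>zariski = T,
       regular = (\<lambda>U. {f. (\<forall>\<epsilon>. \<epsilon> \<notin> U \<longrightarrow> f \<epsilon> = 0) \<and>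
         (\<forall>\<epsilon>\<in>U. \<exists>W d P Q. openin T W \<and> \<epsilon> \<in> W \<and> W \<subseteq> U \<and>
            homogeneous (pluecker_funs L r) d P \<and> homogeneous (pluecker_funs L r) d Q \<and>
            (\<forall>X\<in>frames L r. frame_span L X \<in> W \<longrightarrow>
               Q X \<noteq> 0 \<and> f (frame_span L X) = P X / Q X))})\<rparr>)"

definition elementary_variety :: "('k::field, 'g::ab_group_add) lie \<Rightarrow> nat \<Rightarrow> ('g set, 'k) variety" where
  "elementary_variety L r = grassmannian_subvariety L r (elementary_subalgebras L r)"

definition elementary_frames :: "('k::field, 'g::ab_group_add) lie \<Rightarrow> nat \<Rightarrow> 'g list set" where
  "elementary_frames L r = {X \<in> frames L r.
     (\<forall>x\<in>set X. \<forall>y\<in>set X. lbracket L x y = 0) \<and> (\<forall>x\<in>set X. lpow L x = 0)}"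

definition frame_variety :: "('k::field, 'g::ab_group_add) lie \<Rightarrow> nat \<Rightarrow> ('g list, 'k) variety" where
  "frame_variety L r = tuple_variety L r (elementary_frames L r)"


section \<open>Image and kernel sheaves\<close>

definition Theta :: "('k::field, 'g::ab_group_add) lie \<Rightarrow> ('k, 'g, 'm::ab_group_add) umod \<Rightarrow>
    nat \<Rightarrow> ('g list \<Rightarrow> 'm) \<Rightarrow> 'g list \<Rightarrow> 'm" where
  "Theta L M s t = (\<lambda>X. \<Sum>x\<in>lbasis L. mscale M (coord_fun L x s X) (mact M (u_gen L x) (t X)))"

definition exponents :: "nat \<Rightarrow> nat \<Rightarrow> nat list set" where
  "exponents r j = {a. length a = r \<and> sum_list a = j}"

definition Theta_power :: "('k::field, 'g::ab_group_add) lie \<Rightarrow> ('k, 'g, 'm::ab_group_add) umod \<Rightarrow>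
    nat list \<Rightarrow> ('g list \<Rightarrow> 'm) \<Rightarrow> 'g list \<Rightarrow> 'm" where
  "Theta_power L M a = foldr (\<lambda>s T. (Theta L M s ^^ (a ! s)) \<circ> T) [0..<length a] id"

definition Im_frames :: "('k::field, 'g::ab_group_add) lie \<Rightarrow> ('k, 'g, 'm::ab_group_add) umod \<Rightarrow>
    nat \<Rightarrow> nat \<Rightarrow> 'g list set \<Rightarrow> ('g list \<Rightarrow> 'm) set" where
  "Im_frames L M r j V = (if \<not> openin (zariski (frame_variety L r)) V then {} else
     {t \<in> tensor_sections (mscale M) (mbasis M) (frame_variety L r) V.
        \<forall>X\<in>V. \<exists>W u. openin (zariski (frame_variety L r)) W \<and> X \<in> W \<and> W \<subseteq> V \<and>
          (\<forall>a\<in>exponents r j. u a \<in> tensor_sections (mscale M) (mbasis M) (frame_variety L r) W) \<and>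
          restr W t = (\<lambda>X'. \<Sum>a\<in>exponents r j. Theta_power L M a (u a) X')})"

definition Ker_frames :: "('k::field, 'g::ab_group_add) lie \<Rightarrow> ('k, 'g, 'm::ab_group_add) umod \<Rightarrow>
    nat \<Rightarrow> nat \<Rightarrow> 'g list set \<Rightarrow> ('g list \<Rightarrow> 'm) set" where
  "Ker_frames L M r j V = (if \<not> openin (zariski (frame_variety L r)) V then {} else
     {t \<in> tensor_sections (mscale M) (mbasis M) (frame_variety L r) V.
        \<forall>a\<in>exponents r j. Theta_power L M a t = (\<lambda>X. 0)})"

definition descent :: "('k::field, 'g::ab_group_add) lie \<Rightarrow> ('k, 'g, 'm::ab_group_add) umod \<Rightarrow>
    nat \<Rightarrow> ('g list set \<Rightarrow> ('g list \<Rightarrow> 'm) set) \<Rightarrow> 'g set set \<Rightarrow> ('g set \<Rightarrow> 'm) set" where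
  "descent L M r G = (THE F.
     coherent_subsheaf (mscale M) (mbasis M) (elementary_variety L r) F \<and>
     pullback (mscale M) (mbasis M) (frame_variety L r) (elementary_variety L r)
       (frame_span L) F = G)"

definition Im_sheaf :: "('k::field, 'g::ab_group_add) lie \<Rightarrow> ('k, 'g, 'm::ab_group_add) umod \<Rightarrow>
    nat \<Rightarrow> nat \<Rightarrow> 'g set set \<Rightarrow> ('g set \<Rightarrow> 'm) set" where
  "Im_sheaf L M r j = descent L M r (Im_frames L M r j)"

definition Ker_sheaf :: "('k::field, 'g::ab_group_add) lie \<Rightarrow> ('k, 'g, 'm::ab_group_add) umod \<Rightarrow>
    nat \<Rightarrow> nat \<Rightarrow> 'g set set \<Rightarrow> ('g set \<Rightarrow> 'm) set" where
  "Ker_sheaf L M r j = descent L M r (Ker_frames L M r j)"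

end

theory Submission
  imports Defs
begin

text \<open>Write \<open>N(\<epsilon>)\<close> for the subspace \<open>Rad L M j \<epsilon>\<close>, respectively \<open>Soc L M j \<epsilon>\<close>, of \<open>M\<close>. Everything
  follows from one description: when the dimension of \<open>N(\<epsilon>)\<close> is constant, the image (respectively
  kernel) sheaf consists of all \<open>M\<close>-valued regular functions whose value at each \<open>\<epsilon>\<close> lies in
  \<open>N(\<epsilon>)\<close>, and such a sheaf is a vector bundle with fibre \<open>N(\<epsilon>)\<close>.

  Let \<open>X\<^sub>1, \<dots>, X\<^sub>r\<close> be a basis of an elementary subalgebra \<open>\<epsilon>\<close>. The algebra \<open>u(\<epsilon>)\<close> is
  commutative and generated by nilpotent elements, so its Jacobson radical is the augmentation ideal
  (\<open>jacobson_radical_eq\<close>), and the \<open>j\<close>-th power of that ideal is generated by the monomials of degree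
  \<open>j\<close> in the \<open>X\<^sub>s\<close>. Hence the radical is the sum of the images of these monomials and the socle is
  their common kernel (\<open>Rad_eq\<close>, \<open>Soc_eq\<close>). Since \<open>\<Theta>\<^sub>s\<close> acts at the frame \<open>X\<close> as \<open>X\<^sub>s\<close>, these are the
  pointwise images and kernels of the operators that define the two sheaves.

  If vectors that vary regularly are linearly independent
  at a point, then near that point there are regular functionals dual to them (\<open>regular_dual_family\<close>).
  Consequently a span of constant dimension, or a common kernel of constant dimension, is spanned near
  each point by independent regular sections (\<open>frame_of_constant_rank_span\<close>,
  \<open>frame_of_constant_rank_kernel\<close>), and every regular function with values in \<open>N\<close> is a combination of
  these sections with regular coefficients (\<open>frame_coefficients\<close>). This gives local freeness and the
  fibres (\<open>vector_bundle_subspace_sheaf\<close>, \<open>fiber_subspace_sheaf\<close>).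

  Where a Pluecker coordinate does not vanish, the reduced row echelon form with respect
  to it is a regular choice of a frame, by Cramer's rule; so the map \<open>q\<close> from frames to subalgebras has
  local sections (\<open>local_section_exists\<close>). Composition with them turns a statement about the pulled
  back function \<open>s \<circ> q\<close> into one about \<open>s\<close>, which shows that a subsheaf is determined by its
  pull-back and that the functions with values in \<open>N\<close> form the descended sheaf
  (\<open>descent_subspace_sheaf\<close>).\<close>

section \<open>Sheaves of regular functions\<close>

text \<open>What the proof uses of the structure sheaf of a variety: regular functions form a sheaf of rings,
  the nonvanishing locus of a regular function is open, and there the function is invertible.\<close>

locale function_sheaf =
  fixes X :: "('x, 'k::field) variety"
  assumes regular_outside: "f \<in> regular X U \<Longrightarrow> x \<notin> U \<Longrightarrow> f x = 0"
    and regular_restr: "f \<in> regular X U \<Longrightarrow> openin (zariski X) V \<Longrightarrow> V \<subseteq> U \<Longrightarrow> restr V f \<in> regular X V"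
    and regular_local: "(\<And>x. x \<notin> U \<Longrightarrow> f x = 0) \<Longrightarrow>
      (\<And>x. x \<in> U \<Longrightarrow> \<exists>V. openin (zariski X) V \<and> x \<in> V \<and> V \<subseteq> U \<and> restr V f \<in> regular X V) \<Longrightarrow>
      f \<in> regular X U"
    and regular_const: "openin (zariski X) U \<Longrightarrow> restr U (\<lambda>x. c) \<in> regular X U"
    and regular_add: "f \<in> regular X U \<Longrightarrow> g \<in> regular X U \<Longrightarrow> (\<lambda>x. f x + g x) \<in> regular X U"
    and regular_mult: "f \<in> regular X U \<Longrightarrow> g \<in> regular X U \<Longrightarrow> (\<lambda>x. f x * g x) \<in> regular X U"
    and open_nonvanishing: "openin (zariski X) U \<Longrightarrow> f \<in> regular X U \<Longrightarrow>
      openin (zariski X) {x \<in> U. f x \<noteq> 0}"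
    and regular_inverse: "f \<in> regular X U \<Longrightarrow> (\<And>x. x \<in> U \<Longrightarrow> f x \<noteq> 0) \<Longrightarrow>
      (\<lambda>x. inverse (f x)) \<in> regular X U"
begin

abbreviation is_open :: "'x set \<Rightarrow> bool" where "is_open U \<equiv> openin (zariski X) U"

text \<open>Regularity regardless of the values outside of \<open>U\<close>, so that algebra can be done with plain functions.\<close>

definition regular_on :: "'x set \<Rightarrow> ('x \<Rightarrow> 'k) \<Rightarrow> bool" where
  "regular_on U f \<longleftrightarrow> restr U f \<in> regular X U"

lemma regular_iff: "f \<in> regular X U \<longleftrightarrow> regular_on U f \<and> (\<forall>x. x \<notin> U \<longrightarrow> f x = 0)"
proof -
  have "restr U f = f" if "\<forall>x. x \<notin> U \<longrightarrow> f x = 0"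
    using that by (auto simp: restr_def fun_eq_iff)
  then show ?thesis
    using regular_outside[of f U] unfolding regular_on_def
    by (intro iffI conjI allI impI) (simp_all)
qed

lemma regular_on_cong: "(\<And>x. x \<in> U \<Longrightarrow> f x = g x) \<Longrightarrow> regular_on U f \<longleftrightarrow> regular_on U g"
  unfolding regular_on_def by (rule arg_cong[where f = "\<lambda>h. h \<in> regular X U"]) (auto simp: restr_def)

lemma regular_on_subset:
  assumes "regular_on U f" "is_open V" "V \<subseteq> U" shows "regular_on V f"
proof -
  have "restr V (restr U f) = restr V f" using assms(3) by (auto simp: restr_def fun_eq_iff)
  then show ?thesis using assms regular_restr[of "restr U f" U V] unfolding regular_on_def by simp
qed

lemma regular_on_local:
  assumes "\<And>x. x \<in> U \<Longrightarrow> \<exists>V. is_open V \<and> x \<in> V \<and> V \<subseteq> U \<and> regular_on V f"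
  shows "regular_on U f"
  unfolding regular_on_def
proof (rule regular_local)
  fix x assume "x \<in> U"
  from assms[OF this] obtain V where V: "is_open V" "x \<in> V" "V \<subseteq> U" "regular_on V f" by blast
  have "restr V (restr U f) = restr V f" using V(3) by (auto simp: restr_def fun_eq_iff)
  with V show "\<exists>V. is_open V \<and> x \<in> V \<and> V \<subseteq> U \<and> restr V (restr U f) \<in> regular X V"
    by (intro exI[of _ V]) (simp add: regular_on_def)
qed (simp add: restr_def)

lemma regular_on_const: "is_open U \<Longrightarrow> regular_on U (\<lambda>x. c)"
  unfolding regular_on_def by (rule regular_const)

lemma regular_on_add:
  assumes "regular_on U f" "regular_on U g" shows "regular_on U (\<lambda>x. f x + g x)"
proof -
  have "restr U (\<lambda>x. f x + g x) = (\<lambda>x. restr U f x + restr U g x)" by (auto simp: restr_def)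
  then show ?thesis using regular_add[OF assms[unfolded regular_on_def]] by (simp add: regular_on_def)
qed

lemma regular_on_mult:
  assumes "regular_on U f" "regular_on U g" shows "regular_on U (\<lambda>x. f x * g x)"
proof -
  have "restr U (\<lambda>x. f x * g x) = (\<lambda>x. restr U f x * restr U g x)" by (auto simp: restr_def)
  then show ?thesis using regular_mult[OF assms[unfolded regular_on_def]] by (simp add: regular_on_def)
qed

lemma regular_on_divide:
  assumes "regular_on U f" "regular_on U g" "\<And>x. x \<in> U \<Longrightarrow> g x \<noteq> 0"
  shows "regular_on U (\<lambda>x. f x / g x)"
proof -
  have "restr U (\<lambda>x. inverse (g x)) = (\<lambda>x. inverse (restr U g x))" by (auto simp: restr_def)
  moreover have "(\<lambda>x. inverse (restr U g x)) \<in> regular X U"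
    using assms(2,3) unfolding regular_on_def by (intro regular_inverse) (auto simp: restr_def)
  ultimately have "regular_on U (\<lambda>x. inverse (g x))" by (simp add: regular_on_def)
  from regular_on_mult[OF assms(1) this] show ?thesis by (simp add: divide_inverse)
qed

lemma regular_on_diff:
  assumes "is_open U" "regular_on U f" "regular_on U g" shows "regular_on U (\<lambda>x. f x - g x)"
  using regular_on_add[OF assms(2) regular_on_mult[OF regular_on_const[OF assms(1), of "-1"] assms(3)]]
  by simp

lemma regular_on_sum:
  assumes "is_open U" "\<And>i. i \<in> I \<Longrightarrow> regular_on U (f i)"
  shows "regular_on U (\<lambda>x. \<Sum>i\<in>I. f i x)"
  using assms(2)
proof (induction I rule: infinite_finite_induct)
  case (insert i I)
  then show ?case by (simp add: regular_on_add)
qed (simp_all add: regular_on_const[OF assms(1)])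

lemma open_nonvanishing_on:
  assumes "is_open U" "regular_on U f" shows "is_open {x \<in> U. f x \<noteq> 0}"
proof -
  have "{x \<in> U. f x \<noteq> 0} = {x \<in> U. restr U f x \<noteq> 0}" by (auto simp: restr_def)
  then show ?thesis using open_nonvanishing[OF assms(1) assms(2)[unfolded regular_on_def]] by simp
qed

text \<open>Gauss elimination: subtract from \<open>e\<^sub>n\<close> its components along the earlier vectors, as read off by the
  functionals dual to those. By independence the rest \<open>v\<close> has a coordinate \<open>c\<^sub>0\<close> that is nonzero at \<open>x\<close>,
  hence invertible nearby; dividing by it gives the functional dual to \<open>e\<^sub>n\<close>, which then corrects the
  earlier ones.\<close>

lemma regular_dual_family:
  fixes e :: "nat \<Rightarrow> 'c \<Rightarrow> 'x \<Rightarrow> 'k"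
  assumes U: "is_open U" "x \<in> U" and C: "finite C"
    and e: "\<And>i c. i < n \<Longrightarrow> c \<in> C \<Longrightarrow> regular_on U (e i c)"
    and indep: "\<And>a. (\<And>c. c \<in> C \<Longrightarrow> (\<Sum>i<n. a i * e i c x) = 0) \<Longrightarrow> \<forall>i<n. a i = 0"
  shows "\<exists>W l. is_open W \<and> x \<in> W \<and> W \<subseteq> U \<and> (\<forall>i<n. \<forall>c\<in>C. regular_on W (l i c)) \<and>
    (\<forall>y\<in>W. \<forall>i<n. \<forall>k<n. (\<Sum>c\<in>C. l i c y * e k c y) = (if i = k then 1 else 0))"
  using e indep
proof (induction n)
  case 0
  then show ?case using U by auto
next
  case (Suc n)
  have "\<exists>W l. is_open W \<and> x \<in> W \<and> W \<subseteq> U \<and> (\<forall>i<n. \<forall>c\<in>C. regular_on W (l i c)) \<and>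
    (\<forall>y\<in>W. \<forall>i<n. \<forall>k<n. (\<Sum>c\<in>C. l i c y * e k c y) = (if i = k then 1 else 0))"
  proof (rule Suc.IH)
    show "\<forall>i<n. a i = 0" if "\<And>c. c \<in> C \<Longrightarrow> (\<Sum>i<n. a i * e i c x) = 0" for a
    proof -
      have "\<forall>i<Suc n. (a(n := 0)) i = 0"
        by (rule Suc.prems(2)) (use that in simp)
      then show ?thesis by (auto simp: less_Suc_eq split: if_splits)
    qed
  qed (use Suc.prems(1) in auto)
  then obtain W l where W: "is_open W" "x \<in> W" "W \<subseteq> U"
    and l': "\<forall>i<n. \<forall>c\<in>C. regular_on W (l i c)"
    and dual': "\<forall>y\<in>W. \<forall>i<n. \<forall>k<n. (\<Sum>c\<in>C. l i c y * e k c y) = (if i = k then 1 else 0)"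
    by (elim exE conjE) (rule that)
  have l: "regular_on W (l i c)" if "i < n" "c \<in> C" for i c
    using l' that by simp
  have dual: "(\<Sum>c\<in>C. l i c y * e k c y) = (if i = k then 1 else 0)"
    if "y \<in> W" "i < n" "k < n" for y i k
    using dual' that by simp
  define v where "v c y = e n c y - (\<Sum>i<n. (\<Sum>c'\<in>C. l i c' y * e n c' y) * e i c y)" for c y
  have "\<exists>c\<in>C. v c x \<noteq> 0"
  proof (rule ccontr)
    assume contr: "\<not> (\<exists>c\<in>C. v c x \<noteq> 0)"
    define a where "a i = (if i = n then 1 else - (\<Sum>c'\<in>C. l i c' x * e n c' x))" for i
    have "\<forall>i<Suc n. a i = 0"
    proof (rule Suc.prems(2))
      fix c assume "c \<in> C"
      then have "v c x = 0" using contr by blast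
      moreover have "(\<Sum>i<n. a i * e i c x) = - (\<Sum>i<n. (\<Sum>c'\<in>C. l i c' x * e n c' x) * e i c x)"
        unfolding sum_negf[symmetric] by (rule sum.cong) (auto simp: a_def)
      ultimately show "(\<Sum>i<Suc n. a i * e i c x) = 0" by (simp add: v_def a_def)
    qed
    then show False by (auto simp: a_def)
  qed
  then obtain c0 where c0: "c0 \<in> C" "v c0 x \<noteq> 0" by blast
  have eW: "regular_on W (e i c)" if "i < Suc n" "c \<in> C" for i c
    using Suc.prems(1)[OF that] W by (blast intro: regular_on_subset)
  define W' where "W' = {y \<in> W. v c0 y \<noteq> 0}"
  have vW: "regular_on W (v c)" if "c \<in> C" for c
    unfolding v_def using that
    by (intro regular_on_diff regular_on_sum regular_on_mult W(1) eW l) auto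
  have W': "is_open W'" "x \<in> W'" "W' \<subseteq> W"
    using open_nonvanishing_on[OF W(1) vW] c0 W(2) by (auto simp: W'_def)
  \<comment> \<open>The functional dual to \<open>e\<^sub>n\<close>: the coordinate \<open>c\<^sub>0\<close> of the component transversal to the earlier vectors, normalised at \<open>e\<^sub>n\<close>.\<close>
  define ln where "ln c y = ((if c = c0 then 1 else 0) - (\<Sum>i<n. e i c0 y * l i c y)) / v c0 y" for c y
  define l' where "l' i c y = (if i = n then ln c y else
     l i c y - (\<Sum>c'\<in>C. l i c' y * e n c' y) * ln c y)" for i c y
  have e': "regular_on W' (e i c)" if "i < Suc n" "c \<in> C" for i c
    using eW[OF that] W' by (blast intro: regular_on_subset)
  have lW': "regular_on W' (l i c)" if "i < n" "c \<in> C" for i c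
    using l[OF that] W' by (blast intro: regular_on_subset)
  have ln_reg: "regular_on W' (ln c)" if "c \<in> C" for c
    unfolding ln_def
    by (intro regular_on_divide regular_on_diff regular_on_sum regular_on_mult regular_on_const
        regular_on_subset[OF vW[OF c0(1)]] W' e' lW')
       (use that c0 in \<open>auto simp: W'_def\<close>)
  have l'_reg: "regular_on W' (l' i c)" if "i < Suc n" "c \<in> C" for i c
  proof (cases "i = n")
    case True
    then have "l' i c = ln c" by (simp add: l'_def fun_eq_iff)
    then show ?thesis using ln_reg[OF that(2)] by simp
  next
    case False
    then have "i < n" using that by simp
    have "regular_on W' (\<lambda>y. l i c y - (\<Sum>c'\<in>C. l i c' y * e n c' y) * ln c y)"
      by (intro regular_on_diff regular_on_sum regular_on_mult W' e' lW' ln_reg)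
         (use that \<open>i < n\<close> in auto)
    moreover have "l' i c = (\<lambda>y. l i c y - (\<Sum>c'\<in>C. l i c' y * e n c' y) * ln c y)"
      using False by (simp add: l'_def fun_eq_iff)
    ultimately show ?thesis by simp
  qed
  have ln_dual: "(\<Sum>c\<in>C. ln c y * e k c y) = (if k = n then 1 else 0)" if "y \<in> W'" "k < Suc n" for y k
  proof -
    have nz: "v c0 y \<noteq> 0" and yW: "y \<in> W" using that by (auto simp: W'_def)
    have "(\<Sum>c\<in>C. ln c y * e k c y) =
      ((\<Sum>c\<in>C. (if c = c0 then 1 else 0) * e k c y)
        - (\<Sum>c\<in>C. (\<Sum>i<n. e i c0 y * l i c y) * e k c y)) / v c0 y"
      unfolding sum_subtractf[symmetric] sum_divide_distrib ln_def
      by (rule sum.cong) (simp_all add: left_diff_distrib)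
    also have "(\<Sum>c\<in>C. (if c = c0 then 1 else 0) * e k c y) = e k c0 y"
      using C c0 by (simp add: if_distrib[where f = "\<lambda>z. z * _"] cong: if_cong)
    also have "(\<Sum>c\<in>C. (\<Sum>i<n. e i c0 y * l i c y) * e k c y) =
      (\<Sum>i<n. (\<Sum>c\<in>C. l i c y * e k c y) * e i c0 y)"
      unfolding sum_distrib_right by (subst sum.swap) (simp add: mult_ac)
    finally have *: "(\<Sum>c\<in>C. ln c y * e k c y) =
      (e k c0 y - (\<Sum>i<n. (\<Sum>c\<in>C. l i c y * e k c y) * e i c0 y)) / v c0 y" .
    show ?thesis
    proof (cases "k = n")
      case True
      then show ?thesis using * nz by (simp add: v_def)
    next
      case False
      then have "k < n" using that by simp
      have "(\<Sum>i<n. (\<Sum>c\<in>C. l i c y * e k c y) * e i c0 y) = (\<Sum>i<n. (if i = k then 1 else 0) * e i c0 y)"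
        by (rule sum.cong) (use dual[OF yW _ \<open>k < n\<close>] in auto)
      also have "\<dots> = e k c0 y"
        using \<open>k < n\<close> by (simp add: if_distrib[where f = "\<lambda>z. z * _"] cong: if_cong)
      finally show ?thesis using * False by simp
    qed
  qed
  have "(\<Sum>c\<in>C. l' i c y * e k c y) = (if i = k then 1 else 0)"
    if "y \<in> W'" "i < Suc n" "k < Suc n" for y i k
  proof (cases "i = n")
    case True
    then show ?thesis using ln_dual[OF that(1,3)] by (simp add: l'_def)
  next
    case False
    then have i: "i < n" using that by simp
    have yW: "y \<in> W" using that W' by auto
    have "(\<Sum>c\<in>C. l' i c y * e k c y) =
      (\<Sum>c\<in>C. l i c y * e k c y) - (\<Sum>c'\<in>C. l i c' y * e n c' y) * (\<Sum>c\<in>C. ln c y * e k c y)"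
      unfolding sum_distrib_left sum_subtractf[symmetric]
      by (rule sum.cong) (use False in \<open>simp_all add: l'_def algebra_simps sum_distrib_left\<close>)
    also have "\<dots> = (if i = k then 1 else 0)"
    proof (cases "k = n")
      case True
      then show ?thesis using i ln_dual[OF that(1,3)] by simp
    next
      case False
      then show ?thesis using that ln_dual[OF that(1,3)] dual[OF yW i, of k] by simp
    qed
    finally show ?thesis .
  qed
  with W' W(3) l'_reg show ?case by (intro exI[of _ W'] exI[of _ l']) auto
qed

end

section \<open>Families of vectors\<close>

context finite_dimensional_vector_space
begin

text \<open>Independence of an indexed family: the index, and not the vector, stays fixed when a vector varies
  with a point.\<close>

definition indep_family :: "nat \<Rightarrow> (nat \<Rightarrow> 'b) \<Rightarrow> bool" where
  "indep_family n v \<longleftrightarrow> (\<forall>a. (\<Sum>i<n. a i *s v i) = 0 \<longrightarrow> (\<forall>i<n. a i = 0))"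

lemma sum_family_image:
  assumes "inj_on v {..<n}"
  shows "(\<Sum>x\<in>v ` {..<n}. u x *s x) = (\<Sum>i<n. u (v i) *s v i)"
  using assms by (simp add: sum.reindex)

lemma indep_family_iff:
  "indep_family n v \<longleftrightarrow> inj_on v {..<n} \<and> independent (v ` {..<n})"
proof
  assume fam: "indep_family n v"
  have inj: "inj_on v {..<n}"
  proof (rule inj_onI, rule ccontr)
    fix i k assume ik: "i \<in> {..<n}" "k \<in> {..<n}" "v i = v k" "i \<noteq> k"
    define a :: "nat \<Rightarrow> 'a" where "a l = (if l = i then 1 else if l = k then -1 else 0)" for l
    have "(\<Sum>l<n. a l *s v l) = (\<Sum>l\<in>{i, k}. a l *s v l)"
      by (rule sum.mono_neutral_right) (use ik in \<open>auto simp: a_def\<close>)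
    also have "\<dots> = 0" using ik by (simp add: a_def)
    finally have "a i = 0" using fam ik unfolding indep_family_def by blast
    then show False by (simp add: a_def)
  qed
  have "independent (v ` {..<n})"
  proof (rule independent_if_scalars_zero)
    fix f x assume *: "(\<Sum>x\<in>v ` {..<n}. f x *s x) = 0" "x \<in> v ` {..<n}"
    then have "(\<Sum>i<n. f (v i) *s v i) = 0" using sum_family_image[OF inj] by simp
    from fam[unfolded indep_family_def, rule_format, OF this] *(2) show "f x = 0" by auto
  qed simp
  with inj show "inj_on v {..<n} \<and> independent (v ` {..<n})" ..
next
  assume *: "inj_on v {..<n} \<and> independent (v ` {..<n})"
  show "indep_family n v"
    unfolding indep_family_def
  proof (intro allI impI)
    fix a i assume a: "(\<Sum>i<n. a i *s v i) = 0" and i: "i < n"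
    define u where "u x = a (inv_into {..<n} v x)" for x
    have u: "u (v i) = a i" if "i < n" for i
      using * that by (simp add: u_def)
    have "(\<Sum>x\<in>v ` {..<n}. u x *s x) = 0"
      using a u by (subst sum_family_image) (use * in auto)
    from independentD[OF conjunct2[OF *] _ order_refl this, of "v i"] i u show "a i = 0" by simp
  qed
qed

lemma in_span_family:
  fixes v :: "nat \<Rightarrow> 'b"
  shows "m \<in> span (v ` {..<n}) \<longleftrightarrow> (\<exists>a. m = (\<Sum>i<n. a i *s v i))"
proof
  let ?S = "{m. \<exists>a. m = (\<Sum>i<n. a i *s v i)}"
  have "span (v ` {..<n}) \<subseteq> ?S"
  proof (rule span_minimal)
    show "v ` {..<n} \<subseteq> ?S"
    proof
      fix x assume "x \<in> v ` {..<n}"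
      then obtain k where k: "k < n" "x = v k" by auto
      have "(\<Sum>i<n. (if i = k then 1 else 0) *s v i) = (\<Sum>i\<in>{k}. v i)"
        by (rule sum.mono_neutral_cong_right) (use k in auto)
      then show "x \<in> ?S" using k by (intro CollectI exI[of _ "\<lambda>i. if i = k then 1 else 0"]) simp
    qed
    show "subspace ?S"
    proof (rule subspaceI)
      show "0 \<in> ?S" by (auto intro!: exI[of _ "\<lambda>i. 0"])
      show "x + y \<in> ?S" if "x \<in> ?S" "y \<in> ?S" for x y
      proof -
        from that obtain a b where "x = (\<Sum>i<n. a i *s v i)" "y = (\<Sum>i<n. b i *s v i)" by auto
        then show ?thesis
          by (intro CollectI exI[of _ "\<lambda>i. a i + b i"]) (simp add: scale_left_distrib sum.distrib)
      qed
      show "c *s x \<in> ?S" if "x \<in> ?S" for c x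
      proof -
        from that obtain a where "x = (\<Sum>i<n. a i *s v i)" by auto
        then show ?thesis
          by (intro CollectI exI[of _ "\<lambda>i. c * a i"]) (simp add: scale_sum_right)
      qed
    qed
  qed
  then show "m \<in> span (v ` {..<n}) \<Longrightarrow> \<exists>a. m = (\<Sum>i<n. a i *s v i)" by blast
next
  assume "\<exists>a. m = (\<Sum>i<n. a i *s v i)"
  then show "m \<in> span (v ` {..<n})" by (auto intro!: span_sum span_scale intro: span_base)
qed

lemma indep_family_spans:
  assumes "indep_family n v" "subspace S" "\<And>i. i < n \<Longrightarrow> v i \<in> S" "dim S = n"
  shows "S = span (v ` {..<n})"
proof -
  have ind: "inj_on v {..<n}" "independent (v ` {..<n})" using assms(1) indep_family_iff by auto
  have sub: "v ` {..<n} \<subseteq> S" using assms(3) by auto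
  have "S \<subseteq> span (v ` {..<n})"
    by (rule card_ge_dim_independent[OF sub ind(2)]) (simp add: card_image[OF ind(1)] assms(4))
  moreover have "span (v ` {..<n}) \<subseteq> S" using span_minimal[OF sub assms(2)] .
  ultimately show ?thesis by blast
qed

text \<open>A family of \<open>n\<close> vectors whose span contains a subspace of dimension \<open>n\<close> leaves no room: it is a basis
  of that subspace.\<close>

lemma spanning_family_indep:
  fixes v :: "nat \<Rightarrow> 'b"
  assumes "subspace S" "S \<subseteq> span (v ` {..<n})" "dim S = n"
  shows "S = span (v ` {..<n}) \<and> indep_family n v"
proof -
  have le: "dim (span (v ` {..<n})) \<le> card (v ` {..<n})" by (simp add: dim_le_card')
  have card: "card (v ` {..<n}) \<le> n" using card_image_le[of "{..<n}" v] by simp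
  have eq: "S = span (v ` {..<n})"
    by (rule subspace_dim_equal) (use assms le card in auto)
  have "n \<le> card (v ` {..<n})" using le eq assms(3) by simp
  with card have c: "card (v ` {..<n}) = n" by simp
  have "inj_on v {..<n}" by (rule eq_card_imp_inj_on) (simp_all add: c)
  moreover have "independent (v ` {..<n})"
    by (rule card_le_dim_spanning[of _ S]) (use eq assms(3) c in \<open>auto intro: span_base\<close>)
  ultimately show ?thesis using eq indep_family_iff by blast
qed

abbreviation coordinate :: "'b \<Rightarrow> 'b \<Rightarrow> 'a" where
  "coordinate m b \<equiv> representation Basis m b"

lemma coordinate_sum: "coordinate (\<Sum>i\<in>I. f i) b = (\<Sum>i\<in>I. coordinate (f i) b)"
  by (simp add: representation_sum independent_Basis span_Basis)

lemma coordinate_add: "coordinate (x + y) b = coordinate x b + coordinate y b"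
  by (simp add: representation_add independent_Basis span_Basis)

lemma coordinate_scale: "coordinate (c *s x) b = c * coordinate x b"
  by (simp add: representation_scale independent_Basis span_Basis)

lemma coordinate_zero: "coordinate 0 b = 0"
  by (simp add: representation_zero)

lemma coordinate_expansion: "(\<Sum>b\<in>Basis. coordinate x b *s b) = x"
  by (rule sum_representation_eq) (simp_all add: independent_Basis span_Basis finite_Basis)

lemma coordinate_Basis: "b \<in> Basis \<Longrightarrow> coordinate b c = (if c = b then 1 else 0)"
  by (simp add: representation_basis independent_Basis)

lemma coordinate_of_expansion: "c \<in> Basis \<Longrightarrow> coordinate (\<Sum>b\<in>Basis. f b *s b) c = f c"
proof -
  assume c: "c \<in> Basis"
  have "coordinate (\<Sum>b\<in>Basis. f b *s b) c = (\<Sum>b\<in>Basis. f b * (if c = b then 1 else 0))"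
    unfolding coordinate_sum by (rule sum.cong) (simp_all add: coordinate_scale coordinate_Basis)
  also have "\<dots> = f c" using c finite_Basis by (simp add: if_distrib[of "(*) _"] cong: if_cong)
  finally show ?thesis .
qed

lemma eq_zero_if_coordinates: "(\<And>b. b \<in> Basis \<Longrightarrow> coordinate x b = 0) \<Longrightarrow> x = 0"
  using coordinate_expansion[of x] by simp

end

section \<open>Vector bundles of subspaces\<close>

locale tensor_sheaf = function_sheaf X + vs: finite_dimensional_vector_space sc B
  for X :: "('x, 'k::field) variety" and sc :: "'k \<Rightarrow> 'm::ab_group_add \<Rightarrow> 'm" and B :: "'m set"
begin

definition section_on :: "'x set \<Rightarrow> ('x \<Rightarrow> 'm) \<Rightarrow> bool" where
  "section_on U s \<longleftrightarrow> (\<forall>b\<in>B. regular_on U (\<lambda>x. vs.coordinate (s x) b))"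

lemma tensor_sections_iff:
  "s \<in> tensor_sections sc B X U \<longleftrightarrow> section_on U s \<and> (\<forall>x. x \<notin> U \<longrightarrow> s x = 0)"
proof
  assume "s \<in> tensor_sections sc B X U"
  then obtain f where f: "s = (\<lambda>x. \<Sum>b\<in>B. sc (f b x) b)" "\<And>b. b \<in> B \<Longrightarrow> f b \<in> regular X U"
    unfolding tensor_sections_def by auto
  then show "section_on U s \<and> (\<forall>x. x \<notin> U \<longrightarrow> s x = 0)"
    unfolding section_on_def by (auto simp: vs.coordinate_of_expansion regular_iff)
next
  assume s: "section_on U s \<and> (\<forall>x. x \<notin> U \<longrightarrow> s x = 0)"
  show "s \<in> tensor_sections sc B X U"
    unfolding tensor_sections_def
  proof (intro CollectI exI[of _ "\<lambda>b x. vs.coordinate (s x) b"] conjI ballI)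
    show "s = (\<lambda>x. \<Sum>b\<in>B. sc (vs.coordinate (s x) b) b)" by (simp add: vs.coordinate_expansion)
    show "(\<lambda>x. vs.coordinate (s x) b) \<in> regular X U" if "b \<in> B" for b
      using s that by (simp add: regular_iff section_on_def vs.coordinate_zero)
  qed
qed

lemma section_on_cong:
  assumes "\<And>x. x \<in> U \<Longrightarrow> s x = t x" shows "section_on U s \<longleftrightarrow> section_on U t"
  unfolding section_on_def by (intro ball_cong refl regular_on_cong) (simp add: assms)

lemma section_on_subset: "section_on U s \<Longrightarrow> is_open V \<Longrightarrow> V \<subseteq> U \<Longrightarrow> section_on V s"
  unfolding section_on_def using regular_on_subset by blast

lemma section_on_const: "is_open U \<Longrightarrow> section_on U (\<lambda>x. m)"
  unfolding section_on_def using regular_on_const by blast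

lemma section_on_add: "section_on U s \<Longrightarrow> section_on U t \<Longrightarrow> section_on U (\<lambda>x. s x + t x)"
  unfolding section_on_def by (simp add: vs.coordinate_add regular_on_add)

lemma section_on_scale: "regular_on U f \<Longrightarrow> section_on U s \<Longrightarrow> section_on U (\<lambda>x. sc (f x) (s x))"
  unfolding section_on_def by (simp add: vs.coordinate_scale regular_on_mult)

lemma section_on_sum:
  "is_open U \<Longrightarrow> (\<And>i. i \<in> I \<Longrightarrow> section_on U (s i)) \<Longrightarrow> section_on U (\<lambda>x. \<Sum>i\<in>I. s i x)"
  unfolding section_on_def by (simp add: vs.coordinate_sum regular_on_sum)

lemma section_on_diff:
  assumes "is_open U" "section_on U s" "section_on U t" shows "section_on U (\<lambda>x. s x - t x)"
  using section_on_add[OF assms(2) section_on_scale[OF regular_on_const[OF assms(1), of "-1"] assms(3)]]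
  by simp

lemma section_on_restr: "section_on U (restr U s) \<longleftrightarrow> section_on U s"
  by (rule section_on_cong) (simp add: restr_def)

lemma restr_in_tensor_sections: "section_on U s \<Longrightarrow> restr U s \<in> tensor_sections sc B X U"
  by (simp add: tensor_sections_iff section_on_restr) (simp add: restr_def)

text \<open>The functionals \<open>l\<^sub>i\<close> vary regularly and read off the coefficients with respect to the vectors \<open>e\<^sub>k\<close>.\<close>

definition dual_on :: "'x set \<Rightarrow> nat \<Rightarrow> (nat \<Rightarrow> 'x \<Rightarrow> 'm) \<Rightarrow> (nat \<Rightarrow> 'x \<Rightarrow> 'm \<Rightarrow> 'k) \<Rightarrow> bool" where
  "dual_on W n e l \<longleftrightarrow>
     (\<forall>i<n. \<forall>V s. is_open V \<longrightarrow> V \<subseteq> W \<longrightarrow> section_on V s \<longrightarrow> regular_on V (\<lambda>y. l i y (s y))) \<and>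
     (\<forall>y\<in>W. \<forall>i<n. \<forall>a. l i y (\<Sum>k<n. sc (a k) (e k y)) = a i)"

lemma dual_on_coefficient:
  "dual_on W n e l \<Longrightarrow> y \<in> W \<Longrightarrow> i < n \<Longrightarrow> l i y (\<Sum>k<n. sc (a k) (e k y)) = a i"
  by (simp add: dual_on_def)

lemma dual_functionals:
  assumes U: "is_open U" "x \<in> U" and e: "\<And>i. i < n \<Longrightarrow> section_on U (e i)"
    and indep: "vs.indep_family n (\<lambda>i. e i x)"
  shows "\<exists>W l. is_open W \<and> x \<in> W \<and> W \<subseteq> U \<and> dual_on W n e l"
proof -
  have "\<exists>W c. is_open W \<and> x \<in> W \<and> W \<subseteq> U \<and> (\<forall>i<n. \<forall>b\<in>B. regular_on W (c i b)) \<and>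
    (\<forall>y\<in>W. \<forall>i<n. \<forall>k<n. (\<Sum>b\<in>B. c i b y * vs.coordinate (e k y) b) = (if i = k then 1 else 0))"
  proof (rule regular_dual_family[OF U vs.finite_Basis, where e = "\<lambda>i b y. vs.coordinate (e i y) b"])
    show "regular_on U (\<lambda>y. vs.coordinate (e i y) b)" if "i < n" "b \<in> B" for i b
      using e[OF that(1)] that(2) unfolding section_on_def by blast
    show "\<forall>i<n. a i = 0"
      if "\<And>b. b \<in> B \<Longrightarrow> (\<Sum>i<n. a i * vs.coordinate (e i x) b) = 0" for a
    proof -
      have "(\<Sum>i<n. sc (a i) (e i x)) = 0"
        by (rule vs.eq_zero_if_coordinates) (simp add: vs.coordinate_sum vs.coordinate_scale that)
      with indep show ?thesis unfolding vs.indep_family_def by blast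
    qed
  qed
  then obtain W c where W: "is_open W" "x \<in> W" "W \<subseteq> U"
    and c: "\<forall>i<n. \<forall>b\<in>B. regular_on W (c i b)"
    and dual: "\<forall>y\<in>W. \<forall>i<n. \<forall>k<n.
      (\<Sum>b\<in>B. c i b y * vs.coordinate (e k y) b) = (if i = k then 1 else 0)"
    by (elim exE conjE) (rule that)
  define l where "l i y m = (\<Sum>b\<in>B. c i b y * vs.coordinate m b)" for i y m
  have "dual_on W n e l"
    unfolding dual_on_def
  proof (intro conjI allI impI ballI)
    fix i V s assume that: "i < n" "is_open V" "V \<subseteq> W" "section_on V s"
    show "regular_on V (\<lambda>y. l i y (s y))"
      unfolding l_def
    proof (intro regular_on_sum regular_on_mult that(2))
      fix b assume b: "b \<in> B"
      show "regular_on V (c i b)" using c that b by (blast intro: regular_on_subset)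
      show "regular_on V (\<lambda>y. vs.coordinate (s y) b)" using that(4) b unfolding section_on_def by blast
    qed
  next
    fix y i a assume that: "y \<in> W" "i < n"
    have "l i y (\<Sum>k<n. sc (a k) (e k y)) = (\<Sum>k<n. a k * (\<Sum>b\<in>B. c i b y * vs.coordinate (e k y) b))"
      unfolding l_def vs.coordinate_sum vs.coordinate_scale sum_distrib_left
      by (subst sum.swap) (simp add: mult_ac)
    also have "\<dots> = (\<Sum>k<n. a k * (if i = k then 1 else 0))"
      by (rule sum.cong) (use dual that in auto)
    also have "\<dots> = a i" using that(2) by (simp add: if_distrib[of "(*) _"] cong: if_cong)
    finally show "l i y (\<Sum>k<n. sc (a k) (e k y)) = a i" .
  qed
  with W show ?thesis by blast
qed

lemma indep_near:
  assumes "is_open U" "x \<in> U" "\<And>i. i < n \<Longrightarrow> section_on U (e i)" "vs.indep_family n (\<lambda>i. e i x)"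
  shows "\<exists>W. is_open W \<and> x \<in> W \<and> W \<subseteq> U \<and> (\<forall>y\<in>W. vs.indep_family n (\<lambda>i. e i y))"
proof -
  from dual_functionals[OF assms] obtain W l
    where W: "is_open W" "x \<in> W" "W \<subseteq> U" and l: "dual_on W n e l" by blast
  have "vs.indep_family n (\<lambda>i. e i y)" if y: "y \<in> W" for y
    unfolding vs.indep_family_def
  proof (intro allI impI)
    fix a i assume *: "(\<Sum>k<n. sc (a k) (e k y)) = 0" "i < n"
    show "a i = 0"
      using dual_on_coefficient[OF l y *(2), of a] dual_on_coefficient[OF l y *(2), of "\<lambda>_. 0"] *(1)
      by simp
  qed
  with W show ?thesis by blast
qed

text \<open>The sections \<open>e\<^sub>i\<close> form a basis of \<open>N y\<close> at every point \<open>y\<close> of \<open>U\<close>.\<close>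

definition frame_on :: "('x \<Rightarrow> 'm set) \<Rightarrow> 'x set \<Rightarrow> nat \<Rightarrow> (nat \<Rightarrow> 'x \<Rightarrow> 'm) \<Rightarrow> bool" where
  "frame_on N U n e \<longleftrightarrow> is_open U \<and> (\<forall>i<n. section_on U (e i)) \<and>
     (\<forall>y\<in>U. vs.indep_family n (\<lambda>i. e i y) \<and> N y = vs.span ((\<lambda>i. e i y) ` {..<n}))"

text \<open>The coefficients exist pointwise; they are regular because near each point they are the values of
  regular dual functionals on \<open>s\<close>.\<close>

lemma frame_coefficients:
  assumes fr: "frame_on N U n e" and V: "is_open V" "V \<subseteq> U"
    and s: "section_on V s" "\<And>y. y \<in> V \<Longrightarrow> s y \<in> N y"
  shows "\<exists>f. (\<forall>i<n. f i \<in> regular X V) \<and> (\<forall>y\<in>V. s y = (\<Sum>i<n. sc (f i y) (e i y)))"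
proof -
  have "\<exists>a. s y = (\<Sum>i<n. sc (a i) (e i y))" if "y \<in> V" for y
    using s(2)[OF that] V(2) that fr unfolding frame_on_def by (auto simp: vs.in_span_family)
  then obtain g where g: "\<And>y. y \<in> V \<Longrightarrow> s y = (\<Sum>i<n. sc (g y i) (e i y))" by metis
  have "regular_on V (\<lambda>y. g y i)" if i: "i < n" for i
  proof (rule regular_on_local)
    fix x assume x: "x \<in> V"
    have eV: "section_on V (e k)" if "k < n" for k
      using fr that V unfolding frame_on_def by (blast intro: section_on_subset)
    have "vs.indep_family n (\<lambda>i. e i x)" using fr x V unfolding frame_on_def by blast
    from dual_functionals[OF V(1) x eV this] obtain W l
      where W: "is_open W" "x \<in> W" "W \<subseteq> V" and l: "dual_on W n e l" by blast
    have "g y i = l i y (s y)" if y: "y \<in> W" for y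
    proof -
      have "s y = (\<Sum>k<n. sc (g y k) (e k y))" using g y W by blast
      then show ?thesis using dual_on_coefficient[OF l y i, of "g y"] by simp
    qed
    then have "regular_on W (\<lambda>y. g y i) \<longleftrightarrow> regular_on W (\<lambda>y. l i y (s y))"
      by (intro regular_on_cong)
    moreover have "regular_on W (\<lambda>y. l i y (s y))"
      using l i W(1) section_on_subset[OF s(1) W(1,3)] unfolding dual_on_def by blast
    ultimately show "\<exists>W. is_open W \<and> x \<in> W \<and> W \<subseteq> V \<and> regular_on W (\<lambda>y. g y i)" using W by blast
  qed
  then show ?thesis
    by (intro exI[of _ "\<lambda>i. restr V (\<lambda>y. g y i)"] conjI)
       (auto simp: regular_on_def, simp add: restr_def g)
qed

end

context tensor_sheaf
begin

text \<open>Both the image and the kernel sheaf turn out to have this form.\<close>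

definition subspace_sheaf :: "('x \<Rightarrow> 'm set) \<Rightarrow> 'x set \<Rightarrow> ('x \<Rightarrow> 'm) set" where
  "subspace_sheaf N U = (if \<not> is_open U then {} else
     {s \<in> tensor_sections sc B X U. \<forall>y\<in>U. s y \<in> N y})"

lemma subspace_sheaf_iff:
  "is_open U \<Longrightarrow> s \<in> subspace_sheaf N U \<longleftrightarrow>
     section_on U s \<and> (\<forall>x. x \<notin> U \<longrightarrow> s x = 0) \<and> (\<forall>y\<in>U. s y \<in> N y)"
  by (auto simp: subspace_sheaf_def tensor_sections_iff)

lemma submodule_sheaf_subspace_sheaf:
  assumes sub: "\<And>y. y \<in> topspace (zariski X) \<Longrightarrow> vs.subspace (N y)"
  shows "submodule_sheaf sc B X (subspace_sheaf N)"
  unfolding submodule_sheaf_def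
proof (intro conjI allI impI)
  fix U assume "\<not> is_open U"
  then show "subspace_sheaf N U = {}" by (simp add: subspace_sheaf_def)
next
  fix U assume U: "is_open U"
  then have subU: "vs.subspace (N y)" if "y \<in> U" for y
    using sub that openin_subset by blast
  note iff = subspace_sheaf_iff[OF U]
  show "subspace_sheaf N U \<subseteq> tensor_sections sc B X U" by (auto simp: subspace_sheaf_def)
  show "(\<lambda>x. 0) \<in> subspace_sheaf N U"
    using subU vs.subspace_0 section_on_const[OF U] by (simp add: iff)
  show "\<forall>s\<in>subspace_sheaf N U. \<forall>t\<in>subspace_sheaf N U. (\<lambda>x. s x + t x) \<in> subspace_sheaf N U"
    using subU vs.subspace_add section_on_add by (simp add: iff)
  show "\<forall>f\<in>regular X U. \<forall>s\<in>subspace_sheaf N U. (\<lambda>x. sc (f x) (s x)) \<in> subspace_sheaf N U"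
    using subU vs.subspace_scale section_on_scale by (simp add: iff regular_iff)
  show "restr V s \<in> subspace_sheaf N V" if "is_open V \<and> V \<subseteq> U \<and> s \<in> subspace_sheaf N U" for V s
  proof -
    have V: "is_open V" "V \<subseteq> U" and s: "section_on U s" "\<forall>y\<in>U. s y \<in> N y"
      using that iff by auto
    have "section_on V s" using s(1) V section_on_subset by blast
    then show ?thesis using V s(2) by (auto simp: subspace_sheaf_iff section_on_restr) (auto simp: restr_def)
  qed
  show "\<forall>s\<in>tensor_sections sc B X U.
    (\<forall>x\<in>U. \<exists>V. is_open V \<and> x \<in> V \<and> V \<subseteq> U \<and> restr V s \<in> subspace_sheaf N V) \<longrightarrow> s \<in> subspace_sheaf N U"
  proof (intro ballI impI)
    fix s assume s: "s \<in> tensor_sections sc B X U"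
      and loc: "\<forall>x\<in>U. \<exists>V. is_open V \<and> x \<in> V \<and> V \<subseteq> U \<and> restr V s \<in> subspace_sheaf N V"
    have "s y \<in> N y" if "y \<in> U" for y
    proof -
      from loc that obtain V where V: "is_open V" "y \<in> V" "restr V s \<in> subspace_sheaf N V" by blast
      then have "restr V s y \<in> N y" by (simp add: subspace_sheaf_iff)
      then show ?thesis using V by (simp add: restr_def)
    qed
    then show "s \<in> subspace_sheaf N U" using s U by (simp add: subspace_sheaf_def)
  qed
qed

definition locally_framed :: "('x \<Rightarrow> 'm set) \<Rightarrow> bool" where
  "locally_framed N \<longleftrightarrow> (\<forall>x\<in>topspace (zariski X). \<exists>U n e. x \<in> U \<and> frame_on N U n e)"

lemma frame_subspace: "frame_on N U n e \<Longrightarrow> y \<in> U \<Longrightarrow> vs.subspace (N y)"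
  unfolding frame_on_def by simp

lemma locally_framed_subspace:
  "locally_framed N \<Longrightarrow> y \<in> topspace (zariski X) \<Longrightarrow> vs.subspace (N y)"
  unfolding locally_framed_def using frame_subspace by blast

lemma frame_on_subset:
  "frame_on N U n e \<Longrightarrow> is_open V \<Longrightarrow> V \<subseteq> U \<Longrightarrow> frame_on N V n e"
  unfolding frame_on_def using section_on_subset by blast

lemma frame_combination:
  assumes fr: "frame_on N U n e" and V: "is_open V" "V \<subseteq> U" and f: "\<And>i. i < n \<Longrightarrow> f i \<in> regular X V"
  shows "lincomb sc n f e \<in> subspace_sheaf N V"
  unfolding subspace_sheaf_iff[OF V(1)]
proof (intro conjI allI impI ballI)
  have "section_on V (e i)" if "i < n" for i
    using fr that V section_on_subset unfolding frame_on_def by blast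
  then show "section_on V (lincomb sc n f e)"
    unfolding lincomb_def using f regular_iff by (intro section_on_sum section_on_scale V) auto
  show "lincomb sc n f e x = 0" if "x \<notin> V" for x
    using f that by (simp add: lincomb_def regular_iff)
  show "lincomb sc n f e y \<in> N y" if "y \<in> V" for y
  proof -
    have "N y = vs.span ((\<lambda>i. e i y) ` {..<n})" using fr that V unfolding frame_on_def by blast
    then show ?thesis by (auto simp: vs.in_span_family lincomb_def)
  qed
qed

lemma frame_expansion:
  assumes fr: "frame_on N U n e" and V: "is_open V" "V \<subseteq> U" and s: "s \<in> subspace_sheaf N V"
  shows "\<exists>f. (\<forall>i<n. f i \<in> regular X V) \<and> s = lincomb sc n f e"
proof -
  have s': "section_on V s" "\<And>x. x \<notin> V \<Longrightarrow> s x = 0" "\<And>y. y \<in> V \<Longrightarrow> s y \<in> N y"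
    using s subspace_sheaf_iff[OF V(1)] by auto
  from frame_coefficients[OF fr V s'(1,3)] obtain f
    where f: "\<forall>i<n. f i \<in> regular X V" "\<forall>y\<in>V. s y = (\<Sum>i<n. sc (f i y) (e i y))" by blast
  have "s x = lincomb sc n f e x" for x
    using f s'(2) by (cases "x \<in> V") (simp_all add: lincomb_def regular_iff)
  with f(1) show ?thesis by blast
qed

lemma frame_in_sheaf:
  "frame_on N U n e \<Longrightarrow> i < n \<Longrightarrow> restr U (e i) \<in> subspace_sheaf N U"
  unfolding frame_on_def
  by (simp add: subspace_sheaf_iff section_on_restr) (auto simp: restr_def intro: vs.span_base)

lemma lincomb_restr_frame:
  "(\<And>i. i < n \<Longrightarrow> f i \<in> regular X V) \<Longrightarrow> V \<subseteq> U \<Longrightarrow> lincomb sc n f (\<lambda>i. restr U (e i)) = lincomb sc n f e"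
  unfolding lincomb_def by (intro ext sum.cong refl) (auto simp: regular_iff restr_def)

text \<open>A frame of \<open>N\<close> over \<open>U\<close> is a basis of the sections over every open subset of \<open>U\<close>: coefficients
  exist by \<open>frame_expansion\<close> and are unique because the frame is independent at each point.\<close>

theorem vector_bundle_subspace_sheaf:
  assumes lf: "locally_framed N"
  shows "vector_bundle sc B X (subspace_sheaf N)"
  unfolding vector_bundle_def
proof (intro conjI ballI)
  show "submodule_sheaf sc B X (subspace_sheaf N)"
    using submodule_sheaf_subspace_sheaf locally_framed_subspace[OF lf] .
next
  fix x assume "x \<in> topspace (zariski X)"
  then obtain U n e where x: "x \<in> U" and fr: "frame_on N U n e"
    using lf unfolding locally_framed_def by blast
  have "bij_betw (\<lambda>f. lincomb sc n f (\<lambda>i. restr U (e i))) ({..<n} \<rightarrow>\<^sub>E regular X V) (subspace_sheaf N V)"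
    if V: "is_open V" "V \<subseteq> U" for V
  proof (rule bij_betw_imageI)
    let ?R = "{..<n} \<rightarrow>\<^sub>E regular X V"
    have comb: "lincomb sc n f (\<lambda>i. restr U (e i)) = lincomb sc n f e" if "f \<in> ?R" for f
      by (rule lincomb_restr_frame[OF _ V(2)]) (use that in auto)
    show "inj_on (\<lambda>f. lincomb sc n f (\<lambda>i. restr U (e i))) ?R"
    proof (rule inj_onI)
      fix f g assume fg: "f \<in> ?R" "g \<in> ?R"
        and "lincomb sc n f (\<lambda>i. restr U (e i)) = lincomb sc n g (\<lambda>i. restr U (e i))"
      then have eq: "lincomb sc n f e = lincomb sc n g e" using comb by simp
      have "f i y = g i y" if "i < n" for i y
      proof (cases "y \<in> V")
        case True
        have "(\<Sum>i<n. sc (f i y - g i y) (e i y)) = lincomb sc n f e y - lincomb sc n g e y"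
          by (simp add: lincomb_def vs.scale_left_diff_distrib sum_subtractf)
        also have "\<dots> = 0" by (simp add: eq)
        finally have "(\<Sum>i<n. sc (f i y - g i y) (e i y)) = 0" .
        moreover have "vs.indep_family n (\<lambda>i. e i y)" using fr True V unfolding frame_on_def by blast
        ultimately have "f i y - g i y = 0"
          using that unfolding vs.indep_family_def
          by (elim allE[of _ "\<lambda>i. f i y - g i y"]) simp
        then show ?thesis by simp
      next
        case False
        have "f i \<in> regular X V" "g i \<in> regular X V" using fg that by auto
        then show ?thesis using False by (simp add: regular_iff)
      qed
      then show "f = g" by (intro PiE_ext[OF fg]) (auto simp: fun_eq_iff)
    qed
    show "(\<lambda>f. lincomb sc n f (\<lambda>i. restr U (e i))) ` ?R = subspace_sheaf N V"
    proof
      show "(\<lambda>f. lincomb sc n f (\<lambda>i. restr U (e i))) ` ?R \<subseteq> subspace_sheaf N V"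
      proof (rule image_subsetI)
        fix f assume f: "f \<in> ?R"
        have "lincomb sc n f e \<in> subspace_sheaf N V"
          by (rule frame_combination[OF fr V]) (use f in auto)
        then show "lincomb sc n f (\<lambda>i. restr U (e i)) \<in> subspace_sheaf N V" by (simp add: comb[OF f])
      qed
      show "subspace_sheaf N V \<subseteq> (\<lambda>f. lincomb sc n f (\<lambda>i. restr U (e i))) ` ?R"
      proof
        fix s assume "s \<in> subspace_sheaf N V"
        from frame_expansion[OF fr V this] obtain f
          where f: "\<forall>i<n. f i \<in> regular X V" "s = lincomb sc n f e" by blast
        let ?g = "restrict f {..<n}"
        have g: "?g \<in> ?R" using f(1) by auto
        have "lincomb sc n ?g e = s" by (simp add: f(2) lincomb_def)
        then have "s = lincomb sc n ?g (\<lambda>i. restr U (e i))" using comb[OF g] by simp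
        then show "s \<in> (\<lambda>f. lincomb sc n f (\<lambda>i. restr U (e i))) ` ?R" using g by (rule image_eqI)
      qed
    qed
  qed
  then show "\<exists>U n e. is_open U \<and> x \<in> U \<and> (\<forall>i<n. e i \<in> subspace_sheaf N U) \<and>
    (\<forall>V. is_open V \<and> V \<subseteq> U \<longrightarrow>
      bij_betw (\<lambda>f. lincomb sc n f e) ({..<n} \<rightarrow>\<^sub>E regular X V) (subspace_sheaf N V))"
    using fr x frame_in_sheaf[OF fr]
    by (intro exI[of _ U] exI[of _ n] exI[of _ "\<lambda>i. restr U (e i)"]) (auto simp: frame_on_def)
qed

theorem coherent_subspace_sheaf:
  assumes lf: "locally_framed N"
  shows "coherent_subsheaf sc B X (subspace_sheaf N)"
  unfolding coherent_subsheaf_def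
proof (intro conjI ballI)
  show "submodule_sheaf sc B X (subspace_sheaf N)"
    using submodule_sheaf_subspace_sheaf locally_framed_subspace[OF lf] .
next
  fix x assume "x \<in> topspace (zariski X)"
  then obtain U n e where x: "x \<in> U" and fr: "frame_on N U n e"
    using lf unfolding locally_framed_def by blast
  have "\<exists>W f. is_open W \<and> y \<in> W \<and> W \<subseteq> V \<and> (\<forall>i<n. f i \<in> regular X W) \<and>
      restr W s = lincomb sc n f (\<lambda>i. restr U (e i))"
    if V: "is_open V" "V \<subseteq> U" and s: "s \<in> subspace_sheaf N V" and y: "y \<in> V" for V s y
  proof -
    from frame_expansion[OF fr V s] obtain f
      where f: "\<forall>i<n. f i \<in> regular X V" "s = lincomb sc n f e" by blast
    have "restr V s = s" using s by (auto simp: subspace_sheaf_iff[OF V(1)] restr_def fun_eq_iff)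
    then have "restr V s = lincomb sc n f (\<lambda>i. restr U (e i))"
      using f lincomb_restr_frame[OF _ V(2)] by simp
    with V y f(1) show ?thesis by blast
  qed
  then show "\<exists>U n e. is_open U \<and> x \<in> U \<and> (\<forall>i<n. e i \<in> subspace_sheaf N U) \<and>
    (\<forall>V s. is_open V \<and> V \<subseteq> U \<and> s \<in> subspace_sheaf N V \<longrightarrow>
      (\<forall>y\<in>V. \<exists>W f. is_open W \<and> y \<in> W \<and> W \<subseteq> V \<and> (\<forall>i<n. f i \<in> regular X W) \<and>
        restr W s = lincomb sc n f e))"
    using fr x frame_in_sheaf[OF fr]
    by (intro exI[of _ U] exI[of _ n] exI[of _ "\<lambda>i. restr U (e i)"]) (auto simp: frame_on_def)
qed

text \<open>Two local sections with the same value at \<open>x\<close> differ by a combination of frame sections whose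
  coefficients vanish at \<open>x\<close>. So the fibre classes are exactly the sets \<open>cls v\<close> of the sections with
  value \<open>v\<close>, and every \<open>v\<close> in \<open>N x\<close> occurs, as the value of a combination of the frame with
  constant coefficients.\<close>

theorem fiber_subspace_sheaf:
  assumes lf: "locally_framed N" and x: "x \<in> topspace (zariski X)"
  shows "fiber_naturally_identified sc X (subspace_sheaf N) x (N x)"
proof -
  let ?F = "subspace_sheaf N"
  let ?L = "local_sections X ?F x"
  let ?R = "fiber_rel sc X ?F x"
  obtain U n e where xU: "x \<in> U" and fr: "frame_on N U n e"
    using lf x unfolding locally_framed_def by blast
  have oU: "is_open U" using fr unfolding frame_on_def by blast
  have L: "(V, s) \<in> ?L \<longleftrightarrow> is_open V \<and> x \<in> V \<and> s \<in> ?F V" for V s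
    by (simp add: local_sections_def)
  have rel: "((V, s), (W, t)) \<in> ?R \<longleftrightarrow> (V, s) \<in> ?L \<and> (W, t) \<in> ?L \<and> s x = t x" for V s W t
  proof
    assume "((V, s), (W, t)) \<in> ?R"
    then show "(V, s) \<in> ?L \<and> (W, t) \<in> ?L \<and> s x = t x"
      unfolding fiber_rel_def by (auto simp: lincomb_def)
  next
    assume *: "(V, s) \<in> ?L \<and> (W, t) \<in> ?L \<and> s x = t x"
    \<comment> \<open>Near \<open>x\<close>, inside the domain of the frame, \<open>s - t\<close> takes values in \<open>N\<close>.\<close>
    define Z where "Z = V \<inter> W \<inter> U"
    have Z: "is_open Z" "x \<in> Z" "Z \<subseteq> V" "Z \<subseteq> W" "Z \<subseteq> U" using * oU xU by (auto simp: Z_def L)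
    have "section_on Z s" "section_on Z t" "\<forall>y\<in>Z. s y \<in> N y" "\<forall>y\<in>Z. t y \<in> N y"
      using * Z section_on_subset by (auto simp: L subspace_sheaf_iff)
    then have "section_on Z (\<lambda>y. s y - t y)" "\<And>y. y \<in> Z \<Longrightarrow> s y - t y \<in> N y"
      using section_on_diff[OF Z(1)] frame_subspace[OF fr] Z(5) vs.subspace_diff by blast+
    from frame_coefficients[OF fr Z(1,5) this] obtain f where f: "\<forall>i<n. f i \<in> regular X Z"
      "\<forall>y\<in>Z. s y - t y = (\<Sum>i<n. sc (f i y) (e i y))" by blast
    have "(\<Sum>i<n. sc (f i x) (e i x)) = 0" using f(2) Z(2) * by (metis right_minus_eq)
    moreover have "vs.indep_family n (\<lambda>i. e i x)" using fr xU unfolding frame_on_def by blast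
    ultimately have f0: "\<forall>i<n. f i x = 0"
      unfolding vs.indep_family_def by (elim allE[of _ "\<lambda>i. f i x"]) simp
    have eZ: "\<forall>i<n. restr Z (e i) \<in> ?F Z"
      using frame_in_sheaf[OF frame_on_subset[OF fr Z(1,5)]] by blast
    have "\<forall>y\<in>Z. s y - t y = lincomb sc n f (\<lambda>i. restr Z (e i)) y"
      using f(2) by (simp add: lincomb_def restr_def)
    with * Z f(1) f0 eZ show "((V, s), (W, t)) \<in> ?R"
      unfolding fiber_rel_def
      by (auto intro!: exI[of _ Z] exI[of _ n] exI[of _ f] exI[of _ "\<lambda>i. restr Z (e i)"])
  qed
  define cls where "cls v = {(V, s). (V, s) \<in> ?L \<and> s x = v}" for v
  have class_eq: "?R `` {(V, s)} = cls (s x)" if "(V, s) \<in> ?L" for V s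
    using that by (auto simp: cls_def rel)
  have value_in: "s x \<in> N x" if "(V, s) \<in> ?L" for V s
    using that by (auto simp: L subspace_sheaf_iff)
  have section_through: "\<exists>s. (U, s) \<in> ?L \<and> s x = v" if v: "v \<in> N x" for v
  proof -
    from v fr xU obtain a where a: "v = (\<Sum>i<n. sc (a i) (e i x))"
      unfolding frame_on_def by (auto simp: vs.in_span_family)
    let ?s = "lincomb sc n (\<lambda>i. restr U (\<lambda>_. a i)) e"
    have "?s \<in> ?F U" by (rule frame_combination[OF fr oU order_refl]) (rule regular_const[OF oU])
    moreover have "?s x = v" using xU by (simp add: a lincomb_def restr_def)
    ultimately show ?thesis using oU xU L by blast
  qed
  have fib: "fiber sc X ?F x = cls ` N x"
  proof
    show "fiber sc X ?F x \<subseteq> cls ` N x"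
      unfolding fiber_def quotient_def using class_eq value_in by auto
    show "cls ` N x \<subseteq> fiber sc X ?F x"
    proof (rule image_subsetI)
      fix v assume "v \<in> N x"
      then obtain s where s: "(U, s) \<in> ?L" "s x = v" using section_through by blast
      then show "cls v \<in> fiber sc X ?F x"
        unfolding fiber_def quotient_def using class_eq[OF s(1)] by auto
    qed
  qed
  have cls_inj: "v = w" if "cls v = cls w" "v \<in> N x" for v w
  proof -
    obtain s where "(U, s) \<in> ?L" "s x = v" using section_through \<open>v \<in> N x\<close> by blast
    then have "(U, s) \<in> cls w" using that(1) by (auto simp: cls_def)
    then show ?thesis using \<open>s x = v\<close> by (auto simp: cls_def)
  qed
  have subx: "vs.subspace (N x)" using frame_subspace[OF fr xU] .
  have add: "fiber_add sc X ?F x (cls v) (cls w) = cls (v + w)" if vw: "v \<in> N x" "w \<in> N x" for v w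
  proof -
    have step: "?R `` {(V \<inter> W, restr (V \<inter> W) (\<lambda>y. s y + t y))} = cls (v + w)"
      if "(V, s) \<in> cls v" "(W, t) \<in> cls w" for V s W t
    proof -
      have *: "(V, s) \<in> ?L" "(W, t) \<in> ?L" "s x = v" "t x = w" using that by (auto simp: cls_def)
      let ?Z = "V \<inter> W"
      have Z: "is_open ?Z" "x \<in> ?Z" using * by (auto simp: L)
      have "section_on ?Z s" "section_on ?Z t" "\<forall>y\<in>?Z. s y \<in> N y \<and> t y \<in> N y"
        using * Z section_on_subset by (auto simp: L subspace_sheaf_iff)
      moreover have "\<forall>y\<in>?Z. vs.subspace (N y)"
        using locally_framed_subspace[OF lf] Z(1) openin_subset by blast
      ultimately have "restr ?Z (\<lambda>y. s y + t y) \<in> ?F ?Z"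
        using section_on_add vs.subspace_add
        by (simp add: subspace_sheaf_iff[OF Z(1)] section_on_restr) (simp add: restr_def)
      then have "(?Z, restr ?Z (\<lambda>y. s y + t y)) \<in> ?L" using Z by (simp add: L)
      from class_eq[OF this] show ?thesis using Z * by (simp add: restr_def)
    qed
    have "cls v \<noteq> {}" "cls w \<noteq> {}" using section_through vw unfolding cls_def by blast+
    moreover have "fiber_add sc X ?F x (cls v) (cls w) = (\<Union>p\<in>cls v. \<Union>q\<in>cls w. cls (v + w))"
      unfolding fiber_add_def
    proof (intro SUP_cong refl)
      fix p assume p: "p \<in> cls v"
      obtain V s where p_eq: "p = (V, s)" by (cases p)
      show "(case p of (V, s) \<Rightarrow> \<Union>(W, t)\<in>cls w. ?R `` {(V \<inter> W, restr (V \<inter> W) (\<lambda>y. s y + t y))}) =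
        (\<Union>q\<in>cls w. cls (v + w))"
        unfolding p_eq prod.case
      proof (intro SUP_cong refl)
        fix q assume q: "q \<in> cls w"
        obtain W t where q_eq: "q = (W, t)" by (cases q)
        show "(case q of (W, t) \<Rightarrow> ?R `` {(V \<inter> W, restr (V \<inter> W) (\<lambda>y. s y + t y))}) = cls (v + w)"
          unfolding q_eq prod.case by (rule step) (use p q p_eq q_eq in simp_all)
      qed
    qed
    ultimately show ?thesis by simp
  qed
  have scale: "fiber_scale sc X ?F x c (cls v) = cls (sc c v)" if v: "v \<in> N x" for c v
  proof -
    have step: "?R `` {(V, \<lambda>y. sc c (s y))} = cls (sc c v)" if "(V, s) \<in> cls v" for V s
    proof -
      have *: "(V, s) \<in> ?L" "s x = v" using that by (auto simp: cls_def)
      then have V: "is_open V" "x \<in> V" by (auto simp: L)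
      have "\<forall>y\<in>V. vs.subspace (N y)"
        using locally_framed_subspace[OF lf] V(1) openin_subset by blast
      then have "(V, \<lambda>y. sc c (s y)) \<in> ?L"
        using * V vs.subspace_scale section_on_scale[OF regular_on_const[OF V(1)]]
        by (simp add: L subspace_sheaf_iff)
      from class_eq[OF this] show ?thesis using * by simp
    qed
    have "cls v \<noteq> {}" using section_through v unfolding cls_def by blast
    moreover have "fiber_scale sc X ?F x c (cls v) = (\<Union>p\<in>cls v. cls (sc c v))"
      unfolding fiber_scale_def
    proof (intro SUP_cong refl)
      fix p assume p: "p \<in> cls v"
      obtain V s where p_eq: "p = (V, s)" by (cases p)
      show "(case p of (V, s) \<Rightarrow> ?R `` {(V, \<lambda>y. sc c (s y))}) = cls (sc c v)"
        unfolding p_eq prod.case by (rule step) (use p p_eq in simp)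
    qed
    ultimately show ?thesis by simp
  qed
  define \<phi> where "\<phi> = inv_into (N x) cls"
  have inj: "inj_on cls (N x)" using cls_inj by (auto intro: inj_onI)
  have \<phi>: "\<phi> (cls v) = v" if "v \<in> N x" for v using that inj by (simp add: \<phi>_def)
  show ?thesis
    unfolding fiber_naturally_identified_def fib
  proof (intro exI[of _ \<phi>] conjI)
    show "\<forall>(V, s)\<in>?L. \<phi> (?R `` {(V, s)}) = s x" using class_eq value_in \<phi> by auto
    show "bij_betw \<phi> (cls ` N x) (N x)"
      unfolding \<phi>_def by (rule bij_betw_inv_into) (simp add: inj inj_on_imp_bij_betw)
    show "\<forall>C\<in>cls ` N x. \<forall>D\<in>cls ` N x. fiber_add sc X ?F x C D \<in> cls ` N x \<and>
      \<phi> (fiber_add sc X ?F x C D) = \<phi> C + \<phi> D"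
      using add \<phi> vs.subspace_add[OF subx] by auto
    show "\<forall>c. \<forall>C\<in>cls ` N x. fiber_scale sc X ?F x c C \<in> cls ` N x \<and>
      \<phi> (fiber_scale sc X ?F x c C) = sc c (\<phi> C)"
      using scale \<phi> vs.subspace_scale[OF subx] by auto
  qed
qed

end

section \<open>Subspaces of constant dimension\<close>

context tensor_sheaf
begin

text \<open>Choose generators that form a basis at \<open>x\<close>. They stay independent nearby, and as the dimension does
  not grow, they go on to span.\<close>

lemma frame_of_constant_rank_span:
  assumes U: "is_open U" "x \<in> U" and g: "\<And>c. c \<in> C \<Longrightarrow> section_on U (g c)"
    and N: "\<And>y. y \<in> U \<Longrightarrow> N y = vs.span ((\<lambda>c. g c y) ` C)"
    and dim: "\<And>y. y \<in> U \<Longrightarrow> vs.dim (N y) = d"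
  shows "\<exists>W c. x \<in> W \<and> W \<subseteq> U \<and> (\<forall>i<d. c i \<in> C) \<and> frame_on N W d (\<lambda>i. g (c i))"
proof -
  obtain A where A: "A \<subseteq> (\<lambda>c. g c x) ` C" "vs.independent A" "(\<lambda>c. g c x) ` C \<subseteq> vs.span A"
    using vs.maximal_independent_subset by blast
  have "N x = vs.span A"
    using A N[OF U(2)] vs.span_minimal[OF A(3) vs.subspace_span] vs.span_mono[OF A(1)] by blast
  then have card: "card A = d" using dim[OF U(2)] vs.dim_span_eq_card_independent[OF A(2)] by simp
  obtain f where f: "bij_betw f {..<d} A"
    using ex_bij_betw_nat_finite[OF vs.finiteI_independent[OF A(2)]] card
    by (auto simp: atLeast0LessThan)
  have "\<exists>c. c \<in> C \<and> g c x = f i" if "i < d" for i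
    using f A(1) that unfolding bij_betw_def by (metis (no_types, lifting) image_iff lessThan_iff subsetD)
  then obtain c where c: "\<And>i. i < d \<Longrightarrow> c i \<in> C" "\<And>i. i < d \<Longrightarrow> g (c i) x = f i" by metis
  have img: "(\<lambda>i. g (c i) x) ` {..<d} = f ` {..<d}" using c(2) by auto
  have inj: "inj_on (\<lambda>i. g (c i) x) {..<d} \<longleftrightarrow> inj_on f {..<d}"
    by (rule inj_on_cong) (use c(2) in auto)
  have "vs.indep_family d (\<lambda>i. g (c i) x)"
    unfolding vs.indep_family_iff img inj using f A(2) unfolding bij_betw_def by simp
  from indep_near[OF U g[OF c(1)] this] obtain W
    where W: "is_open W" "x \<in> W" "W \<subseteq> U" "\<forall>y\<in>W. vs.indep_family d (\<lambda>i. g (c i) y)" by blast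
  have "N y = vs.span ((\<lambda>i. g (c i) y) ` {..<d})" if y: "y \<in> W" for y
  proof (rule vs.indep_family_spans)
    show "vs.indep_family d (\<lambda>i. g (c i) y)" using W(4) y by blast
    show "vs.subspace (N y)" "vs.dim (N y) = d" using N dim W(3) y by auto
    show "g (c i) y \<in> N y" if "i < d" for i
      using N W(3) y c(1)[OF that] by (auto intro: vs.span_base)
  qed
  then have "frame_on N W d (\<lambda>i. g (c i))"
    unfolding frame_on_def using W c(1) g section_on_subset by blast
  with W c(1) show ?thesis by blast
qed

text \<open>Extend a basis \<open>v\<close> of the kernel at \<open>x\<close> by vectors \<open>w\<close> to a basis of the whole space. The
  operators \<open>T\<close> are injective on the span of the \<open>w\<^sub>i\<close> at \<open>x\<close>, so near \<open>x\<close> there are regular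
  functionals on the target dual to the images of the \<open>w\<^sub>i\<close>. They define a regular endomorphism \<open>P\<close>
  that kills every \<open>w\<^sub>i\<close> and is the identity on the kernel. Hence the vectors \<open>P v\<^sub>i\<close> span a space
  that contains the kernel, and by the dimension they are a basis of it.\<close>

lemma frame_of_constant_rank_kernel:
  assumes U: "is_open U" "x \<in> U" and A: "finite A"
    and lin: "\<And>a y. a \<in> A \<Longrightarrow> y \<in> U \<Longrightarrow> module_hom sc sc (T a y)"
    and T: "\<And>a m. a \<in> A \<Longrightarrow> section_on U (\<lambda>y. T a y m)"
    and N: "\<And>y. y \<in> U \<Longrightarrow> N y = {m. \<forall>a\<in>A. T a y m = 0}"
    and dim: "\<And>y. y \<in> U \<Longrightarrow> vs.dim (N y) = d"
  shows "\<exists>W e. x \<in> W \<and> W \<subseteq> U \<and> frame_on N W d e"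
proof -
  note add = module_hom.add[OF lin] and scale = module_hom.scale[OF lin]
  have subN: "vs.subspace (N y)" if "y \<in> U" for y
    unfolding N[OF that]
    by (rule vs.subspaceI) (auto simp: that add scale module_hom.zero[OF lin[OF _ that]])
  obtain B0 where B0: "B0 \<subseteq> N x" "vs.independent B0" "vs.span B0 = N x" "card B0 = d"
    using vs.basis_subspace_exists[OF subN[OF U(2)]] dim[OF U(2)] by metis
  obtain B1 where B1': "B0 \<subseteq> B1" "B1 \<subseteq> UNIV" "vs.independent B1" "UNIV \<subseteq> vs.span B1"
    by (rule vs.maximal_independent_subset_extend[OF subset_UNIV B0(2)])
  then have B1: "B0 \<subseteq> B1" "vs.independent B1" "vs.span B1 = UNIV" by auto
  have fin: "finite B0" "finite (B1 - B0)" using B0(2) B1(2) vs.finiteI_independent by auto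
  obtain v where v: "bij_betw v {..<d} B0"
    using ex_bij_betw_nat_finite[OF fin(1)] B0(4) by (auto simp: atLeast0LessThan)
  define k where "k = card (B1 - B0)"
  obtain w where w: "bij_betw w {..<k} (B1 - B0)"
    using ex_bij_betw_nat_finite[OF fin(2)] by (auto simp: atLeast0LessThan k_def)
  have wB: "w i \<in> B1" "w i \<notin> B0" if "i < k" for i
    using w that unfolding bij_betw_def by auto
  have w_eq: "w i = w j \<longleftrightarrow> i = j" if "i < k" "j < k" for i j
    using w that unfolding bij_betw_def inj_on_def by auto
  define coord where "coord i p y = vs.coordinate (T (fst p) y (w i)) (snd p)" for i p y
  have "\<exists>W l. is_open W \<and> x \<in> W \<and> W \<subseteq> U \<and> (\<forall>i<k. \<forall>p\<in>A \<times> B. regular_on W (l i p)) \<and>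
    (\<forall>y\<in>W. \<forall>i<k. \<forall>j<k. (\<Sum>p\<in>A \<times> B. l i p y * coord j p y) = (if i = j then 1 else 0))"
  proof (rule regular_dual_family[OF U])
    show "finite (A \<times> B)" using A vs.finite_Basis by simp
    show "regular_on U (coord i p)" if "p \<in> A \<times> B" for i p
      using that T[of "fst p" "w i"] unfolding section_on_def coord_def by auto
    show "\<forall>i<k. c i = 0" if c: "\<And>p. p \<in> A \<times> B \<Longrightarrow> (\<Sum>i<k. c i * coord i p x) = 0" for c
    proof (intro allI impI)
      fix j assume j: "j < k"
      let ?m = "\<Sum>i<k. sc (c i) (w i)"
      have "T a x ?m = 0" if a: "a \<in> A" for a
      proof (rule vs.eq_zero_if_coordinates)
        fix b assume "b \<in> B"
        with c[of "(a, b)"] a show "vs.coordinate (T a x ?m) b = 0"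
          by (simp add: module_hom.sum[OF lin[OF a U(2)]] scale[OF a U(2)] vs.coordinate_sum
              vs.coordinate_scale coord_def)
      qed
      then have "?m \<in> vs.span B0" using N[OF U(2)] B0(3) by simp
      then have "vs.representation B1 ?m = vs.representation B0 ?m"
        using vs.representation_extend[OF B1(2) _ B1(1)] by simp
      moreover have "vs.representation B0 ?m (w j) = 0"
        using vs.representation_ne_zero[of B0 ?m "w j"] wB(2)[OF j] by blast
      moreover have "vs.representation B1 ?m (w j) = (\<Sum>i<k. c i * (if i = j then 1 else 0))"
        using wB j w_eq
        by (simp add: vs.representation_sum[OF B1(2)] vs.representation_scale[OF B1(2)]
            vs.representation_basis[OF B1(2)] B1(3) eq_commute[of j] cong: if_cong)
      moreover have "\<dots> = c j" using j by (simp add: if_distrib[of "(*) _"] cong: if_cong)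
      ultimately show "c j = 0" by simp
    qed
  qed
  then obtain W l where W: "is_open W" "x \<in> W" "W \<subseteq> U"
    and l: "\<forall>i<k. \<forall>p\<in>A \<times> B. regular_on W (l i p)"
    and dual: "\<forall>y\<in>W. \<forall>i<k. \<forall>j<k. (\<Sum>p\<in>A \<times> B. l i p y * coord j p y) = (if i = j then 1 else 0)"
    by (elim exE conjE) (rule that)
  \<comment> \<open>\<open>\<Lambda> i y\<close> is the coefficient of \<open>w\<^sub>i\<close> as seen through \<open>T\<close>, and \<open>P y\<close> the resulting projection.\<close>
  define \<Lambda> where "\<Lambda> i y m = (\<Sum>p\<in>A \<times> B. l i p y * vs.coordinate (T (fst p) y m) (snd p))" for i y m
  define P where "P y m = m - (\<Sum>i<k. sc (\<Lambda> i y m) (w i))" for y m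
  have \<Lambda>_add: "\<Lambda> i y (m + m') = \<Lambda> i y m + \<Lambda> i y m'" if "y \<in> W" for i y m m'
    unfolding \<Lambda>_def sum.distrib[symmetric]
    by (rule sum.cong) (use that W(3) in \<open>auto simp: add vs.coordinate_add algebra_simps\<close>)
  have \<Lambda>_scale: "\<Lambda> i y (sc c m) = c * \<Lambda> i y m" if "y \<in> W" for i y c m
    unfolding \<Lambda>_def sum_distrib_left
    by (rule sum.cong) (use that W(3) in \<open>auto simp: scale vs.coordinate_scale algebra_simps\<close>)
  have \<Lambda>_zero: "\<Lambda> i y 0 = 0" if "y \<in> W" for i y
    using \<Lambda>_scale[OF that, of i 0 0] by simp
  have P_add: "P y (m + m') = P y m + P y m'" if "y \<in> W" for y m m'
    by (simp add: P_def \<Lambda>_add[OF that] vs.scale_left_distrib sum.distrib)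
  have P_scale: "P y (sc c m) = sc c (P y m)" if "y \<in> W" for y c m
    by (simp add: P_def \<Lambda>_scale[OF that] vs.scale_right_diff_distrib vs.scale_sum_right)
  have P_w: "P y (w j) = 0" if "y \<in> W" "j < k" for y j
  proof -
    have "(\<Sum>i<k. sc (\<Lambda> i y (w j)) (w i)) = (\<Sum>i<k. if i = j then w i else 0)"
      by (rule sum.cong) (use dual that in \<open>auto simp: \<Lambda>_def coord_def\<close>)
    then show ?thesis using that by (simp add: P_def)
  qed
  have P_N: "P y m = m" if "y \<in> W" "m \<in> N y" for y m
  proof -
    have "\<Lambda> i y m = 0" for i
      unfolding \<Lambda>_def by (rule sum.neutral) (use that N W(3) in \<open>auto simp: vs.coordinate_zero\<close>)
    then show ?thesis by (simp add: P_def)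
  qed
  have "N y = vs.span ((\<lambda>i. P y (v i)) ` {..<d}) \<and> vs.indep_family d (\<lambda>i. P y (v i))" if y: "y \<in> W" for y
  proof (rule vs.spanning_family_indep)
    show "vs.subspace (N y)" "vs.dim (N y) = d" using subN dim W(3) y by auto
    let ?S = "vs.span ((\<lambda>i. P y (v i)) ` {..<d})"
    have "vs.span B1 \<subseteq> {m. P y m \<in> ?S}"
    proof (rule vs.span_minimal)
      show "B1 \<subseteq> {m. P y m \<in> ?S}"
      proof
        fix b assume b: "b \<in> B1"
        show "b \<in> {m. P y m \<in> ?S}"
        proof (cases "b \<in> B0")
          case True
          then obtain i where "i < d" "b = v i" using v unfolding bij_betw_def by auto
          then show ?thesis by (auto intro: vs.span_base)
        next
          case False
          then obtain i where "i < k" "b = w i" using w b unfolding bij_betw_def by force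
          then show ?thesis using P_w[OF y] by (simp add: vs.span_zero)
        qed
      qed
      show "vs.subspace {m. P y m \<in> ?S}"
      proof (rule vs.subspaceI)
        show "0 \<in> {m. P y m \<in> ?S}" using \<Lambda>_zero[OF y] by (simp add: P_def vs.span_zero)
      qed (simp_all add: P_add[OF y] P_scale[OF y] vs.span_add vs.span_scale)
    qed
    then have PS: "P y m \<in> ?S" for m using B1(3) by blast
    show "N y \<subseteq> ?S"
    proof
      fix m assume "m \<in> N y"
      with P_N[OF y this] PS[of m] show "m \<in> ?S" by simp
    qed
  qed
  moreover have "section_on W (\<lambda>y. P y (v i))" for i
    unfolding P_def
  proof (intro section_on_diff section_on_const section_on_sum section_on_scale W(1))
    fix j assume j: "j \<in> {..<k}"
    show "regular_on W (\<lambda>y. \<Lambda> j y (v i))"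
      unfolding \<Lambda>_def
    proof (intro regular_on_sum regular_on_mult W(1))
      fix p assume p: "p \<in> A \<times> B"
      show "regular_on W (l j p)" using l j p by blast
      have "section_on W (\<lambda>y. T (fst p) y (v i))"
        using section_on_subset[OF T W(1,3)] p by auto
      then show "regular_on W (\<lambda>y. vs.coordinate (T (fst p) y (v i)) (snd p))"
        using p unfolding section_on_def by auto
    qed
  qed
  ultimately have "frame_on N W d (\<lambda>i y. P y (v i))" unfolding frame_on_def using W(1) by blast
  with W show ?thesis by blast
qed

end

section \<open>Varieties whose regular functions are local fractions\<close>

text \<open>The common pattern of affine and projective varieties: functions on \<open>X\<close> are evaluated on a set \<open>Y\<close>
  of representatives (points, respectively frames of subspaces), and regular functions are locally
  quotients of pairs from \<open>D\<close> (polynomials, respectively homogeneous polynomials of equal degree).\<close>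

locale fraction_space =
  fixes X :: "('x, 'k::field) variety" and Y :: "'y set" and \<pi> :: "'y \<Rightarrow> 'x"
    and D :: "(('y \<Rightarrow> 'k) \<times> ('y \<Rightarrow> 'k)) set"
  assumes onto: "x \<in> topspace (zariski X) \<Longrightarrow> \<exists>y\<in>Y. \<pi> y = x"
    and regular_fractions: "regular X U = {f. (\<forall>x. x \<notin> U \<longrightarrow> f x = 0) \<and>
      (\<forall>x\<in>U. \<exists>W P Q. openin (zariski X) W \<and> x \<in> W \<and> W \<subseteq> U \<and> (P, Q) \<in> D \<and>
        (\<forall>y\<in>Y. \<pi> y \<in> W \<longrightarrow> Q y \<noteq> 0 \<and> f (\<pi> y) = P y / Q y))}"
    and fraction_const: "((\<lambda>y. c), (\<lambda>y. 1)) \<in> D"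
    and fraction_add: "(P, Q) \<in> D \<Longrightarrow> (P', Q') \<in> D \<Longrightarrow>
      ((\<lambda>y. P y * Q' y + Q y * P' y), (\<lambda>y. Q y * Q' y)) \<in> D"
    and fraction_mult: "(P, Q) \<in> D \<Longrightarrow> (P', Q') \<in> D \<Longrightarrow> ((\<lambda>y. P y * P' y), (\<lambda>y. Q y * Q' y)) \<in> D"
    and fraction_swap: "(P, Q) \<in> D \<Longrightarrow> (Q, P) \<in> D"
    and fraction_open: "(P, Q) \<in> D \<Longrightarrow>
      openin (zariski X) {x \<in> topspace (zariski X). \<exists>y\<in>Y. \<pi> y = x \<and> P y \<noteq> 0}"
begin

definition fraction_at :: "'x set \<Rightarrow> ('x \<Rightarrow> 'k) \<Rightarrow> ('y \<Rightarrow> 'k) \<Rightarrow> ('y \<Rightarrow> 'k) \<Rightarrow> bool" where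
  "fraction_at W f P Q \<longleftrightarrow> openin (zariski X) W \<and> (P, Q) \<in> D \<and>
     (\<forall>y\<in>Y. \<pi> y \<in> W \<longrightarrow> Q y \<noteq> 0 \<and> f (\<pi> y) = P y / Q y)"

lemma regular_fraction_at:
  "f \<in> regular X U \<longleftrightarrow> (\<forall>x. x \<notin> U \<longrightarrow> f x = 0) \<and>
     (\<forall>x\<in>U. \<exists>W P Q. x \<in> W \<and> W \<subseteq> U \<and> fraction_at W f P Q)"
  unfolding regular_fractions fraction_at_def by blast

lemma fraction_at_subset:
  "fraction_at W f P Q \<Longrightarrow> openin (zariski X) V \<Longrightarrow> V \<subseteq> W \<Longrightarrow> fraction_at V f P Q"
  unfolding fraction_at_def by blast

lemma fraction_at_cong:
  "fraction_at W f P Q \<Longrightarrow> (\<And>x. x \<in> W \<Longrightarrow> f x = g x) \<Longrightarrow> fraction_at W g P Q"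
  unfolding fraction_at_def by auto

lemma fraction_at_pair:
  assumes "f \<in> regular X U" "g \<in> regular X U" "x \<in> U"
  shows "\<exists>W P Q P' Q'. x \<in> W \<and> W \<subseteq> U \<and> fraction_at W f P Q \<and> fraction_at W g P' Q'"
proof -
  from assms obtain V P Q V' P' Q' where V: "x \<in> V" "V \<subseteq> U" "fraction_at V f P Q"
    and V': "x \<in> V'" "V' \<subseteq> U" "fraction_at V' g P' Q'"
    unfolding regular_fraction_at by blast
  have "openin (zariski X) (V \<inter> V')" using V(3) V'(3) unfolding fraction_at_def by blast
  then have "fraction_at (V \<inter> V') f P Q" "fraction_at (V \<inter> V') g P' Q'"
    using V(3) V'(3) fraction_at_subset by blast+
  then show ?thesis using V(1,2) V'(1) by blast
qed

lemma function_sheaf: "function_sheaf X"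
proof
  show "f x = 0" if "f \<in> regular X U" "x \<notin> U" for f U x
    using that by (simp add: regular_fraction_at)
next
  fix f U V assume f: "f \<in> regular X U" and V: "openin (zariski X) V" "V \<subseteq> U"
  show "restr V f \<in> regular X V"
    unfolding regular_fraction_at
  proof (intro conjI allI impI ballI)
    fix x assume x: "x \<in> V"
    then obtain W P Q where W: "x \<in> W" "W \<subseteq> U" "fraction_at W f P Q"
      using f V(2) unfolding regular_fraction_at by blast
    have "openin (zariski X) (W \<inter> V)" using W(3) V(1) unfolding fraction_at_def by blast
    then have "fraction_at (W \<inter> V) f P Q" using fraction_at_subset[OF W(3)] by blast
    then have "fraction_at (W \<inter> V) (restr V f) P Q" by (rule fraction_at_cong) (simp add: restr_def)
    then show "\<exists>W P Q. x \<in> W \<and> W \<subseteq> V \<and> fraction_at W (restr V f) P Q" using x W(1) by blast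
  qed (simp add: restr_def)
next
  fix f U
  assume out: "\<And>x. x \<notin> U \<Longrightarrow> f x = 0"
    and loc: "\<And>x. x \<in> U \<Longrightarrow> \<exists>V. openin (zariski X) V \<and> x \<in> V \<and> V \<subseteq> U \<and> restr V f \<in> regular X V"
  show "f \<in> regular X U"
    unfolding regular_fraction_at
  proof (intro conjI allI impI ballI)
    fix x assume "x \<in> U"
    from loc[OF this] obtain V where V: "x \<in> V" "V \<subseteq> U" "restr V f \<in> regular X V" by blast
    then obtain W P Q where W: "x \<in> W" "W \<subseteq> V" "fraction_at W (restr V f) P Q"
      unfolding regular_fraction_at by blast
    have "fraction_at W f P Q" by (rule fraction_at_cong[OF W(3)]) (use W(2) in \<open>auto simp: restr_def\<close>)
    then show "\<exists>W P Q. x \<in> W \<and> W \<subseteq> U \<and> fraction_at W f P Q" using W V by blast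
  qed (rule out)
next
  fix U c assume U: "openin (zariski X) U"
  have "fraction_at U (restr U (\<lambda>x. c)) (\<lambda>y. c) (\<lambda>y. 1)"
    unfolding fraction_at_def using U fraction_const by (simp add: restr_def)
  then show "restr U (\<lambda>x. c) \<in> regular X U"
    unfolding regular_fraction_at by (auto simp: restr_def)
next
  fix f g U assume fg: "f \<in> regular X U" "g \<in> regular X U"
  show "(\<lambda>x. f x + g x) \<in> regular X U"
    unfolding regular_fraction_at
  proof (intro conjI allI impI ballI)
    fix x assume "x \<in> U"
    from fraction_at_pair[OF fg this] obtain W P Q P' Q'
      where W: "x \<in> W" "W \<subseteq> U" "fraction_at W f P Q" "fraction_at W g P' Q'" by blast
    have "openin (zariski X) W" and PQ: "(P, Q) \<in> D" "(P', Q') \<in> D"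
      using W(3,4) by (simp_all add: fraction_at_def)
    moreover have "\<forall>y\<in>Y. \<pi> y \<in> W \<longrightarrow> Q y * Q' y \<noteq> 0 \<and>
        f (\<pi> y) + g (\<pi> y) = (P y * Q' y + Q y * P' y) / (Q y * Q' y)"
      using W(3,4) by (simp add: fraction_at_def add_frac_eq mult.commute)
    ultimately have "fraction_at W (\<lambda>x. f x + g x) (\<lambda>y. P y * Q' y + Q y * P' y) (\<lambda>y. Q y * Q' y)"
      unfolding fraction_at_def using fraction_add[OF PQ] by simp
    then show "\<exists>W P Q. x \<in> W \<and> W \<subseteq> U \<and> fraction_at W (\<lambda>x. f x + g x) P Q" using W(1,2) by blast
  qed (use fg in \<open>simp add: regular_fraction_at\<close>)
next
  fix f g U assume fg: "f \<in> regular X U" "g \<in> regular X U"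
  show "(\<lambda>x. f x * g x) \<in> regular X U"
    unfolding regular_fraction_at
  proof (intro conjI allI impI ballI)
    fix x assume "x \<in> U"
    from fraction_at_pair[OF fg this] obtain W P Q P' Q'
      where W: "x \<in> W" "W \<subseteq> U" "fraction_at W f P Q" "fraction_at W g P' Q'" by blast
    then have "fraction_at W (\<lambda>x. f x * g x) (\<lambda>y. P y * P' y) (\<lambda>y. Q y * Q' y)"
      unfolding fraction_at_def by (auto intro: fraction_mult)
    then show "\<exists>W P Q. x \<in> W \<and> W \<subseteq> U \<and> fraction_at W (\<lambda>x. f x * g x) P Q" using W(1,2) by blast
  qed (use fg in \<open>simp add: regular_fraction_at\<close>)
next
  fix f U assume U: "openin (zariski X) U" and f: "f \<in> regular X U"
  show "openin (zariski X) {x \<in> U. f x \<noteq> 0}"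
  proof (subst openin_subopen, rule ballI)
    fix x assume x: "x \<in> {x \<in> U. f x \<noteq> 0}"
    then obtain W P Q where W: "x \<in> W" "W \<subseteq> U" "fraction_at W f P Q"
      using f unfolding regular_fraction_at by blast
    have WX: "openin (zariski X) W" "W \<subseteq> topspace (zariski X)" "(P, Q) \<in> D"
      and val: "\<forall>y\<in>Y. \<pi> y \<in> W \<longrightarrow> Q y \<noteq> 0 \<and> f (\<pi> y) = P y / Q y"
      using W(3) openin_subset unfolding fraction_at_def by auto
    let ?V = "W \<inter> {x \<in> topspace (zariski X). \<exists>y\<in>Y. \<pi> y = x \<and> P y \<noteq> 0}"
    have "openin (zariski X) ?V" using WX(1) fraction_open[OF WX(3)] by blast
    moreover have "x \<in> ?V"
    proof -
      obtain y where "y \<in> Y" "\<pi> y = x" using onto W(1) WX(2) by blast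
      then show ?thesis using val x W(1) WX(2) by auto
    qed
    moreover have "?V \<subseteq> {x \<in> U. f x \<noteq> 0}" using W(2) val by auto
    ultimately show "\<exists>T. openin (zariski X) T \<and> x \<in> T \<and> T \<subseteq> {x \<in> U. f x \<noteq> 0}" by blast
  qed
next
  fix f U assume f: "f \<in> regular X U" and nz: "\<And>x. x \<in> U \<Longrightarrow> f x \<noteq> 0"
  show "(\<lambda>x. inverse (f x)) \<in> regular X U"
    unfolding regular_fraction_at
  proof (intro conjI allI impI ballI)
    fix x assume "x \<in> U"
    then obtain W P Q where W: "x \<in> W" "W \<subseteq> U" "fraction_at W f P Q"
      using f unfolding regular_fraction_at by blast
    have "P y \<noteq> 0" if "y \<in> Y" "\<pi> y \<in> W" for y
      using that W nz[of "\<pi> y"] unfolding fraction_at_def by auto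
    then have "fraction_at W (\<lambda>x. inverse (f x)) Q P"
      using W(3) unfolding fraction_at_def by (auto intro: fraction_swap)
    then show "\<exists>W P Q. x \<in> W \<and> W \<subseteq> U \<and> fraction_at W (\<lambda>x. inverse (f x)) P Q" using W(1,2) by blast
  qed (use f in \<open>simp add: regular_fraction_at\<close>)
qed

end

lemma openin_preimage_generated:
  assumes "openin (topology_generated_by S) V"
    and gen: "\<And>G. G \<in> S \<Longrightarrow> openin T {x \<in> U. f x \<in> G}"
  shows "openin T {x \<in> U. f x \<in> V}"
proof -
  from assms(1) have "generate_topology_on S V" by (simp add: openin_topology_generated_by_iff)
  then show ?thesis
  proof induction
    case Empty
    then show ?case by simp
  next
    case (Int a b)
    have "{x \<in> U. f x \<in> a \<inter> b} = {x \<in> U. f x \<in> a} \<inter> {x \<in> U. f x \<in> b}" by blast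
    then show ?case using openin_Int[OF Int.IH] by simp
  next
    case (UN K)
    have "{x \<in> U. f x \<in> \<Union>K} = (\<Union>k\<in>K. {x \<in> U. f x \<in> k})" by blast
    then show ?case using UN by auto
  next
    case (Basis s)
    then show ?case by (rule gen)
  qed
qed

lemma tuple_basic_open:
  "P \<in> polynomials (coord_funs L r) \<Longrightarrow> openin (zariski (tuple_variety L r Z)) {X \<in> Z. P X \<noteq> 0}"
  unfolding tuple_variety_def Let_def variety.simps
  by (rule topology_generated_by_Basis, rule CollectI, intro exI conjI, rule refl)

lemma topspace_tuple_variety:
  fixes L :: "('k::field, 'g::ab_group_add) lie"
  shows "topspace (zariski (tuple_variety L r Z)) = Z"
proof
  show "topspace (zariski (tuple_variety L r Z)) \<subseteq> Z"
    unfolding tuple_variety_def Let_def by auto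
  show "Z \<subseteq> topspace (zariski (tuple_variety L r Z))"
    using openin_subset[OF tuple_basic_open[OF polynomials.const[of 1], where Z = Z]] by simp
qed

lemma fraction_space_tuple_variety:
  "fraction_space (tuple_variety L r Z) UNIV id
     (polynomials (coord_funs L r) \<times> polynomials (coord_funs L r))"
proof
  fix P Q
  assume "(P, Q) \<in> polynomials (coord_funs L r) \<times> polynomials (coord_funs L r)"
  then show "openin (zariski (tuple_variety L r Z))
    {x \<in> topspace (zariski (tuple_variety L r Z)). \<exists>y\<in>UNIV. id y = x \<and> P y \<noteq> 0}"
    using tuple_basic_open[of P L r Z] by (simp add: topspace_tuple_variety)
next
  show "regular (tuple_variety L r Z) U = {f. (\<forall>x. x \<notin> U \<longrightarrow> f x = 0) \<and>
      (\<forall>x\<in>U. \<exists>W P Q. openin (zariski (tuple_variety L r Z)) W \<and> x \<in> W \<and> W \<subseteq> U \<and>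
        (P, Q) \<in> polynomials (coord_funs L r) \<times> polynomials (coord_funs L r) \<and>
        (\<forall>y\<in>UNIV. id y \<in> W \<longrightarrow> Q y \<noteq> 0 \<and> f (id y) = P y / Q y))}" for U
    by (simp add: tuple_variety_def Let_def Ball_def)
qed (simp_all add: polynomials.add polynomials.mult polynomials.const)

lemma homogeneous_subset_polynomials:
  assumes "homogeneous C d P" "C \<subseteq> polynomials C'"
  shows "P \<in> polynomials C'"
  using assms(1)
proof induction
  case (coord y)
  then show ?case using assms(2) by blast
qed (rule polynomials.const polynomials.add polynomials.mult; assumption?)+

lemma grassmannian_basic_open:
  "homogeneous (pluecker_funs L r) d P \<Longrightarrow> openin (zariski (grassmannian_subvariety L r Z))
     {\<epsilon> \<in> Z. \<exists>X\<in>frames L r. frame_span L X = \<epsilon> \<and> P X \<noteq> 0}"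
  unfolding grassmannian_subvariety_def Let_def variety.simps
  by (rule topology_generated_by_Basis, rule CollectI, intro exI conjI, rule refl)

lemma topspace_grassmannian_subvariety:
  fixes L :: "('k::field, 'g::ab_group_add) lie"
  shows "topspace (zariski (grassmannian_subvariety L r Z)) =
    {\<epsilon> \<in> Z. \<exists>X\<in>frames L r. frame_span L X = \<epsilon>}"
proof
  show "topspace (zariski (grassmannian_subvariety L r Z)) \<subseteq> {\<epsilon> \<in> Z. \<exists>X\<in>frames L r. frame_span L X = \<epsilon>}"
    unfolding grassmannian_subvariety_def Let_def by auto
  show "{\<epsilon> \<in> Z. \<exists>X\<in>frames L r. frame_span L X = \<epsilon>} \<subseteq> topspace (zariski (grassmannian_subvariety L r Z))"
    using openin_subset[OF grassmannian_basic_open[OF homogeneous.const[of _ 1], where Z = Z]] by simp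
qed

definition homogeneous_pairs :: "('x \<Rightarrow> 'k::field) set \<Rightarrow> (('x \<Rightarrow> 'k) \<times> ('x \<Rightarrow> 'k)) set" where
  "homogeneous_pairs C = {(P, Q). \<exists>d. homogeneous C d P \<and> homogeneous C d Q}"

lemma homogeneous_pairs_mult:
  assumes "(P, Q) \<in> homogeneous_pairs C" "(P', Q') \<in> homogeneous_pairs C"
  shows "((\<lambda>y. P y * P' y), (\<lambda>y. Q y * Q' y)) \<in> homogeneous_pairs C"
    and "((\<lambda>y. P y * Q' y + Q y * P' y), (\<lambda>y. Q y * Q' y)) \<in> homogeneous_pairs C"
proof -
  from assms obtain d e where *: "homogeneous C d P" "homogeneous C d Q"
    "homogeneous C e P'" "homogeneous C e Q'" unfolding homogeneous_pairs_def by blast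
  note QQ = homogeneous.mult[OF *(2,4)]
  show "((\<lambda>y. P y * P' y), (\<lambda>y. Q y * Q' y)) \<in> homogeneous_pairs C"
    using homogeneous.mult[OF *(1,3)] QQ unfolding homogeneous_pairs_def by blast
  have "homogeneous C (d + e) (\<lambda>y. P y * Q' y + Q y * P' y)"
    by (rule homogeneous.add[OF homogeneous.mult[OF *(1,4)] homogeneous.mult[OF *(2,3)]])
  then show "((\<lambda>y. P y * Q' y + Q y * P' y), (\<lambda>y. Q y * Q' y)) \<in> homogeneous_pairs C"
    using QQ unfolding homogeneous_pairs_def by blast
qed

lemma fraction_space_grassmannian_subvariety:
  fixes L :: "('k::field, 'g::ab_group_add) lie"
  shows "fraction_space (grassmannian_subvariety L r Z) (frames L r) (frame_span L)
    (homogeneous_pairs (pluecker_funs L r))"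
proof
  fix P Q
  assume "(P, Q) \<in> homogeneous_pairs (pluecker_funs L r)"
  then obtain d where P: "homogeneous (pluecker_funs L r) d P" unfolding homogeneous_pairs_def by blast
  have "{x \<in> topspace (zariski (grassmannian_subvariety L r Z)).
      \<exists>y\<in>frames L r. frame_span L y = x \<and> P y \<noteq> 0} =
    {\<epsilon> \<in> Z. \<exists>X\<in>frames L r. frame_span L X = \<epsilon> \<and> P X \<noteq> 0}"
    unfolding topspace_grassmannian_subvariety by blast
  then show "openin (zariski (grassmannian_subvariety L r Z))
    {x \<in> topspace (zariski (grassmannian_subvariety L r Z)).
      \<exists>y\<in>frames L r. frame_span L y = x \<and> P y \<noteq> 0}"
    using grassmannian_basic_open[OF P, where Z = Z] by simp
next
  show "regular (grassmannian_subvariety L r Z) U =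
    {f. (\<forall>x. x \<notin> U \<longrightarrow> f x = 0) \<and>
      (\<forall>x\<in>U. \<exists>W P Q. openin (zariski (grassmannian_subvariety L r Z)) W \<and> x \<in> W \<and> W \<subseteq> U \<and>
        (P, Q) \<in> homogeneous_pairs (pluecker_funs L r) \<and>
        (\<forall>y\<in>frames L r. frame_span L y \<in> W \<longrightarrow> Q y \<noteq> 0 \<and> f (frame_span L y) = P y / Q y))}" for U
    unfolding grassmannian_subvariety_def Let_def homogeneous_pairs_def
    by (simp, blast)
next
  show "((\<lambda>y. c), (\<lambda>y. 1)) \<in> homogeneous_pairs (pluecker_funs L r)" for c
    unfolding homogeneous_pairs_def using homogeneous.const by blast
qed (simp_all add: topspace_grassmannian_subvariety homogeneous_pairs_mult, simp add: homogeneous_pairs_def, blast)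

section \<open>Pluecker charts\<close>

locale lie_geometry = lv: finite_dimensional_vector_space "lscale L" "lbasis L"
  for L :: "('k::field, 'g::ab_group_add) lie" + fixes r :: nat
begin

lemma coord_fun_eq: "coord_fun L x s X = lv.coordinate (X ! s) x"
  by (simp add: coord_fun_def)

lemma set_eq_nth_image: "length X = n \<Longrightarrow> set X = (!) X ` {..<n}"
  by (auto simp: in_set_conv_nth)

lemma frames_iff: "X \<in> frames L r \<longleftrightarrow> length X = r \<and> lv.indep_family r ((!) X)"
proof -
  have "inj_on ((!) X) {..<r} \<longleftrightarrow> distinct X" if "length X = r"
    using that by (auto simp: distinct_conv_nth inj_on_def)
  then show ?thesis by (auto simp: frames_def lv.indep_family_iff set_eq_nth_image)
qed

lemma frame_span_eq: "length X = r \<Longrightarrow> frame_span L X = lv.span ((!) X ` {..<r})"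
  by (simp add: frame_span_def set_eq_nth_image)

lemma frame_span_iff:
  "length X = r \<Longrightarrow> y \<in> frame_span L X \<longleftrightarrow> (\<exists>a. y = (\<Sum>s<r. lscale L (a s) (X ! s)))"
  by (simp add: frame_span_eq lv.in_span_family)

lemma dim_frame_span: "X \<in> frames L r \<Longrightarrow> lv.dim (frame_span L X) = r"
  unfolding frame_span_def by (simp add: frames_def lv.dim_eq_card_independent distinct_card)

lemma frame_of_independent_elements:
  assumes "X \<in> frames L r" "length Y = r" "lv.indep_family r ((!) Y)"
    "\<And>s. s < r \<Longrightarrow> Y ! s \<in> frame_span L X"
  shows "Y \<in> frames L r \<and> frame_span L Y = frame_span L X"
proof
  show "Y \<in> frames L r" using assms(2,3) frames_iff by blast
  show "frame_span L Y = frame_span L X"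
    unfolding frame_span_eq[OF assms(2)]
    by (rule lv.indep_family_spans[OF assms(3), symmetric])
       (use assms(4) dim_frame_span[OF assms(1)] in \<open>auto simp: frame_span_def\<close>)
qed

text \<open>The coordinate matrix of the new frame is that of the old frame times the matrix of the base change,
  so \<open>c\<close> is the determinant of the latter.\<close>

lemma pluecker_change_of_frame:
  assumes X: "length X = r" and X': "length X' = r" "\<And>s. s < r \<Longrightarrow> X' ! s \<in> frame_span L X"
  shows "\<exists>c. \<forall>b. pluecker L r b X' = c * pluecker L r b X"
proof -
  have "\<exists>a. X' ! s = (\<Sum>t<r. lscale L (a t) (X ! t))" if "s < r" for s
    using X'(2)[OF that] frame_span_iff[OF X] by blast
  then obtain g where g: "\<And>s. s < r \<Longrightarrow> X' ! s = (\<Sum>t<r. lscale L (g s t) (X ! t))" by metis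
  define G where "G = Matrix.mat r r (\<lambda>(s, t). g s t)"
  define A where "A b = Matrix.mat r r (\<lambda>(s, i). coord_fun L (b ! i) s X)" for b
  have "Matrix.mat r r (\<lambda>(s, i). coord_fun L (b ! i) s X') = G * A b" for b
    by (rule eq_matI)
       (simp_all add: G_def A_def coord_fun_eq g lv.coordinate_sum lv.coordinate_scale scalar_prod_def
         atLeast0LessThan)
  moreover have "G \<in> carrier_mat r r" "A b \<in> carrier_mat r r" for b by (simp_all add: G_def A_def)
  ultimately have "pluecker L r b X' = Determinant.det G * pluecker L r b X" for b
    unfolding pluecker_def by (simp add: det_mult A_def)
  then show ?thesis by blast
qed

text \<open>Extend the frame to a basis by a set \<open>C\<close> of standard basis vectors, and let \<open>b\<close> list the remaining
  standard basis vectors. A combination of the frame whose coordinates at \<open>b\<close> vanish lies in the span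
  of \<open>C\<close>, hence is zero; so the minor at \<open>b\<close> is invertible.\<close>

lemma pluecker_nonzero:
  assumes X: "X \<in> frames L r"
  shows "\<exists>b. b \<in> lists (lbasis L) \<and> length b = r \<and> pluecker L r b X \<noteq> 0"
proof -
  have len: "length X = r" and dist: "distinct X" and indX: "lv.independent (set X)"
    and fam: "lv.indep_family r ((!) X)"
    using X frames_iff unfolding frames_def by auto
  obtain B where B: "set X \<subseteq> B" "B \<subseteq> set X \<union> lbasis L" "lv.independent B" "set X \<union> lbasis L \<subseteq> lv.span B"
    by (rule lv.maximal_independent_subset_extend[OF Un_upper1 indX])
  define C where "C = B - set X"
  have C: "C \<subseteq> lbasis L" "lv.independent C" "finite C"
    using B(2) lv.independent_mono[OF B(3)] lv.finiteI_independent[OF B(3)] by (auto simp: C_def)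
  have spanB: "lv.span B = UNIV"
    using lv.span_mono[OF B(4)] lv.span_mono[of "lbasis L" "set X \<union> lbasis L"] lv.span_Basis lv.span_span by auto
  have "card B = card (lbasis L)"
    using lv.dim_span_eq_card_independent[OF B(3)] lv.dim_UNIV spanB by simp
  moreover have "card B = r + card C"
    using lv.finiteI_independent[OF B(3)] B(1) dist len card_Diff_subset[of "set X" B] card_mono[of B "set X"]
    by (simp add: C_def distinct_card)
  ultimately have card: "card (lbasis L - C) = r"
    using C card_Diff_subset[of C "lbasis L"] by simp
  obtain b where b: "set b = lbasis L - C" "distinct b"
    using finite_distinct_list[of "lbasis L - C"] lv.finite_Basis by auto
  have lenb: "length b = r" using b card distinct_card by metis
  define A where "A = Matrix.mat r r (\<lambda>(s, i). coord_fun L (b ! i) s X)"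
  have A: "A \<in> carrier_mat r r" by (simp add: A_def)
  have "Determinant.det A \<noteq> 0"
  proof
    assume "Determinant.det A = 0"
    then have "Determinant.det (transpose_mat A) = 0" using det_transpose[OF A] by simp
    then obtain v where v: "v \<in> carrier_vec r" "v \<noteq> 0\<^sub>v r" "transpose_mat A *\<^sub>v v = 0\<^sub>v r"
      using det_0_iff_vec_prod_zero_field[of "transpose_mat A" r] A by auto
    let ?y = "\<Sum>s<r. lscale L (v $ s) (X ! s)"
    have coord0: "lv.coordinate ?y x = 0" if x: "x \<in> lbasis L - C" for x
    proof -
      from x b lenb obtain i where i: "i < r" "x = b ! i" by (metis in_set_conv_nth)
      have "0 = (transpose_mat A *\<^sub>v v) $ i" using v(3) i by simp
      also have "\<dots> = (\<Sum>s<r. coord_fun L x s X * v $ s)"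
        using i v(1) by (simp add: A_def scalar_prod_def atLeast0LessThan)
      finally show ?thesis
        by (simp add: lv.coordinate_sum lv.coordinate_scale coord_fun_eq mult.commute)
    qed
    have "?y = (\<Sum>x\<in>lbasis L. lscale L (lv.coordinate ?y x) x)" by (simp add: lv.coordinate_expansion)
    also have "\<dots> = (\<Sum>x\<in>C. lscale L (lv.coordinate ?y x) x)"
      by (rule sum.mono_neutral_right) (use coord0 C lv.finite_Basis in auto)
    also have "\<dots> \<in> lv.span C" by (intro lv.span_sum lv.span_scale lv.span_base)
    finally have yC: "?y \<in> lv.span C" .
    then have repC: "lv.representation B ?y = lv.representation C ?y"
      by (intro lv.representation_extend B(3)) (auto simp: C_def)
    have "v $ s = 0" if s: "s < r" for s
    proof -
      have "X ! s \<in> B" "X ! s \<notin> C" using s len B(1) by (auto simp: C_def)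
      have "lv.representation B ?y (X ! s) = (\<Sum>t<r. v $ t * (if t = s then 1 else 0))"
        using s len dist B(1) spanB
        by (simp add: lv.representation_sum[OF B(3)] lv.representation_scale[OF B(3)]
            lv.representation_basis[OF B(3)] subset_iff nth_eq_iff_index_eq eq_commute[of s] cong: if_cong)
      also have "\<dots> = v $ s" using s by (simp add: if_distrib[of "(*) _"] cong: if_cong)
      finally have "v $ s = lv.representation C ?y (X ! s)" by (simp add: repC)
      also have "\<dots> = 0" using lv.representation_ne_zero[of C ?y "X ! s"] \<open>X ! s \<notin> C\<close> by blast
      finally show ?thesis .
    qed
    then have "v = 0\<^sub>v r" using v(1) by (intro eq_vecI) auto
    then show False using v(2) by simp
  qed
  then show ?thesis
    using b(1) lenb by (intro exI[of _ b]) (auto simp: pluecker_def A_def)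
qed

text \<open>This is why evaluating a homogeneous polynomial of Pluecker coordinates at a frame says something
  about the subspace: ratios of equal degree and nonvanishing do not depend on the frame.\<close>

lemma homogeneous_change_of_frame:
  assumes X: "X \<in> frames L r" and X': "X' \<in> frames L r" "frame_span L X' = frame_span L X"
  shows "\<exists>c. c \<noteq> 0 \<and> (\<forall>d P. homogeneous (pluecker_funs L r) d P \<longrightarrow> P X' = c ^ d * P X)"
proof -
  have "X' ! s \<in> frame_span L X" if "s < r" for s
  proof -
    have "X' ! s \<in> set X'" using X'(1) that frames_iff by simp
    then have "X' ! s \<in> frame_span L X'" unfolding frame_span_def by (rule lv.span_base)
    then show ?thesis by (simp add: X'(2))
  qed
  then obtain c where c: "\<And>b. pluecker L r b X' = c * pluecker L r b X"
    using pluecker_change_of_frame[of X X'] X X' frames_iff by auto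
  have "c \<noteq> 0" using pluecker_nonzero[OF X'(1)] by (auto simp: c)
  moreover have "P X' = c ^ d * P X" if "homogeneous (pluecker_funs L r) d P" for d P
    using that
  proof induction
    case (coord y)
    then show ?case using c by (auto simp: pluecker_funs_def)
  qed (simp_all add: algebra_simps power_add)
  ultimately show ?thesis by blast
qed

text \<open>The basis of the span of \<open>X\<close> whose coordinates at \<open>b\<close> form the identity matrix, with its other
  coordinates written as ratios of Pluecker coordinates by Cramer's rule.\<close>

definition reduced_frame :: "'g list \<Rightarrow> 'g list \<Rightarrow> 'g list" where
  "reduced_frame b X = map (\<lambda>s. \<Sum>c\<in>lbasis L.
     lscale L (pluecker L r (b[s := c]) X / pluecker L r b X) c) [0..<r]"

lemma coord_reduced_frame:
  "c \<in> lbasis L \<Longrightarrow> s < r \<Longrightarrow>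
     coord_fun L c s (reduced_frame b X) = pluecker L r (b[s := c]) X / pluecker L r b X"
  by (simp add: coord_fun_eq reduced_frame_def lv.coordinate_of_expansion)

text \<open>Expanding the minor with \<open>b\<^sub>s\<close> replaced by \<open>c\<close> along its column \<open>s\<close> shows that the reduced vectors
  are combinations of \<open>X\<close>, with cofactors as coefficients. Their coordinates at \<open>b\<close> form the identity
  matrix, since a minor with a repeated column vanishes; so they are independent.\<close>

lemma reduced_frame:
  assumes X: "X \<in> frames L r" and b: "b \<in> lists (lbasis L)" "length b = r" and nz: "pluecker L r b X \<noteq> 0"
  shows "reduced_frame b X \<in> frames L r \<and> frame_span L (reduced_frame b X) = frame_span L X"
proof (rule frame_of_independent_elements[OF X])
  let ?Y = "reduced_frame b X"
  define A where "A = Matrix.mat r r (\<lambda>(s, i). coord_fun L (b ! i) s X)"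
  have len: "length X = r" using X frames_iff by blast
  show "length ?Y = r" by (simp add: reduced_frame_def)
  show "?Y ! s \<in> frame_span L X" if s: "s < r" for s
  proof -
    have cramer: "pluecker L r (b[s := c]) X = (\<Sum>t<r. coord_fun L c t X * cofactor A t s)" for c
    proof -
      define A' where "A' = Matrix.mat r r (\<lambda>(t, i). coord_fun L (b[s := c] ! i) t X)"
      have "cofactor A' t s = cofactor A t s" if "t < r" for t
      proof -
        have "mat_delete A' t s = mat_delete A t s"
          unfolding mat_delete_def A'_def A_def using s that b(2)
          by (intro eq_matI) (auto simp: nth_list_update)
        then show ?thesis by (simp add: cofactor_def)
      qed
      moreover have "A' \<in> carrier_mat r r" by (simp add: A'_def)
      moreover have "A' $$ (t, s) = coord_fun L c t X" if "t < r" for t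
        using that s b(2) by (simp add: A'_def)
      ultimately show ?thesis
        unfolding pluecker_def A'_def[symmetric] using laplace_expansion_column[of A' r s] s by simp
    qed
    have "?Y ! s = (\<Sum>c\<in>lbasis L. \<Sum>t<r.
        lscale L (cofactor A t s / pluecker L r b X) (lscale L (lv.coordinate (X ! t) c) c))"
      using s by (simp add: reduced_frame_def cramer sum_divide_distrib lv.scale_sum_left coord_fun_eq mult.commute)
    also have "\<dots> = (\<Sum>t<r. lscale L (cofactor A t s / pluecker L r b X) (X ! t))"
      by (subst sum.swap) (simp add: lv.scale_sum_right[symmetric] lv.coordinate_expansion del: lv.scale_scale)
    finally show ?thesis
      unfolding frame_span_iff[OF len]
      by (rule exI[of _ "\<lambda>t. cofactor A t s / pluecker L r b X"])
  qed
  have delta: "lv.coordinate (?Y ! s) (b ! i) = (if i = s then 1 else 0)" if si: "s < r" "i < r" for s i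
  proof -
    have bi: "b ! i \<in> lbasis L" using b si by (auto simp: in_lists_conv_set)
    have *: "lv.coordinate (?Y ! s) (b ! i) = pluecker L r (b[s := b ! i]) X / pluecker L r b X"
      using coord_reduced_frame[OF bi si(1)] by (simp add: coord_fun_eq)
    show ?thesis
    proof (cases "i = s")
      case True
      then show ?thesis using * nz by simp
    next
      case False
      let ?A = "Matrix.mat r r (\<lambda>(t, k). coord_fun L (b[s := b ! i] ! k) t X)"
      have "col ?A i = col ?A s" using si False b(2) by (intro eq_vecI) auto
      then have "Determinant.det ?A = 0"
        using det_identical_columns[of ?A r i s] False si by simp
      then show ?thesis using * False by (simp add: pluecker_def)
    qed
  qed
  show "lv.indep_family r ((!) ?Y)"
    unfolding lv.indep_family_def
  proof (intro allI impI)
    fix a i assume *: "(\<Sum>s<r. lscale L (a s) (?Y ! s)) = 0" "i < r"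
    have "0 = lv.coordinate (\<Sum>s<r. lscale L (a s) (?Y ! s)) (b ! i)"
      by (simp only: *(1) lv.coordinate_zero)
    also have "\<dots> = (\<Sum>s<r. a s * (if i = s then 1 else 0))"
      unfolding lv.coordinate_sum lv.coordinate_scale by (rule sum.cong) (use delta *(2) in auto)
    also have "\<dots> = a i" using *(2) by (simp add: if_distrib[of "(*) _"] cong: if_cong)
    finally show "a i = 0" by simp
  qed
qed

end

section \<open>The torsor of elementary frames\<close>

locale restricted_geometry = lie_geometry L r
  for L :: "('k::field, 'g::ab_group_add) lie" and r :: nat +
  assumes restricted: "restricted_lie_algebra L" and char_pos: "CHAR('k) > 0"
begin

lemma bracket_add: "lbracket L (x + y) z = lbracket L x z + lbracket L y z"
    "lbracket L z (x + y) = lbracket L z x + lbracket L z y"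
  using restricted by (simp_all add: restricted_lie_algebra_def)

lemma bracket_scale: "lbracket L (lscale L a x) y = lscale L a (lbracket L x y)"
    "lbracket L x (lscale L a y) = lscale L a (lbracket L x y)"
  using restricted by (simp_all add: restricted_lie_algebra_def)

lemma bracket_self: "lbracket L x x = 0"
  using restricted by (simp add: restricted_lie_algebra_def)

lemma pow_scale: "lpow L (lscale L a x) = lscale L (a ^ CHAR('k)) (lpow L x)"
  using restricted by (simp add: restricted_lie_algebra_def)

lemma bracket_zero: "lbracket L 0 x = 0" "lbracket L x 0 = 0"
  using bracket_scale(1)[of 0 0 x] bracket_scale(2)[of x 0 0] by simp_all

lemma pow_zero: "lpow L 0 = 0"
  using pow_scale[of 0 0] char_pos by (simp add: zero_power)

text \<open>Jacobson's correction terms are iterated brackets of \<open>x\<close> and \<open>y\<close>, hence vanish.\<close>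

lemma pow_add_commuting:
  assumes "lbracket L y x = 0"
  shows "lpow L (x + y) = lpow L x + lpow L y"
proof -
  have "jacobson_coeff L x y (Suc m) i = 0" for m i
    by (induction m arbitrary: i) (simp_all add: assms bracket_self bracket_zero)
  then have coeff: "jacobson_coeff L x y m i = 0" if "m > 0" for m i
    using that gr0_implies_Suc by metis
  have "lpow L (x + y) = lpow L x + lpow L y +
    (\<Sum>i = 1..<CHAR('k). lscale L (1 / of_nat i) (jacobson_coeff L x y (CHAR('k) - 1) (i - 1)))"
    using restricted by (simp add: restricted_lie_algebra_def)
  also have "(\<Sum>i = 1..<CHAR('k). lscale L (1 / of_nat i) (jacobson_coeff L x y (CHAR('k) - 1) (i - 1))) = 0"
    by (rule sum.neutral) (auto simp: coeff)
  finally show ?thesis by simp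
qed

lemma elementary_span:
  assumes "\<And>x y. x \<in> S \<Longrightarrow> y \<in> S \<Longrightarrow> lbracket L x y = 0" "\<And>x. x \<in> S \<Longrightarrow> lpow L x = 0"
  shows "elementary_subalgebra L (lv.span S)"
proof -
  have sub1: "lv.subspace {x. \<forall>y\<in>T. lbracket L x y = 0}" for T
    by (rule lv.subspaceI) (auto simp: bracket_zero bracket_add bracket_scale)
  have sub2: "lv.subspace {y. \<forall>x\<in>T. lbracket L x y = 0}" for T
    by (rule lv.subspaceI) (auto simp: bracket_zero bracket_add bracket_scale)
  have "lv.span S \<subseteq> {x. \<forall>y\<in>S. lbracket L x y = 0}"
    by (rule lv.span_minimal[OF _ sub1]) (use assms(1) in auto)
  then have "S \<subseteq> {y. \<forall>x\<in>lv.span S. lbracket L x y = 0}" by auto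
  then have comm: "lv.span S \<subseteq> {y. \<forall>x\<in>lv.span S. lbracket L x y = 0}"
    by (rule lv.span_minimal[OF _ sub2])
  have "lv.span S \<subseteq> {x \<in> lv.span S. lpow L x = 0}"
  proof (rule lv.span_minimal)
    show "S \<subseteq> {x \<in> lv.span S. lpow L x = 0}" using assms(2) lv.span_base by auto
    show "lv.subspace {x \<in> lv.span S. lpow L x = 0}"
    proof (rule lv.subspaceI)
      show "0 \<in> {x \<in> lv.span S. lpow L x = 0}" by (simp add: lv.span_zero pow_zero)
      show "x + y \<in> {x \<in> lv.span S. lpow L x = 0}"
        if "x \<in> {x \<in> lv.span S. lpow L x = 0}" "y \<in> {x \<in> lv.span S. lpow L x = 0}" for x y
        using that comm pow_add_commuting[of y x] by (auto intro: lv.span_add)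
      show "lscale L c x \<in> {x \<in> lv.span S. lpow L x = 0}"
        if "x \<in> {x \<in> lv.span S. lpow L x = 0}" for c x
        using that by (auto simp: pow_scale intro: lv.span_scale)
    qed
  qed
  with comm show ?thesis unfolding elementary_subalgebra_def by auto
qed

text \<open>Commuting elements with vanishing \<open>p\<close>-th power span an elementary subalgebra, so the elementary frames
  are all frames of elementary subalgebras.\<close>

lemma elementary_frames_iff:
  "X \<in> elementary_frames L r \<longleftrightarrow> X \<in> frames L r \<and> frame_span L X \<in> elementary_subalgebras L r"
proof
  assume "X \<in> elementary_frames L r"
  then show "X \<in> frames L r \<and> frame_span L X \<in> elementary_subalgebras L r"
    using elementary_span[of "set X"] dim_frame_span[of X]
    by (auto simp: elementary_frames_def elementary_subalgebras_def frame_span_def)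
next
  assume X: "X \<in> frames L r \<and> frame_span L X \<in> elementary_subalgebras L r"
  have "set X \<subseteq> frame_span L X" unfolding frame_span_def by (rule lv.span_superset)
  with X show "X \<in> elementary_frames L r"
    by (auto simp: elementary_frames_def elementary_subalgebras_def elementary_subalgebra_def)
qed

lemma elementary_subalgebra_has_frame:
  assumes "\<epsilon> \<in> elementary_subalgebras L r"
  shows "\<exists>X\<in>elementary_frames L r. frame_span L X = \<epsilon>"
proof -
  have sub: "lv.subspace \<epsilon>" and dim: "lv.dim \<epsilon> = r"
    using assms by (auto simp: elementary_subalgebras_def elementary_subalgebra_def)
  from lv.basis_subspace_exists[OF sub] obtain B where
    B: "finite B" "lv.independent B" "lv.span B = \<epsilon>" "card B = r" using dim by metis
  obtain X where X: "set X = B" "distinct X" using finite_distinct_list[OF B(1)] by blast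
  then have "X \<in> frames L r" "frame_span L X = \<epsilon>"
    using B distinct_card by (force simp: frames_def, simp add: frame_span_def)
  then show ?thesis using elementary_frames_iff assms by blast
qed

sublocale ef: fraction_space "elementary_variety L r" "frames L r" "frame_span L"
    "homogeneous_pairs (pluecker_funs L r)"
  unfolding elementary_variety_def by (rule fraction_space_grassmannian_subvariety)

sublocale ff: fraction_space "frame_variety L r" UNIV id
    "polynomials (coord_funs L r) \<times> polynomials (coord_funs L r)"
  unfolding frame_variety_def by (rule fraction_space_tuple_variety)

sublocale es: function_sheaf "elementary_variety L r"
  by (rule ef.function_sheaf)

sublocale fs: function_sheaf "frame_variety L r"
  by (rule ff.function_sheaf)

lemma topspace_elementary_variety: "topspace (zariski (elementary_variety L r)) = elementary_subalgebras L r"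
  using elementary_subalgebra_has_frame elementary_frames_iff
  unfolding elementary_variety_def topspace_grassmannian_subvariety by blast

lemma topspace_frame_variety: "topspace (zariski (frame_variety L r)) = elementary_frames L r"
  unfolding frame_variety_def by (rule topspace_tuple_variety)

lemma polynomial_regular_on:
  assumes "fs.is_open U" "P \<in> polynomials (coord_funs L r)" shows "fs.regular_on U P"
proof -
  have "ff.fraction_at U (restr U P) P (\<lambda>_. 1)"
    unfolding ff.fraction_at_def using assms polynomials.const[of 1] by (simp add: restr_def)
  then show ?thesis unfolding fs.regular_on_def ff.regular_fraction_at by (auto simp: restr_def)
qed

text \<open>By the Leibniz formula for the determinant.\<close>

lemma pluecker_polynomial: "pluecker_funs L r \<subseteq> polynomials (coord_funs L r)"
proof -
  have sum: "(\<lambda>X. \<Sum>i\<in>I. f i X) \<in> polynomials (coord_funs L r)"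
    if "\<And>i. i \<in> I \<Longrightarrow> f i \<in> polynomials (coord_funs L r)" for f :: "'i \<Rightarrow> 'g list \<Rightarrow> 'k" and I
    using that
  proof (induction I rule: infinite_finite_induct)
    case (insert i I)
    then show ?case by (simp add: polynomials.add)
  qed (simp_all add: polynomials.const)
  have prod: "(\<lambda>X. \<Prod>i\<in>I. f i X) \<in> polynomials (coord_funs L r)"
    if "\<And>i. i \<in> I \<Longrightarrow> f i \<in> polynomials (coord_funs L r)" for f :: "'i \<Rightarrow> 'g list \<Rightarrow> 'k" and I
    using that
  proof (induction I rule: infinite_finite_induct)
    case (insert i I)
    then show ?case by (simp add: polynomials.mult)
  qed (simp_all add: polynomials.const)
  show ?thesis
  proof
    fix f assume "f \<in> pluecker_funs L r"
    then obtain b where b: "b \<in> lists (lbasis L)" "length b = r" "f = pluecker L r b"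
      unfolding pluecker_funs_def by blast
    have coord: "coord_fun L (b ! i) s \<in> polynomials (coord_funs L r)" if "i < r" "s < r" for i s
    proof (rule polynomials.coord)
      have "b ! i \<in> lbasis L" using that b by (simp add: in_lists_conv_set)
      then show "coord_fun L (b ! i) s \<in> coord_funs L r" using that(2) unfolding coord_funs_def by blast
    qed
    have perm: "p s < r" if "p permutes {0..<r}" "s < r" for p s
      using permutes_in_image[OF that(1), of s] that(2) by simp
    have f: "f = (\<lambda>X. \<Sum>p | p permutes {0..<r}. of_int (sign p) *
        (\<Prod>s = 0..<r. coord_fun L (b ! p s) s X))"
    proof
      fix X
      have "f X = (\<Sum>p | p permutes {0..<r}. of_int (sign p) *
          (\<Prod>s = 0..<r. Matrix.mat r r (\<lambda>(s, i). coord_fun L (b ! i) s X) $$ (s, p s)))"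
        by (simp add: b(3) pluecker_def Determinant.det_def)
      also have "\<dots> = (\<Sum>p | p permutes {0..<r}. of_int (sign p) *
          (\<Prod>s = 0..<r. coord_fun L (b ! p s) s X))"
        by (intro sum.cong refl arg_cong2[where f = "(*)"] prod.cong) (simp add: perm)
      finally show "f X = (\<Sum>p | p permutes {0..<r}. of_int (sign p) *
          (\<Prod>s = 0..<r. coord_fun L (b ! p s) s X))" .
    qed
    show "f \<in> polynomials (coord_funs L r)"
      unfolding f by (intro sum polynomials.mult polynomials.const prod coord) (auto simp: perm)
  qed
qed

definition frame_preimage :: "'g set set \<Rightarrow> 'g list set" where
  "frame_preimage V = {X \<in> elementary_frames L r. frame_span L X \<in> V}"

text \<open>The map from frames to subalgebras is continuous, since Pluecker coordinates are polynomials in the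
  coordinates of the frame.\<close>

lemma open_frame_preimage:
  assumes "es.is_open V" shows "fs.is_open (frame_preimage V)"
  unfolding frame_preimage_def
proof (rule openin_preimage_generated)
  show "openin (topology_generated_by
        {{\<epsilon> \<in> elementary_subalgebras L r. \<exists>X\<in>frames L r. frame_span L X = \<epsilon> \<and> P X \<noteq> 0}
           | P d. homogeneous (pluecker_funs L r) d P}) V"
    using assms unfolding elementary_variety_def grassmannian_subvariety_def Let_def by simp
next
  fix G
  assume "G \<in> {{\<epsilon> \<in> elementary_subalgebras L r. \<exists>X\<in>frames L r. frame_span L X = \<epsilon> \<and> P X \<noteq> 0}
           | P d. homogeneous (pluecker_funs L r) d P}"
  then obtain P d where P: "homogeneous (pluecker_funs L r) d P"
    and G: "G = {\<epsilon> \<in> elementary_subalgebras L r. \<exists>X\<in>frames L r. frame_span L X = \<epsilon> \<and> P X \<noteq> 0}"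
    by (elim CollectE exE conjE)
  have "{X \<in> elementary_frames L r. frame_span L X \<in> G} = {X \<in> elementary_frames L r. P X \<noteq> 0}"
  proof (intro Collect_cong conj_cong refl)
    fix X assume X: "X \<in> elementary_frames L r"
    have "P X \<noteq> 0" if "Y \<in> frames L r" "frame_span L Y = frame_span L X" "P Y \<noteq> 0" for Y
      using homogeneous_change_of_frame[of X Y] X that P elementary_frames_iff by fastforce
    then show "frame_span L X \<in> G \<longleftrightarrow> P X \<noteq> 0"
      using X elementary_frames_iff unfolding G by blast
  qed
  moreover have "fs.is_open {X \<in> elementary_frames L r. P X \<noteq> 0}"
    unfolding frame_variety_def
    by (rule tuple_basic_open[OF homogeneous_subset_polynomials[OF P pluecker_polynomial]])
  ultimately show "fs.is_open {X \<in> elementary_frames L r. frame_span L X \<in> G}" by simp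
qed

lemma regular_on_frame_preimage:
  assumes V: "es.is_open V" and h: "es.regular_on V h"
  shows "fs.regular_on (frame_preimage V) (\<lambda>X. h (frame_span L X))"
proof (rule fs.regular_on_local)
  fix X assume X: "X \<in> frame_preimage V"
  then have "frame_span L X \<in> V" by (simp add: frame_preimage_def)
  with h[unfolded es.regular_on_def ef.regular_fraction_at] obtain W P Q
    where W: "frame_span L X \<in> W" "W \<subseteq> V" "ef.fraction_at W (restr V h) P Q" by blast
  have oW: "es.is_open W" and PQ: "(P, Q) \<in> homogeneous_pairs (pluecker_funs L r)"
    and val: "\<And>Y. Y \<in> frames L r \<Longrightarrow> frame_span L Y \<in> W \<Longrightarrow> Q Y \<noteq> 0 \<and> restr V h (frame_span L Y) = P Y / Q Y"
    using W(3) unfolding ef.fraction_at_def by auto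
  have o: "fs.is_open (frame_preimage W)" using open_frame_preimage[OF oW] .
  have PQ': "P \<in> polynomials (coord_funs L r)" "Q \<in> polynomials (coord_funs L r)"
    using PQ homogeneous_subset_polynomials[OF _ pluecker_polynomial] unfolding homogeneous_pairs_def by auto
  have nz: "Q Y \<noteq> 0" and eq: "h (frame_span L Y) = P Y / Q Y" if "Y \<in> frame_preimage W" for Y
  proof -
    have "Y \<in> frames L r" "frame_span L Y \<in> W" using that elementary_frames_iff by (auto simp: frame_preimage_def)
    from val[OF this] W(2) this(2) show "Q Y \<noteq> 0" "h (frame_span L Y) = P Y / Q Y"
      by (auto simp: restr_def)
  qed
  have "fs.regular_on (frame_preimage W) (\<lambda>Y. P Y / Q Y)"
    by (intro fs.regular_on_divide polynomial_regular_on o PQ' nz)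
  then have "fs.regular_on (frame_preimage W) (\<lambda>Y. h (frame_span L Y))"
    using fs.regular_on_cong[of "frame_preimage W" "\<lambda>Y. h (frame_span L Y)" "\<lambda>Y. P Y / Q Y"] eq by blast
  then show "\<exists>W. fs.is_open W \<and> X \<in> W \<and> W \<subseteq> frame_preimage V \<and> fs.regular_on W (\<lambda>Y. h (frame_span L Y))"
    using o X W(1,2) by (intro exI[of _ "frame_preimage W"]) (auto simp: frame_preimage_def)
qed

text \<open>A section of the torsor of frames over \<open>U\<close>; it is a morphism because its coordinates are regular.\<close>

definition local_section :: "'g set set \<Rightarrow> ('g set \<Rightarrow> 'g list) \<Rightarrow> bool" where
  "local_section U \<sigma> \<longleftrightarrow> es.is_open U \<and>
     (\<forall>\<epsilon>\<in>U. \<sigma> \<epsilon> \<in> elementary_frames L r \<and> frame_span L (\<sigma> \<epsilon>) = \<epsilon>) \<and>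
     (\<forall>c\<in>lbasis L. \<forall>s<r. es.regular_on U (\<lambda>\<epsilon>. coord_fun L c s (\<sigma> \<epsilon>)))"

text \<open>On the open set where the Pluecker coordinate \<open>b\<close> does not vanish, send a subalgebra to its reduced
  frame with respect to \<open>b\<close>.\<close>

lemma local_section_exists:
  assumes \<epsilon>0: "\<epsilon>0 \<in> elementary_subalgebras L r"
  shows "\<exists>U \<sigma>. \<epsilon>0 \<in> U \<and> local_section U \<sigma>"
proof -
  obtain X0 where X0: "X0 \<in> elementary_frames L r" "frame_span L X0 = \<epsilon>0"
    using elementary_subalgebra_has_frame[OF \<epsilon>0] by blast
  then have X0f: "X0 \<in> frames L r" using elementary_frames_iff by blast
  obtain b where b: "b \<in> lists (lbasis L)" "length b = r" "pluecker L r b X0 \<noteq> 0"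
    using pluecker_nonzero[OF X0f] by blast
  define U where "U = {\<epsilon> \<in> elementary_subalgebras L r.
    \<exists>X\<in>frames L r. frame_span L X = \<epsilon> \<and> pluecker L r b X \<noteq> 0}"
  have pl_hom: "homogeneous (pluecker_funs L r) 1 (pluecker L r b')"
    if "b' \<in> lists (lbasis L)" "length b' = r" for b'
    using that by (intro homogeneous.coord) (auto simp: pluecker_funs_def)
  have oU: "es.is_open U"
    unfolding U_def elementary_variety_def by (rule grassmannian_basic_open[OF pl_hom[OF b(1,2)]])
  define fr where "fr \<epsilon> = (SOME X. X \<in> frames L r \<and> frame_span L X = \<epsilon> \<and> pluecker L r b X \<noteq> 0)" for \<epsilon>
  have fr: "fr \<epsilon> \<in> frames L r \<and> frame_span L (fr \<epsilon>) = \<epsilon> \<and> pluecker L r b (fr \<epsilon>) \<noteq> 0"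
    if "\<epsilon> \<in> U" for \<epsilon>
  proof -
    from that have "\<exists>X. X \<in> frames L r \<and> frame_span L X = \<epsilon> \<and> pluecker L r b X \<noteq> 0"
      unfolding U_def by blast
    then show ?thesis unfolding fr_def by (rule someI_ex)
  qed
  define \<sigma> where "\<sigma> \<epsilon> = reduced_frame b (fr \<epsilon>)" for \<epsilon>
  have "\<sigma> \<epsilon> \<in> elementary_frames L r \<and> frame_span L (\<sigma> \<epsilon>) = \<epsilon>" if "\<epsilon> \<in> U" for \<epsilon>
    using reduced_frame[of "fr \<epsilon>" b] fr[OF that] b that elementary_frames_iff
    by (simp add: \<sigma>_def U_def)
  moreover have "es.regular_on U (\<lambda>\<epsilon>. coord_fun L c s (\<sigma> \<epsilon>))" if c: "c \<in> lbasis L" and s: "s < r" for c s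
  proof -
    let ?f = "\<lambda>\<epsilon>. coord_fun L c s (\<sigma> \<epsilon>)"
    let ?P = "pluecker L r (b[s := c])" and ?Q = "pluecker L r b"
    have upd: "b[s := c] \<in> lists (lbasis L)"
      using b(1) c set_update_subset_insert[of b s c] by (auto simp: in_lists_conv_set)
    then have homP: "homogeneous (pluecker_funs L r) 1 ?P" using pl_hom b(2) by simp
    have homQ: "homogeneous (pluecker_funs L r) 1 ?Q" using pl_hom b by blast
    have "ef.fraction_at U (restr U ?f) ?P ?Q"
      unfolding ef.fraction_at_def
    proof (intro conjI ballI impI)
      show "(?P, ?Q) \<in> homogeneous_pairs (pluecker_funs L r)"
        unfolding homogeneous_pairs_def using homP homQ by blast
    next
      fix X assume X: "X \<in> frames L r" "frame_span L X \<in> U"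
      note ch = fr[OF X(2)]
      obtain k where k: "k \<noteq> 0" "\<forall>d P. homogeneous (pluecker_funs L r) d P \<longrightarrow>
          P X = k ^ d * P (fr (frame_span L X))"
        using homogeneous_change_of_frame[of "fr (frame_span L X)" X] ch X by auto
      have kP: "?P X = k * ?P (fr (frame_span L X))" and kQ: "?Q X = k * ?Q (fr (frame_span L X))"
        using k(2) homP homQ by (metis power_one_right)+
      then show "?Q X \<noteq> 0" using k(1) ch by simp
      show "restr U ?f (frame_span L X) = ?P X / ?Q X"
        using X(2) coord_reduced_frame[OF c s] k(1) by (simp add: restr_def \<sigma>_def kP kQ)
    qed (rule oU)
    then show ?thesis
      unfolding es.regular_on_def ef.regular_fraction_at by (auto simp: restr_def)
  qed
  ultimately have "local_section U \<sigma>" unfolding local_section_def using oU by blast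
  moreover have "\<epsilon>0 \<in> U" using X0 X0f b(3) \<epsilon>0 unfolding U_def by blast
  ultimately show ?thesis by blast
qed

lemma regular_on_polynomial_section:
  assumes \<sigma>: "local_section U \<sigma>" and P: "P \<in> polynomials (coord_funs L r)"
  shows "es.regular_on U (\<lambda>\<epsilon>. P (\<sigma> \<epsilon>))"
  using P
proof induction
  case (const c)
  then show ?case using \<sigma> es.regular_on_const unfolding local_section_def by blast
next
  case (coord y)
  then show ?case using \<sigma> unfolding local_section_def coord_funs_def by blast
next
  case (add P Q)
  show ?case by (rule es.regular_on_add[OF add.IH])
next
  case (mult P Q)
  show ?case by (rule es.regular_on_mult[OF mult.IH])
qed

lemma open_section_preimage:
  assumes \<sigma>: "local_section U \<sigma>" and V: "fs.is_open V"
  shows "es.is_open {\<epsilon> \<in> U. \<sigma> \<epsilon> \<in> V}"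
proof (rule openin_preimage_generated)
  show "openin (topology_generated_by
      {{X \<in> elementary_frames L r. P X \<noteq> 0} | P. P \<in> polynomials (coord_funs L r)}) V"
    using V unfolding frame_variety_def tuple_variety_def Let_def by simp
next
  fix G assume "G \<in> {{X \<in> elementary_frames L r. P X \<noteq> 0} | P. P \<in> polynomials (coord_funs L r)}"
  then obtain P where P: "P \<in> polynomials (coord_funs L r)" "G = {X \<in> elementary_frames L r. P X \<noteq> 0}"
    by (elim CollectE exE conjE)
  have "{\<epsilon> \<in> U. \<sigma> \<epsilon> \<in> G} = {\<epsilon> \<in> U. P (\<sigma> \<epsilon>) \<noteq> 0}"
    using \<sigma> unfolding local_section_def P(2) by blast
  then show "es.is_open {\<epsilon> \<in> U. \<sigma> \<epsilon> \<in> G}"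
    using es.open_nonvanishing_on[OF _ regular_on_polynomial_section[OF \<sigma> P(1)]] \<sigma>
    unfolding local_section_def by simp
qed

lemma regular_on_section:
  assumes \<sigma>: "local_section U \<sigma>" and V: "fs.is_open V" and h: "fs.regular_on V h"
  shows "es.regular_on {\<epsilon> \<in> U. \<sigma> \<epsilon> \<in> V} (\<lambda>\<epsilon>. h (\<sigma> \<epsilon>))"
proof (rule es.regular_on_local)
  fix \<epsilon> assume \<epsilon>: "\<epsilon> \<in> {\<epsilon> \<in> U. \<sigma> \<epsilon> \<in> V}"
  with h[unfolded fs.regular_on_def ff.regular_fraction_at] obtain W P Q
    where W: "\<sigma> \<epsilon> \<in> W" "W \<subseteq> V" "ff.fraction_at W (restr V h) P Q" by blast
  have oW: "fs.is_open W" and PQ: "P \<in> polynomials (coord_funs L r)" "Q \<in> polynomials (coord_funs L r)"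
    and val: "\<And>Y. Y \<in> W \<Longrightarrow> Q Y \<noteq> 0 \<and> restr V h Y = P Y / Q Y"
    using W(3) unfolding ff.fraction_at_def by auto
  let ?W = "{\<epsilon> \<in> U. \<sigma> \<epsilon> \<in> W}"
  have o: "es.is_open ?W" by (rule open_section_preimage[OF \<sigma> oW])
  have reg: "es.regular_on ?W (\<lambda>\<epsilon>. P' (\<sigma> \<epsilon>))" if "P' \<in> polynomials (coord_funs L r)" for P'
    by (rule es.regular_on_subset[OF regular_on_polynomial_section[OF \<sigma> that] o]) auto
  have "es.regular_on ?W (\<lambda>\<epsilon>. P (\<sigma> \<epsilon>) / Q (\<sigma> \<epsilon>))"
    by (intro es.regular_on_divide reg PQ) (use val in auto)
  moreover have "h (\<sigma> \<epsilon>) = P (\<sigma> \<epsilon>) / Q (\<sigma> \<epsilon>)" if "\<epsilon> \<in> ?W" for \<epsilon>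
  proof -
    have "\<sigma> \<epsilon> \<in> W" "\<sigma> \<epsilon> \<in> V" using that W(2) by auto
    then show ?thesis using val[of "\<sigma> \<epsilon>"] by (simp add: restr_def)
  qed
  ultimately have "es.regular_on ?W (\<lambda>\<epsilon>. h (\<sigma> \<epsilon>))"
    using es.regular_on_cong[of ?W "\<lambda>\<epsilon>. h (\<sigma> \<epsilon>)" "\<lambda>\<epsilon>. P (\<sigma> \<epsilon>) / Q (\<sigma> \<epsilon>)"] by blast
  then show "\<exists>W. es.is_open W \<and> \<epsilon> \<in> W \<and> W \<subseteq> {\<epsilon> \<in> U. \<sigma> \<epsilon> \<in> V} \<and> es.regular_on W (\<lambda>\<epsilon>. h (\<sigma> \<epsilon>))"
    using o \<epsilon> W(1,2) by (intro exI[of _ ?W]) auto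
qed

end

section \<open>Descent\<close>

locale descent_setting = restricted_geometry L r + mv: finite_dimensional_vector_space sc B
  for L :: "('k::field, 'g::ab_group_add) lie" and r :: nat
    and sc :: "'k \<Rightarrow> 'm::ab_group_add \<Rightarrow> 'm" and B :: "'m set"
begin

sublocale et: tensor_sheaf "elementary_variety L r" sc B ..
sublocale ft: tensor_sheaf "frame_variety L r" sc B ..

abbreviation pull :: "('g set \<Rightarrow> 'm set) \<Rightarrow> 'g list \<Rightarrow> 'm set" where
  "pull N \<equiv> \<lambda>X. N (frame_span L X)"

lemma section_on_frame_preimage:
  "es.is_open V \<Longrightarrow> et.section_on V s \<Longrightarrow> ft.section_on (frame_preimage V) (\<lambda>X. s (frame_span L X))"
  unfolding et.section_on_def ft.section_on_def
proof
  fix b assume "es.is_open V" "\<forall>b\<in>B. es.regular_on V (\<lambda>x. mv.coordinate (s x) b)" "b \<in> B"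
  then show "fs.regular_on (frame_preimage V) (\<lambda>X. mv.coordinate (s (frame_span L X)) b)"
    using regular_on_frame_preimage[of V "\<lambda>x. mv.coordinate (s x) b"] by simp
qed

lemma section_on_local_section:
  "local_section U \<sigma> \<Longrightarrow> fs.is_open V \<Longrightarrow> ft.section_on V t \<Longrightarrow>
     et.section_on {\<epsilon> \<in> U. \<sigma> \<epsilon> \<in> V} (\<lambda>\<epsilon>. t (\<sigma> \<epsilon>))"
  unfolding et.section_on_def ft.section_on_def
proof
  fix b assume "local_section U \<sigma>" "fs.is_open V"
    "\<forall>b\<in>B. fs.regular_on V (\<lambda>x. mv.coordinate (t x) b)" "b \<in> B"
  then show "es.regular_on {\<epsilon> \<in> U. \<sigma> \<epsilon> \<in> V} (\<lambda>\<epsilon>. mv.coordinate (t (\<sigma> \<epsilon>)) b)"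
    using regular_on_section[of U \<sigma> V "\<lambda>x. mv.coordinate (t x) b"] by simp
qed

lemma frame_on_frame_preimage:
  assumes fr: "et.frame_on N U n e"
  shows "ft.frame_on (pull N) (frame_preimage U) n (\<lambda>i X. e i (frame_span L X))"
  unfolding ft.frame_on_def
proof (intro conjI allI impI ballI)
  have U: "es.is_open U" using fr unfolding et.frame_on_def by blast
  show "fs.is_open (frame_preimage U)" by (rule open_frame_preimage[OF U])
  show "ft.section_on (frame_preimage U) (\<lambda>X. e i (frame_span L X))" if "i < n" for i
    using fr that section_on_frame_preimage[OF U] unfolding et.frame_on_def by blast
next
  fix X assume "X \<in> frame_preimage U"
  then have "frame_span L X \<in> U" by (simp add: frame_preimage_def)
  with fr show "mv.indep_family n (\<lambda>i. e i (frame_span L X))"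
    "N (frame_span L X) = mv.span ((\<lambda>i. e i (frame_span L X)) ` {..<n})"
    unfolding et.frame_on_def by blast+
qed

lemma frame_preimage_onto: "es.is_open U \<Longrightarrow> \<epsilon> \<in> U \<Longrightarrow> \<exists>X\<in>frame_preimage U. frame_span L X = \<epsilon>"
  using elementary_subalgebra_has_frame openin_subset topspace_elementary_variety
  unfolding frame_preimage_def by blast

text \<open>The pull-back of a frame of \<open>N\<close> is a frame of the pulled back family, so by \<open>frame_coefficients\<close>
  every section with values there is locally a combination of pulled back sections.\<close>

lemma pullback_subspace_sheaf:
  assumes lf: "et.locally_framed N"
  shows "pullback sc B (frame_variety L r) (elementary_variety L r) (frame_span L) (et.subspace_sheaf N) =
    ft.subspace_sheaf (pull N)"
proof (rule ext)
  fix V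
  show "pullback sc B (frame_variety L r) (elementary_variety L r) (frame_span L) (et.subspace_sheaf N) V =
    ft.subspace_sheaf (pull N) V"
  proof (cases "fs.is_open V")
    case False
    then show ?thesis by (simp add: pullback_def ft.subspace_sheaf_def)
  next
    case V: True
    define loc where "loc t y W U n h s \<longleftrightarrow> fs.is_open W \<and> y \<in> W \<and> W \<subseteq> V \<and>
        es.is_open U \<and> frame_span L ` W \<subseteq> U \<and>
        (\<forall>i<n. h i \<in> regular (frame_variety L r) W \<and> s i \<in> et.subspace_sheaf N U) \<and>
        restr W t = lincomb sc n h (\<lambda>i. s i \<circ> frame_span L)" for t y W U n h s
    have "(\<forall>y\<in>V. \<exists>W U n h s. loc t y W U n h s) \<longleftrightarrow> (\<forall>y\<in>V. t y \<in> N (frame_span L y))"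
      if t: "t \<in> tensor_sections sc B (frame_variety L r) V" for t
    proof
      assume locs: "\<forall>y\<in>V. \<exists>W U n h s. loc t y W U n h s"
      show "\<forall>y\<in>V. t y \<in> N (frame_span L y)"
      proof
        fix y assume "y \<in> V"
        with locs obtain W U n h s where "loc t y W U n h s" by blast
        then have W: "y \<in> W" "es.is_open U" "frame_span L y \<in> U" "\<forall>i<n. s i \<in> et.subspace_sheaf N U"
          and eq: "restr W t = lincomb sc n h (\<lambda>i. s i \<circ> frame_span L)"
          unfolding loc_def by auto
        have "mv.subspace (N (frame_span L y))"
          using et.locally_framed_subspace[OF lf] W(2,3) openin_subset by blast
        moreover have "s i (frame_span L y) \<in> N (frame_span L y)" if "i < n" for i
          using W that by (simp add: et.subspace_sheaf_iff)
        ultimately have "lincomb sc n h (\<lambda>i. s i \<circ> frame_span L) y \<in> N (frame_span L y)"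
          unfolding lincomb_def by (auto intro!: mv.subspace_sum mv.subspace_scale)
        then show "t y \<in> N (frame_span L y)" using W(1) fun_cong[OF eq, of y] by (simp add: restr_def)
      qed
    next
      assume val: "\<forall>y\<in>V. t y \<in> N (frame_span L y)"
      show "\<forall>y\<in>V. \<exists>W U n h s. loc t y W U n h s"
      proof
        fix y assume y: "y \<in> V"
        then have "y \<in> elementary_frames L r" using V openin_subset topspace_frame_variety by blast
        then have "frame_span L y \<in> topspace (zariski (elementary_variety L r))"
          using elementary_frames_iff topspace_elementary_variety by blast
        with lf obtain U n e where U: "frame_span L y \<in> U" and fr: "et.frame_on N U n e"
          unfolding et.locally_framed_def by blast
        have oU: "es.is_open U" using fr unfolding et.frame_on_def by blast
        define W where "W = V \<inter> frame_preimage U"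
        have W: "fs.is_open W" "W \<subseteq> V" "W \<subseteq> frame_preimage U" "y \<in> W"
          using V open_frame_preimage[OF oU] y U \<open>y \<in> elementary_frames L r\<close>
          by (auto simp: W_def frame_preimage_def)
        have "ft.section_on W t" using t W(1,2) ft.section_on_subset ft.tensor_sections_iff by blast
        from ft.frame_coefficients[OF frame_on_frame_preimage[OF fr] W(1,3) this] val W(2)
        obtain h where h: "\<forall>i<n. h i \<in> regular (frame_variety L r) W"
          "\<forall>X\<in>W. t X = (\<Sum>i<n. sc (h i X) (e i (frame_span L X)))" by blast
        have "restr W t X = lincomb sc n h (\<lambda>i. restr U (e i) \<circ> frame_span L) X" for X
        proof (cases "X \<in> W")
          case True
          then have "frame_span L X \<in> U" using W(3) by (auto simp: frame_preimage_def)
          then show ?thesis using True h(2) by (simp add: lincomb_def restr_def)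
        next
          case False
          then show ?thesis using h(1) by (simp add: lincomb_def restr_def fs.regular_iff)
        qed
        then have "restr W t = lincomb sc n h (\<lambda>i. restr U (e i) \<circ> frame_span L)" by blast
        moreover have "\<forall>i<n. restr U (e i) \<in> et.subspace_sheaf N U" using et.frame_in_sheaf[OF fr] by blast
        moreover have "frame_span L ` W \<subseteq> U" using W(3) by (auto simp: frame_preimage_def)
        ultimately have "loc t y W U n h (\<lambda>i. restr U (e i))"
          using W oU h(1) unfolding loc_def by simp
        then show "\<exists>W U n h s. loc t y W U n h s" by blast
      qed
    qed
    then show ?thesis
      using V unfolding pullback_def ft.subspace_sheaf_def loc_def[symmetric] by (simp cong: conj_cong)
  qed
qed

text \<open>Near a given point write \<open>s \<circ> q\<close> as a combination of pulled back sections \<open>t\<^sub>i \<circ> q\<close> with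
  coefficients \<open>h\<^sub>i\<close>, and compose with a local section \<open>\<sigma>\<close> of \<open>q\<close>: as \<open>q \<circ> \<sigma>\<close> is the identity,
  \<open>s\<close> is the combination of the \<open>t\<^sub>i\<close> with coefficients \<open>h\<^sub>i \<circ> \<sigma>\<close>.\<close>

lemma pulled_back_section_descends:
  assumes F: "submodule_sheaf sc B (elementary_variety L r) F" and U: "es.is_open U"
    and s: "s \<in> tensor_sections sc B (elementary_variety L r) U"
    and pb: "restr (frame_preimage U) (\<lambda>X. s (frame_span L X)) \<in>
      pullback sc B (frame_variety L r) (elementary_variety L r) (frame_span L) F (frame_preimage U)"
  shows "s \<in> F U"
proof -
  note F' = conjunct2[OF F[unfolded submodule_sheaf_def], THEN spec, THEN mp]
  have F_zero: "(\<lambda>x. 0) \<in> F V" if "es.is_open V" for V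
    using F'[OF that] by (elim conjE)
  have F_add: "(\<lambda>x. s x + t x) \<in> F V" if "es.is_open V" "s \<in> F V" "t \<in> F V" for V s t
  proof -
    have "\<forall>s\<in>F V. \<forall>t\<in>F V. (\<lambda>x. s x + t x) \<in> F V" using F'[OF that(1)] by (elim conjE)
    then show ?thesis using that(2,3) by simp
  qed
  have F_scale: "(\<lambda>x. sc (f x) (s x)) \<in> F V"
    if "es.is_open V" "f \<in> regular (elementary_variety L r) V" "s \<in> F V" for V f s
  proof -
    have "\<forall>f\<in>regular (elementary_variety L r) V. \<forall>s\<in>F V. (\<lambda>x. sc (f x) (s x)) \<in> F V"
      using F'[OF that(1)] by (elim conjE)
    then show ?thesis using that(2,3) by simp
  qed
  have F_restr: "restr W s \<in> F W" if "es.is_open V" "es.is_open W" "W \<subseteq> V" "s \<in> F V" for V W s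
  proof -
    have "\<forall>W s. es.is_open W \<and> W \<subseteq> V \<and> s \<in> F V \<longrightarrow> restr W s \<in> F W"
      using F'[OF that(1)] by (elim conjE)
    then show ?thesis using that(2-4) by simp
  qed
  have F_glue: "\<forall>s\<in>tensor_sections sc B (elementary_variety L r) U.
      (\<forall>x\<in>U. \<exists>V. es.is_open V \<and> x \<in> V \<and> V \<subseteq> U \<and> restr V s \<in> F V) \<longrightarrow> s \<in> F U"
    using F'[OF U] by (elim conjE)
  have "\<exists>V. es.is_open V \<and> \<epsilon> \<in> V \<and> V \<subseteq> U \<and> restr V s \<in> F V" if \<epsilon>: "\<epsilon> \<in> U" for \<epsilon>
  proof -
    let ?U' = "frame_preimage U"
    have "\<epsilon> \<in> elementary_subalgebras L r" using U \<epsilon> openin_subset topspace_elementary_variety by blast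
    from local_section_exists[OF this] obtain U0 \<sigma> where U0: "\<epsilon> \<in> U0" and \<sigma>: "local_section U0 \<sigma>" by blast
    have sec: "\<sigma> \<delta> \<in> elementary_frames L r" "frame_span L (\<sigma> \<delta>) = \<delta>" if "\<delta> \<in> U0" for \<delta>
      using \<sigma> that unfolding local_section_def by blast+
    have "\<sigma> \<epsilon> \<in> ?U'" using sec[OF U0] \<epsilon> by (simp add: frame_preimage_def)
    moreover have "\<forall>X\<in>?U'. \<exists>W V n h t. fs.is_open W \<and> X \<in> W \<and> W \<subseteq> ?U' \<and> es.is_open V \<and>
        frame_span L ` W \<subseteq> V \<and> (\<forall>i<n. h i \<in> regular (frame_variety L r) W \<and> t i \<in> F V) \<and>
        restr W (restr ?U' (\<lambda>X. s (frame_span L X))) = lincomb sc n h (\<lambda>i. t i \<circ> frame_span L)"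
      using pb open_frame_preimage[OF U] by (simp add: pullback_def)
    ultimately have "\<exists>W V n h t. fs.is_open W \<and> \<sigma> \<epsilon> \<in> W \<and> W \<subseteq> ?U' \<and> es.is_open V \<and>
        frame_span L ` W \<subseteq> V \<and> (\<forall>i<n. h i \<in> regular (frame_variety L r) W \<and> t i \<in> F V) \<and>
        restr W (restr ?U' (\<lambda>X. s (frame_span L X))) = lincomb sc n h (\<lambda>i. t i \<circ> frame_span L)"
      by (rule bspec[rotated])
    then obtain W V n h t where
      W: "fs.is_open W" "\<sigma> \<epsilon> \<in> W" "W \<subseteq> ?U'" and V: "es.is_open V" "frame_span L ` W \<subseteq> V"
      and ht: "\<forall>i<n. h i \<in> regular (frame_variety L r) W \<and> t i \<in> F V"
      and eq: "restr W (restr ?U' (\<lambda>X. s (frame_span L X))) = lincomb sc n h (\<lambda>i. t i \<circ> frame_span L)"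
      by (elim exE conjE) (rule that)
    define Z where "Z = {\<delta> \<in> U0. \<sigma> \<delta> \<in> W}"
    have Z: "es.is_open Z" "\<epsilon> \<in> Z" "Z \<subseteq> U0"
      using open_section_preimage[OF \<sigma> W(1)] U0 W(2) by (auto simp: Z_def)
    have ZU: "\<delta> \<in> U" "\<delta> \<in> V" if "\<delta> \<in> Z" for \<delta>
    proof -
      have "\<sigma> \<delta> \<in> W" "\<delta> \<in> U0" using that by (auto simp: Z_def)
      then show "\<delta> \<in> U" "\<delta> \<in> V" using sec[of \<delta>] W(3) V(2) unfolding frame_preimage_def by force+
    qed
    define g where "g i = restr Z (\<lambda>\<delta>. h i (\<sigma> \<delta>))" for i
    have g: "g i \<in> regular (elementary_variety L r) Z" if "i < n" for i
      using regular_on_section[OF \<sigma> W(1), of "h i"] ht that fs.regular_iff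
      unfolding g_def Z_def es.regular_on_def by blast
    have comb: "(\<lambda>\<delta>. \<Sum>i<k. sc (g i \<delta>) (restr Z (t i) \<delta>)) \<in> F Z" if "k \<le> n" for k
      using that
    proof (induction k)
      case 0
      then show ?case using F_zero[OF Z(1)] by simp
    next
      case (Suc k)
      have "Z \<subseteq> V" "t k \<in> F V" using ZU(2) ht Suc.prems by auto
      then have "restr Z (t k) \<in> F Z" by (rule F_restr[OF V(1) Z(1)])
      then have "(\<lambda>\<delta>. sc (g k \<delta>) (restr Z (t k) \<delta>)) \<in> F Z"
        using F_scale[OF Z(1) g] Suc.prems by simp
      moreover have "(\<lambda>\<delta>. \<Sum>i<k. sc (g i \<delta>) (restr Z (t i) \<delta>)) \<in> F Z" using Suc by simp
      ultimately show ?case using F_add[OF Z(1)] by simp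
    qed
    have "restr Z s = (\<lambda>\<delta>. \<Sum>i<n. sc (g i \<delta>) (restr Z (t i) \<delta>))"
    proof
      fix \<delta>
      show "restr Z s \<delta> = (\<Sum>i<n. sc (g i \<delta>) (restr Z (t i) \<delta>))"
      proof (cases "\<delta> \<in> Z")
        case True
        then have "\<sigma> \<delta> \<in> W" "\<sigma> \<delta> \<in> ?U'" "frame_span L (\<sigma> \<delta>) = \<delta>" using W(3) sec by (auto simp: Z_def)
        with fun_cong[OF eq, of "\<sigma> \<delta>"] True show ?thesis by (simp add: restr_def lincomb_def g_def)
      qed (simp add: restr_def)
    qed
    then have "restr Z s \<in> F Z" using comb[of n] by simp
    then show ?thesis using Z ZU by blast
  qed
  then show ?thesis using F_glue s by blast
qed

text \<open>A section \<open>s\<close> lies in a subsheaf as soon as its pull-back lies in the pull-back of the subsheaf, so the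
  subsheaf is determined by its pull-back.\<close>

theorem descent_subspace_sheaf:
  assumes lf: "et.locally_framed N"
  shows "(THE F. coherent_subsheaf sc B (elementary_variety L r) F \<and>
      pullback sc B (frame_variety L r) (elementary_variety L r) (frame_span L) F =
        ft.subspace_sheaf (pull N)) = et.subspace_sheaf N"
proof (rule the_equality)
  show "coherent_subsheaf sc B (elementary_variety L r) (et.subspace_sheaf N) \<and>
      pullback sc B (frame_variety L r) (elementary_variety L r) (frame_span L) (et.subspace_sheaf N) =
        ft.subspace_sheaf (pull N)"
    using et.coherent_subspace_sheaf[OF lf] pullback_subspace_sheaf[OF lf] by blast
next
  fix F
  assume F: "coherent_subsheaf sc B (elementary_variety L r) F \<and>
      pullback sc B (frame_variety L r) (elementary_variety L r) (frame_span L) F =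
        ft.subspace_sheaf (pull N)"
  then have sub: "submodule_sheaf sc B (elementary_variety L r) F" unfolding coherent_subsheaf_def by blast
  show "F = et.subspace_sheaf N"
  proof (rule ext)
    fix U
    show "F U = et.subspace_sheaf N U"
    proof (cases "es.is_open U")
      case False
      then show ?thesis using sub by (simp add: submodule_sheaf_def et.subspace_sheaf_def)
    next
      case U: True
      let ?U' = "frame_preimage U"
      let ?pb = "\<lambda>s. restr ?U' (\<lambda>X. s (frame_span L X))"
      have U': "fs.is_open ?U'" by (rule open_frame_preimage[OF U])
      have tens: "F U \<subseteq> tensor_sections sc B (elementary_variety L r) U"
        using conjunct2[OF sub[unfolded submodule_sheaf_def], THEN spec, THEN mp, OF U] by (elim conjE)
      have pb_tensor: "?pb s \<in> tensor_sections sc B (frame_variety L r) ?U'"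
        if "s \<in> tensor_sections sc B (elementary_variety L r) U" for s
        using that section_on_frame_preimage[OF U] et.tensor_sections_iff
        by (intro ft.restr_in_tensor_sections) blast
      have sheaf_iff: "?pb s \<in> ft.subspace_sheaf (pull N) ?U' \<longleftrightarrow> (\<forall>\<epsilon>\<in>U. s \<epsilon> \<in> N \<epsilon>)"
        if "s \<in> tensor_sections sc B (elementary_variety L r) U" for s
      proof -
        have "?pb s \<in> ft.subspace_sheaf (pull N) ?U' \<longleftrightarrow> (\<forall>X\<in>?U'. s (frame_span L X) \<in> N (frame_span L X))"
          using pb_tensor[OF that] U' by (simp add: ft.subspace_sheaf_def restr_def)
        also have "\<dots> \<longleftrightarrow> (\<forall>\<epsilon>\<in>U. s \<epsilon> \<in> N \<epsilon>)"
          using frame_preimage_onto[OF U] by (auto simp: frame_preimage_def)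
        finally show ?thesis .
      qed
      show ?thesis
      proof
        show "F U \<subseteq> et.subspace_sheaf N U"
        proof
          fix s assume s: "s \<in> F U"
          have "restr ?U' (?pb s) = lincomb sc 1 (\<lambda>_. restr ?U' (\<lambda>_. 1)) (\<lambda>_. s \<circ> frame_span L)"
            by (auto simp: lincomb_def restr_def fun_eq_iff)
          moreover have "frame_span L ` ?U' \<subseteq> U" by (auto simp: frame_preimage_def)
          moreover have "restr ?U' (\<lambda>_. 1) \<in> regular (frame_variety L r) ?U'" by (rule fs.regular_const[OF U'])
          ultimately have "?pb s \<in> pullback sc B (frame_variety L r) (elementary_variety L r) (frame_span L) F ?U'"
            using pb_tensor s tens U U' unfolding pullback_def
            by (auto intro!: exI[of _ ?U'] exI[of _ U] exI[of _ "1::nat"] exI[of _ "\<lambda>_. restr ?U' (\<lambda>_. 1)"] exI[of _ "\<lambda>_. s"])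
          then have "\<forall>\<epsilon>\<in>U. s \<epsilon> \<in> N \<epsilon>" using F sheaf_iff s tens by auto
          then show "s \<in> et.subspace_sheaf N U" using s tens U by (auto simp: et.subspace_sheaf_def)
        qed
        show "et.subspace_sheaf N U \<subseteq> F U"
        proof
          fix s assume "s \<in> et.subspace_sheaf N U"
          then have s: "s \<in> tensor_sections sc B (elementary_variety L r) U" "\<forall>\<epsilon>\<in>U. s \<epsilon> \<in> N \<epsilon>"
            using U by (auto simp: et.subspace_sheaf_def)
          then have "?pb s \<in> pullback sc B (frame_variety L r) (elementary_variety L r) (frame_span L) F ?U'"
            using F sheaf_iff by simp
          then show "s \<in> F U" by (rule pulled_back_section_descends[OF sub U s(1)])
        qed
      qed
    qed
  qed
qed

end

section \<open>The free algebra\<close>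

definition scaled_word :: "'k \<Rightarrow> 'g list \<Rightarrow> 'g list \<Rightarrow> 'k::field" where
  "scaled_word c v = (\<lambda>w. if w = v then c else 0)"

lemma monomial_word_eq: "monomial_word v = scaled_word 1 v"
  by (simp add: monomial_word_def scaled_word_def)

lemma free_algebra_carrier:
  "f \<in> carrier (free_algebra S) \<longleftrightarrow> finite {w. f w \<noteq> 0} \<and> (\<forall>w. f w \<noteq> 0 \<longrightarrow> w \<in> lists S)"
  by (auto simp: free_algebra_def)

lemma free_algebra_simps:
  "f \<otimes>\<^bsub>free_algebra S\<^esub> h = (\<lambda>w. \<Sum>i\<le>length w. f (take i w) * h (drop i w))"
  "f \<oplus>\<^bsub>free_algebra S\<^esub> h = (\<lambda>w. f w + h w)"
  "\<zero>\<^bsub>free_algebra S\<^esub> = (\<lambda>w. 0)"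
  "\<one>\<^bsub>free_algebra S\<^esub> = scaled_word 1 []"
  by (simp_all add: free_algebra_def scaled_word_def)

lemma scaled_word_carrier: "v \<in> lists S \<Longrightarrow> scaled_word c v \<in> carrier (free_algebra S)"
  unfolding free_algebra_carrier
proof
  show "finite {w. scaled_word c v w \<noteq> 0}"
    by (rule finite_subset[of _ "{v}"]) (auto simp: scaled_word_def)
qed (auto simp: scaled_word_def)

lemma free_algebra_add_closed:
  assumes "f \<in> carrier (free_algebra S)" "h \<in> carrier (free_algebra S)"
  shows "(\<lambda>w. f w + h w) \<in> carrier (free_algebra S)"
  unfolding free_algebra_carrier
proof
  show "finite {w. f w + h w \<noteq> 0}"
    by (rule finite_subset[of _ "{w. f w \<noteq> 0} \<union> {w. h w \<noteq> 0}"])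
       (use assms in \<open>auto simp: free_algebra_carrier\<close>)
  show "\<forall>w. f w + h w \<noteq> 0 \<longrightarrow> w \<in> lists S"
    using assms unfolding free_algebra_carrier by (metis add.right_neutral)
qed

lemma free_algebra_mult_closed:
  assumes f: "f \<in> carrier (free_algebra S)" and h: "h \<in> carrier (free_algebra S)"
  shows "f \<otimes>\<^bsub>free_algebra S\<^esub> h \<in> carrier (free_algebra S)"
proof -
  let ?fh = "f \<otimes>\<^bsub>free_algebra S\<^esub> h"
  have ex: "\<exists>u v. w = u @ v \<and> f u \<noteq> 0 \<and> h v \<noteq> 0" if "?fh w \<noteq> 0" for w
  proof -
    from that obtain i where "f (take i w) * h (drop i w) \<noteq> 0"
      unfolding free_algebra_simps by (meson sum.not_neutral_contains_not_neutral)
    then show ?thesis by (intro exI[of _ "take i w"] exI[of _ "drop i w"]) auto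
  qed
  have "finite ((\<lambda>(u, v). u @ v) ` ({w. f w \<noteq> 0} \<times> {w. h w \<noteq> 0}))"
    using f h by (auto simp: free_algebra_carrier)
  moreover have "{w. ?fh w \<noteq> 0} \<subseteq> (\<lambda>(u, v). u @ v) ` ({w. f w \<noteq> 0} \<times> {w. h w \<noteq> 0})"
    using ex by fastforce
  ultimately have "finite {w. ?fh w \<noteq> 0}" by (rule finite_subset[rotated])
  moreover have "w \<in> lists S" if w: "?fh w \<noteq> 0" for w
  proof -
    from ex[OF w] obtain u v where "w = u @ v" "f u \<noteq> 0" "h v \<noteq> 0" by blast
    then show ?thesis using f h by (simp add: free_algebra_carrier)
  qed
  ultimately show ?thesis by (simp add: free_algebra_carrier)
qed

text \<open>Both sides sum over the decompositions of \<open>w\<close> into three consecutive words, of lengths \<open>a\<close>, \<open>b\<close>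
  and the rest.\<close>

lemma free_algebra_mult_assoc:
  "(f \<otimes>\<^bsub>free_algebra S\<^esub> g) \<otimes>\<^bsub>free_algebra S\<^esub> h = f \<otimes>\<^bsub>free_algebra S\<^esub> (g \<otimes>\<^bsub>free_algebra S\<^esub> h)"
proof
  fix w :: "'a list"
  define F where "F a b = f (take a w) * (g (take b (drop a w)) * h (drop (a + b) w))" for a b
  have "((f \<otimes>\<^bsub>free_algebra S\<^esub> g) \<otimes>\<^bsub>free_algebra S\<^esub> h) w = (\<Sum>i\<le>length w. \<Sum>k\<le>i. F k (i - k))"
    unfolding free_algebra_simps sum_distrib_right
  proof (rule sum.cong[OF refl])
    fix i assume "i \<in> {..length w}"
    then have i: "i \<le> length w" by simp
    show "(\<Sum>k\<le>length (take i w). f (take k (take i w)) * g (drop k (take i w)) * h (drop i w)) =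
      (\<Sum>k\<le>i. F k (i - k))"
      by (rule sum.cong) (use i in \<open>auto simp: F_def drop_take min_def\<close>)
  qed
  also have "\<dots> = (\<Sum>(a, b)\<in>{(a, b). a + b \<le> length w}. F a b)"
    by (rule sum.triangle_reindex_eq[symmetric])
  also have "{(a, b). a + b \<le> length w} = (SIGMA a:{..length w}. {..length w - a})" by auto
  also have "(\<Sum>(a, b)\<in>\<dots>. F a b) = (\<Sum>a\<le>length w. \<Sum>b\<le>length w - a. F a b)"
    by (rule sum.Sigma[symmetric]) simp_all
  also have "\<dots> = (f \<otimes>\<^bsub>free_algebra S\<^esub> (g \<otimes>\<^bsub>free_algebra S\<^esub> h)) w"
    unfolding free_algebra_simps F_def sum_distrib_left by (simp add: add.commute)
  finally show "((f \<otimes>\<^bsub>free_algebra S\<^esub> g) \<otimes>\<^bsub>free_algebra S\<^esub> h) w =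
    (f \<otimes>\<^bsub>free_algebra S\<^esub> (g \<otimes>\<^bsub>free_algebra S\<^esub> h)) w" .
qed

lemma scaled_word_mult:
  "scaled_word c u \<otimes>\<^bsub>free_algebra S\<^esub> scaled_word d v = scaled_word (c * d) (u @ v)"
proof
  fix w :: "'a list"
  have *: "scaled_word c u (take i w) * scaled_word d v (drop i w) =
    (if i = length u then (if w = u @ v then c * d else 0) else 0)" if "i \<le> length w" for i
  proof -
    have "take i w = u \<and> drop i w = v \<longleftrightarrow> w = u @ v \<and> i = length u"
    proof
      assume tk: "take i w = u \<and> drop i w = v"
      then have "w = u @ v" by (metis append_take_drop_id)
      moreover have "length u = i" using tk \<open>i \<le> length w\<close> by auto
      ultimately show "w = u @ v \<and> i = length u" by simp
    qed simp
    then show ?thesis unfolding scaled_word_def by (cases "take i w = u"; cases "drop i w = v"; simp)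
  qed
  have "(scaled_word c u \<otimes>\<^bsub>free_algebra S\<^esub> scaled_word d v) w =
    (\<Sum>i\<le>length w. if i = length u then (if w = u @ v then c * d else 0) else 0)"
    unfolding free_algebra_simps by (rule sum.cong) (use * in auto)
  also have "\<dots> = scaled_word (c * d) (u @ v) w" by (auto simp: scaled_word_def)
  finally show "(scaled_word c u \<otimes>\<^bsub>free_algebra S\<^esub> scaled_word d v) w = scaled_word (c * d) (u @ v) w" .
qed

lemma scaled_one_mult: "scaled_word c [] \<otimes>\<^bsub>free_algebra S\<^esub> f = (\<lambda>w. c * f w)"
proof
  fix w
  have "(scaled_word c [] \<otimes>\<^bsub>free_algebra S\<^esub> f) w = (\<Sum>i\<le>length w. if i = 0 then c * f w else 0)"
    unfolding free_algebra_simps by (rule sum.cong) (auto simp: scaled_word_def)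
  then show "(scaled_word c [] \<otimes>\<^bsub>free_algebra S\<^esub> f) w = c * f w" by simp
qed

lemma mult_scaled_one: "f \<otimes>\<^bsub>free_algebra S\<^esub> scaled_word c [] = (\<lambda>w. c * f w)"
proof
  fix w
  have "(f \<otimes>\<^bsub>free_algebra S\<^esub> scaled_word c []) w = (\<Sum>i\<le>length w. if i = length w then c * f w else 0)"
    unfolding free_algebra_simps by (rule sum.cong) (auto simp: scaled_word_def)
  then show "(f \<otimes>\<^bsub>free_algebra S\<^esub> scaled_word c []) w = c * f w" by simp
qed

lemma ring_free_algebra: "ring (free_algebra S :: ('g list \<Rightarrow> 'k::field) ring)"
proof (rule ringI)
  show "abelian_group (free_algebra S :: ('g list \<Rightarrow> 'k::field) ring)"
  proof (rule abelian_groupI)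
    fix f :: "'g list \<Rightarrow> 'k" assume f: "f \<in> carrier (free_algebra S)"
    then have "(\<lambda>w. - f w) \<in> carrier (free_algebra S)" by (simp add: free_algebra_carrier)
    then show "\<exists>h\<in>carrier (free_algebra S). h \<oplus>\<^bsub>free_algebra S\<^esub> f = \<zero>\<^bsub>free_algebra S\<^esub>"
      by (rule bexI[rotated]) (simp add: free_algebra_simps)
  next
    show "f \<oplus>\<^bsub>free_algebra S\<^esub> h \<in> carrier (free_algebra S)"
      if "f \<in> carrier (free_algebra S)" "h \<in> carrier (free_algebra S)" for f h :: "'g list \<Rightarrow> 'k"
      using free_algebra_add_closed[OF that] by (simp add: free_algebra_simps)
  qed (simp_all add: free_algebra_simps free_algebra_carrier algebra_simps)
  show "monoid (free_algebra S :: ('g list \<Rightarrow> 'k::field) ring)"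
  proof (rule monoidI)
    show "\<one>\<^bsub>free_algebra S\<^esub> \<in> carrier (free_algebra S :: ('g list \<Rightarrow> 'k::field) ring)"
      unfolding free_algebra_simps by (rule scaled_word_carrier) simp
    show "\<one>\<^bsub>free_algebra S\<^esub> \<otimes>\<^bsub>free_algebra S\<^esub> f = f" "f \<otimes>\<^bsub>free_algebra S\<^esub> \<one>\<^bsub>free_algebra S\<^esub> = f"
      for f :: "'g list \<Rightarrow> 'k"
      unfolding free_algebra_simps(4) by (simp_all add: scaled_one_mult mult_scaled_one)
  qed (simp_all add: free_algebra_mult_closed free_algebra_mult_assoc)
  show "(f \<oplus>\<^bsub>free_algebra S\<^esub> g) \<otimes>\<^bsub>free_algebra S\<^esub> h =
      f \<otimes>\<^bsub>free_algebra S\<^esub> h \<oplus>\<^bsub>free_algebra S\<^esub> g \<otimes>\<^bsub>free_algebra S\<^esub> h"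
    "h \<otimes>\<^bsub>free_algebra S\<^esub> (f \<oplus>\<^bsub>free_algebra S\<^esub> g) =
      h \<otimes>\<^bsub>free_algebra S\<^esub> f \<oplus>\<^bsub>free_algebra S\<^esub> h \<otimes>\<^bsub>free_algebra S\<^esub> g"
    for f g h :: "'g list \<Rightarrow> 'k"
    by (simp_all add: free_algebra_simps algebra_simps sum.distrib)
qed

lemma free_algebra_induct [consumes 1, case_names zero word add]:
  assumes f: "f \<in> carrier (free_algebra S)"
    and zero: "P (\<lambda>w. 0)"
    and word: "\<And>v. f v \<noteq> 0 \<Longrightarrow> v \<in> lists S \<Longrightarrow> P (scaled_word (f v) v)"
    and add: "\<And>g h. g \<in> carrier (free_algebra S) \<Longrightarrow> h \<in> carrier (free_algebra S) \<Longrightarrow> P g \<Longrightarrow> P h \<Longrightarrow>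
      P (\<lambda>w. g w + h w)"
  shows "P f"
proof -
  have fin: "finite {w. f w \<noteq> 0}" and supp: "\<And>w. f w \<noteq> 0 \<Longrightarrow> w \<in> lists S"
    using f by (auto simp: free_algebra_carrier)
  have "(\<lambda>w. if w \<in> T then f w else 0) \<in> carrier (free_algebra S) \<and> P (\<lambda>w. if w \<in> T then f w else 0)"
    if "finite T" "T \<subseteq> {w. f w \<noteq> 0}" for T
    using that
  proof (induction T rule: finite_induct)
    case empty
    then show ?case using zero by (simp add: free_algebra_carrier)
  next
    case (insert v T)
    let ?g = "\<lambda>w. if w \<in> T then f w else 0"
    have v: "f v \<noteq> 0" "v \<in> lists S" using insert.prems supp by auto
    have eq: "(\<lambda>w. if w \<in> insert v T then f w else 0) = (\<lambda>w. scaled_word (f v) v w + ?g w)"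
      using insert.hyps(2) by (auto simp: scaled_word_def)
    have g: "?g \<in> carrier (free_algebra S)" "P ?g" using insert by auto
    show ?case
      unfolding eq
      using free_algebra_add_closed[OF scaled_word_carrier[OF v(2)] g(1)]
        add[OF scaled_word_carrier[OF v(2)] g(1) word[OF v] g(2)] by blast
  qed
  from this[OF fin order_refl] have "P (\<lambda>w. if f w \<noteq> 0 then f w else 0)" by simp
  moreover have "(\<lambda>w. if f w \<noteq> 0 then f w else 0) = f" by auto
  ultimately show ?thesis by simp
qed

lemma free_algebra_idealI:
  fixes I :: "('g list \<Rightarrow> 'k::field) set"
  assumes sub: "I \<subseteq> carrier (free_algebra S)" and zero: "(\<lambda>w. 0) \<in> I"
    and add: "\<And>f g. f \<in> I \<Longrightarrow> g \<in> I \<Longrightarrow> (\<lambda>w. f w + g w) \<in> I"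
    and left: "\<And>f g. f \<in> carrier (free_algebra S) \<Longrightarrow> g \<in> I \<Longrightarrow> f \<otimes>\<^bsub>free_algebra S\<^esub> g \<in> I"
    and right: "\<And>f g. f \<in> carrier (free_algebra S) \<Longrightarrow> g \<in> I \<Longrightarrow> g \<otimes>\<^bsub>free_algebra S\<^esub> f \<in> I"
  shows "ideal I (free_algebra S)"
proof (rule idealI[OF ring_free_algebra])
  interpret ring "free_algebra S :: ('g list \<Rightarrow> 'k) ring" by (rule ring_free_algebra)
  have neg: "(\<lambda>w. - f w) \<in> I" if "f \<in> I" for f
    using left[OF scaled_word_carrier[of "[]" S "-1"] that] by (simp add: scaled_one_mult)
  show "subgroup I (add_monoid (free_algebra S))"
  proof (rule group.subgroupI[OF a_group])
    show "I \<subseteq> carrier (add_monoid (free_algebra S))" using sub by simp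
    show "I \<noteq> {}" using zero by blast
    show "inv\<^bsub>add_monoid (free_algebra S)\<^esub> f \<in> I" if "f \<in> I" for f
    proof -
      have "\<ominus>\<^bsub>free_algebra S\<^esub> f = (\<lambda>w. - f w)"
        by (rule minus_equality) (use that neg sub in \<open>auto simp: free_algebra_simps\<close>)
      then show ?thesis using neg[OF that] by (simp add: a_inv_def)
    qed
    show "f \<otimes>\<^bsub>add_monoid (free_algebra S)\<^esub> g \<in> I" if "f \<in> I" "g \<in> I" for f g
      using add[OF that] by (simp add: free_algebra_simps)
  qed
qed (use left right in auto)

section \<open>Restricted enveloping algebras\<close>

definition class_in :: "('k::field, 'g::ab_group_add) lie \<Rightarrow> 'g set \<Rightarrow> ('g list \<Rightarrow> 'k) \<Rightarrow> ('g list \<Rightarrow> 'k) set" where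
  "class_in L S f = u_ideal L S +>\<^bsub>free_algebra S\<^esub> f"

definition augmentation_ideal :: "('k::field, 'g::ab_group_add) lie \<Rightarrow> 'g set \<Rightarrow> ('g list \<Rightarrow> 'k) set set" where
  "augmentation_ideal L S = class_in L S ` {f \<in> carrier (free_algebra S). f [] = 0}"

text \<open>The enveloping algebra of a restricted subalgebra \<open>S\<close>. The case \<open>S = UNIV\<close> is that of the whole Lie
  algebra.\<close>

locale enveloping =
  fixes L :: "('k::field, 'g::ab_group_add) lie" and S :: "'g set"
  assumes add_closed: "x \<in> S \<Longrightarrow> y \<in> S \<Longrightarrow> x + y \<in> S"
    and scale_closed: "x \<in> S \<Longrightarrow> lscale L a x \<in> S"
    and bracket_closed: "x \<in> S \<Longrightarrow> y \<in> S \<Longrightarrow> lbracket L x y \<in> S"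
    and pow_closed: "x \<in> S \<Longrightarrow> lpow L x \<in> S"
begin

abbreviation A :: "('g list \<Rightarrow> 'k) ring" where "A \<equiv> free_algebra S"
abbreviation U :: "('g list \<Rightarrow> 'k) set ring" where "U \<equiv> u_algebra L S"
abbreviation cls :: "('g list \<Rightarrow> 'k) \<Rightarrow> ('g list \<Rightarrow> 'k) set" where
  "cls \<equiv> class_in L S"
abbreviation letter :: "'g \<Rightarrow> ('g list \<Rightarrow> 'k) set" where
  "letter x \<equiv> cls (scaled_word 1 [x])"
abbreviation augmentation :: "('g list \<Rightarrow> 'k) set set" where
  "augmentation \<equiv> augmentation_ideal L S"

sublocale A: ring A by (rule ring_free_algebra)

lemma diff_closed:
  assumes "f \<in> carrier A" "h \<in> carrier A" shows "(\<lambda>w. f w - h w) \<in> carrier A"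
proof -
  have "(\<lambda>w. f w + (-1) * h w) \<in> carrier A"
    using free_algebra_add_closed[OF assms(1) A.m_closed[OF scaled_word_carrier[of "[]" S "-1"] assms(2)]]
    by (simp add: scaled_one_mult)
  then show ?thesis by simp
qed

lemma relations_in_carrier: "u_relations L S \<subseteq> carrier A"
proof
  note mono = scaled_word_carrier[of _ S "1::'k", folded monomial_word_eq]
  fix f assume "f \<in> u_relations L S"
  then consider (add) x y where "x \<in> S" "y \<in> S"
      "f = (\<lambda>w. monomial_word [x + y] w - monomial_word [x] w - monomial_word [y] w)"
    | (scale) a x where "x \<in> S" "f = (\<lambda>w. monomial_word [lscale L a x] w - a * monomial_word [x] w)"
    | (bracket) x y where "x \<in> S" "y \<in> S"
      "f = (\<lambda>w. monomial_word [x, y] w - monomial_word [y, x] w - monomial_word [lbracket L x y] w)"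
    | (pow) x where "x \<in> S"
      "f = (\<lambda>w. monomial_word (replicate CHAR('k) x) w - monomial_word [lpow L x] w)"
    unfolding u_relations_def by blast
  then show "f \<in> carrier A"
  proof cases
    case add
    then show ?thesis using add_closed by (auto intro!: diff_closed mono)
  next
    case scale
    have "(\<lambda>w. a * monomial_word [x] w) \<in> carrier A"
      using scaled_word_carrier[of "[x]" S a] scale(1)
      by (simp add: monomial_word_def scaled_word_def if_distrib cong: if_cong)
    then show ?thesis using scale scale_closed by (auto intro!: diff_closed mono)
  next
    case bracket
    then show ?thesis using bracket_closed by (auto intro!: diff_closed mono)
  next
    case pow
    then show ?thesis using pow_closed by (auto intro!: diff_closed mono)
  qed
qed

sublocale I: ideal "u_ideal L S" A
  unfolding u_ideal_def by (rule A.genideal_ideal[OF relations_in_carrier])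

sublocale U: ring U
  unfolding u_algebra_def by (rule I.quotient_is_ring)

lemma class_hom: "cls \<in> Ring.ring_hom A U"
  using I.rcos_ring_hom unfolding class_in_def u_algebra_def by simp

lemma class_closed: "f \<in> carrier A \<Longrightarrow> cls f \<in> carrier U"
  using class_hom by (rule ring_hom_closed)

lemma class_add:
  "f \<in> carrier A \<Longrightarrow> h \<in> carrier A \<Longrightarrow> cls (\<lambda>w. f w + h w) = cls f \<oplus>\<^bsub>U\<^esub> cls h"
  using ring_hom_add[OF class_hom, of f h] by (simp add: free_algebra_simps)

lemma class_mult:
  "f \<in> carrier A \<Longrightarrow> h \<in> carrier A \<Longrightarrow> cls (f \<otimes>\<^bsub>A\<^esub> h) = cls f \<otimes>\<^bsub>U\<^esub> cls h"
  by (rule ring_hom_mult[OF class_hom])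

lemma class_one: "cls (scaled_word 1 []) = \<one>\<^bsub>U\<^esub>"
  using ring_hom_one[OF class_hom] by (simp add: free_algebra_simps)

lemma class_ideal: "f \<in> u_ideal L S \<Longrightarrow> cls f = \<zero>\<^bsub>U\<^esub>"
  unfolding class_in_def u_algebra_def
  by (simp add: FactRing_def I.a_rcos_const)

lemma class_zero: "cls (\<lambda>w. 0) = \<zero>\<^bsub>U\<^esub>"
  by (rule class_ideal) (use I.zero_closed in \<open>simp add: free_algebra_simps\<close>)

lemma carrier_U: "C \<in> carrier U \<Longrightarrow> \<exists>f\<in>carrier A. C = cls f"
  unfolding u_algebra_def FactRing_def A_RCOSETS_def' class_in_def by auto

lemma class_eq_if_diff:
  assumes f: "f \<in> carrier A" and i: "i \<in> u_ideal L S" and h: "\<And>w. h w = i w + f w"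
  shows "cls h = cls f"
proof -
  have "h = (\<lambda>w. i w + f w)" using h by blast
  then have "cls h = cls i \<oplus>\<^bsub>U\<^esub> cls f" using class_add[OF I.a_Hcarr[OF i] f] by simp
  then show ?thesis using class_ideal[OF i] class_closed[OF f] by simp
qed

lemma relation_in_ideal: "f \<in> u_relations L S \<Longrightarrow> f \<in> u_ideal L S"
  unfolding u_ideal_def using A.genideal_self[OF relations_in_carrier] by blast

lemma class_word_add:
  assumes "x \<in> S" "y \<in> S"
  shows "cls (scaled_word 1 [x + y]) = cls (scaled_word 1 [x]) \<oplus>\<^bsub>U\<^esub> cls (scaled_word 1 [y])"
proof -
  let ?i = "\<lambda>w. monomial_word [x + y] w - monomial_word [x] w - monomial_word [y] w :: 'k"
  have "?i \<in> u_ideal L S" by (rule relation_in_ideal) (use assms in \<open>auto simp: u_relations_def\<close>)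
  then have "cls (scaled_word 1 [x + y]) = cls (\<lambda>w. scaled_word 1 [x] w + scaled_word 1 [y] w)"
    by (rule class_eq_if_diff[rotated])
       (use assms in \<open>auto simp: monomial_word_eq intro!: free_algebra_add_closed scaled_word_carrier\<close>)
  then show ?thesis using assms by (simp add: class_add scaled_word_carrier)
qed

lemma class_word_scale:
  assumes "x \<in> S"
  shows "cls (scaled_word 1 [lscale L a x]) = cls (scaled_word a [x])"
proof (rule class_eq_if_diff)
  show "(\<lambda>w. monomial_word [lscale L a x] w - a * monomial_word [x] w) \<in> u_ideal L S"
    by (rule relation_in_ideal) (use assms in \<open>auto simp: u_relations_def\<close>)
  show "scaled_word a [x] \<in> carrier A" by (rule scaled_word_carrier) (use assms in simp)
qed (simp add: monomial_word_def scaled_word_def)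

lemma class_word_bracket:
  assumes "x \<in> S" "y \<in> S"
  shows "cls (scaled_word 1 [x, y]) =
    cls (scaled_word 1 [y, x]) \<oplus>\<^bsub>U\<^esub> cls (scaled_word 1 [lbracket L x y])"
proof -
  let ?i = "\<lambda>w. monomial_word [x, y] w - monomial_word [y, x] w - monomial_word [lbracket L x y] w :: 'k"
  have "?i \<in> u_ideal L S" by (rule relation_in_ideal) (use assms in \<open>auto simp: u_relations_def\<close>)
  then have "cls (scaled_word 1 [x, y]) =
      cls (\<lambda>w. scaled_word 1 [y, x] w + scaled_word 1 [lbracket L x y] w)"
    by (rule class_eq_if_diff[rotated])
       (use assms bracket_closed in \<open>auto simp: monomial_word_eq intro!: free_algebra_add_closed scaled_word_carrier\<close>)
  then show ?thesis using assms bracket_closed by (simp add: class_add scaled_word_carrier)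
qed

lemma class_word_pow:
  assumes "x \<in> S"
  shows "cls (scaled_word 1 (replicate CHAR('k) x)) = cls (scaled_word 1 [lpow L x])"
proof (rule class_eq_if_diff)
  show "(\<lambda>w. monomial_word (replicate CHAR('k) x) w - monomial_word [lpow L x] w) \<in> u_ideal L S"
    by (rule relation_in_ideal) (use assms in \<open>auto simp: u_relations_def\<close>)
qed (use assms pow_closed in \<open>simp_all add: scaled_word_carrier monomial_word_eq\<close>)

end

text \<open>The enveloping algebra of an elementary subalgebra. The assumptions list what its commutativity and
  its radical depend on.\<close>

locale elementary_enveloping =
  fixes L :: "('k::field, 'g::ab_group_add) lie" and S :: "'g set"
  assumes zero_in: "0 \<in> S"
    and elem_add_closed: "x \<in> S \<Longrightarrow> y \<in> S \<Longrightarrow> x + y \<in> S"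
    and elem_scale_closed: "x \<in> S \<Longrightarrow> lscale L a x \<in> S"
    and scale_zero: "lscale L 0 0 = 0"
    and bracket_eq_zero: "x \<in> S \<Longrightarrow> y \<in> S \<Longrightarrow> lbracket L x y = 0"
    and pow_eq_zero: "x \<in> S \<Longrightarrow> lpow L x = 0"
    and char_pos: "CHAR('k) > 0"
begin

sublocale enveloping L S
  by unfold_locales (simp_all add: zero_in elem_add_closed elem_scale_closed bracket_eq_zero pow_eq_zero)

lemma letter_closed: "x \<in> S \<Longrightarrow> letter x \<in> carrier U"
  by (simp add: class_closed scaled_word_carrier)

lemma letter_zero: "letter 0 = \<zero>\<^bsub>U\<^esub>"
proof -
  have "scaled_word (0::'k) [0::'g] = (\<lambda>w. 0)" by (auto simp: scaled_word_def)
  then show ?thesis using class_word_scale[OF zero_in, of 0] class_zero by (simp add: scale_zero)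
qed

lemma class_scaled_Cons:
  "x \<in> S \<Longrightarrow> v \<in> lists S \<Longrightarrow> cls (scaled_word c (x # v)) = letter x \<otimes>\<^bsub>U\<^esub> cls (scaled_word c v)"
  using class_mult[of "scaled_word 1 [x]" "scaled_word c v"]
  by (simp add: scaled_word_carrier scaled_word_mult)

lemma letters_commute:
  assumes "x \<in> S" "y \<in> S" shows "letter x \<otimes>\<^bsub>U\<^esub> letter y = letter y \<otimes>\<^bsub>U\<^esub> letter x"
proof -
  have word: "cls (scaled_word 1 [u, v]) = letter u \<otimes>\<^bsub>U\<^esub> letter v" if "u \<in> S" "v \<in> S" for u v
    using class_scaled_Cons[of u "[v]" 1] that by simp
  have "cls (scaled_word 1 [x, y]) = cls (scaled_word 1 [y, x])"
    using class_word_bracket[OF assms] assms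
    by (simp add: bracket_eq_zero letter_zero class_closed scaled_word_carrier)
  then show ?thesis using assms by (simp add: word)
qed

lemma constant_commutes:
  "f \<in> carrier A \<Longrightarrow> cls (scaled_word c []) \<otimes>\<^bsub>U\<^esub> cls f = cls f \<otimes>\<^bsub>U\<^esub> cls (scaled_word c [])"
  using class_mult[of "scaled_word c []" f] class_mult[of f "scaled_word c []"]
  by (simp add: scaled_word_carrier scaled_one_mult mult_scaled_one)

text \<open>The elements that commute with \<open>a\<close> form a subalgebra, so it suffices to check generators.\<close>

lemma commute_induct:
  assumes a: "a \<in> carrier U"
    and const: "\<And>c. a \<otimes>\<^bsub>U\<^esub> cls (scaled_word c []) = cls (scaled_word c []) \<otimes>\<^bsub>U\<^esub> a"
    and letters: "\<And>x. x \<in> S \<Longrightarrow> a \<otimes>\<^bsub>U\<^esub> letter x = letter x \<otimes>\<^bsub>U\<^esub> a"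
    and f: "f \<in> carrier A"
  shows "a \<otimes>\<^bsub>U\<^esub> cls f = cls f \<otimes>\<^bsub>U\<^esub> a"
  using f
proof (induction rule: free_algebra_induct)
  case zero
  then show ?case using a by (simp add: class_zero)
next
  case (word v)
  have "a \<otimes>\<^bsub>U\<^esub> cls (scaled_word c v) = cls (scaled_word c v) \<otimes>\<^bsub>U\<^esub> a" for c
    using word(2)
  proof (induction v)
    case Nil
    then show ?case by (simp add: const)
  next
    case (Cons x v)
    then have x: "x \<in> S" and v: "v \<in> lists S" by auto
    have cl: "letter x \<in> carrier U" "cls (scaled_word c v) \<in> carrier U"
      using x v by (simp_all add: letter_closed class_closed scaled_word_carrier)
    have "a \<otimes>\<^bsub>U\<^esub> (letter x \<otimes>\<^bsub>U\<^esub> cls (scaled_word c v)) = letter x \<otimes>\<^bsub>U\<^esub> (a \<otimes>\<^bsub>U\<^esub> cls (scaled_word c v))"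
      using a cl letters[OF x] by (simp add: U.m_assoc[symmetric])
    also have "\<dots> = (letter x \<otimes>\<^bsub>U\<^esub> cls (scaled_word c v)) \<otimes>\<^bsub>U\<^esub> a"
      using a cl Cons.IH by (simp add: U.m_assoc)
    finally show ?case by (simp add: class_scaled_Cons[OF x v])
  qed
  then show ?case .
next
  case (add g h)
  then show ?case using a by (simp add: class_add class_closed U.r_distr U.l_distr)
qed

lemma class_commute:
  assumes f: "f \<in> carrier A" and h: "h \<in> carrier A"
  shows "cls f \<otimes>\<^bsub>U\<^esub> cls h = cls h \<otimes>\<^bsub>U\<^esub> cls f"
proof (rule commute_induct[OF class_closed[OF f] _ _ h])
  show "cls f \<otimes>\<^bsub>U\<^esub> cls (scaled_word c []) = cls (scaled_word c []) \<otimes>\<^bsub>U\<^esub> cls f" for c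
    by (rule constant_commutes[OF f, symmetric])
  fix x assume x: "x \<in> S"
  show "cls f \<otimes>\<^bsub>U\<^esub> letter x = letter x \<otimes>\<^bsub>U\<^esub> cls f"
  proof (rule commute_induct[OF letter_closed[OF x] _ _ f, symmetric])
    show "letter x \<otimes>\<^bsub>U\<^esub> cls (scaled_word c []) = cls (scaled_word c []) \<otimes>\<^bsub>U\<^esub> letter x" for c
      by (rule constant_commutes[symmetric]) (simp add: x scaled_word_carrier)
    show "letter x \<otimes>\<^bsub>U\<^esub> letter y = letter y \<otimes>\<^bsub>U\<^esub> letter x" if "y \<in> S" for y
      by (rule letters_commute[OF x that])
  qed
qed

lemma U_commute: "a \<in> carrier U \<Longrightarrow> b \<in> carrier U \<Longrightarrow> a \<otimes>\<^bsub>U\<^esub> b = b \<otimes>\<^bsub>U\<^esub> a"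
  using class_commute carrier_U by metis

lemma letter_nilpotent: "x \<in> S \<Longrightarrow> cls (scaled_word 1 (replicate CHAR('k) x)) = \<zero>\<^bsub>U\<^esub>"
  using class_word_pow[of x] by (simp add: pow_eq_zero letter_zero)

text \<open>The constant term is a character of the free algebra. It vanishes on the relations, where \<open>p > 0\<close>
  matters for \<open>x ^ p = x\<^sup>[\<^sup>p\<^sup>]\<close>, and therefore on the ideal.\<close>

lemma ideal_constant_term: "f \<in> u_ideal L S \<Longrightarrow> f [] = 0"
proof -
  have "ideal {f \<in> carrier A. f [] = 0} A"
  proof (rule free_algebra_idealI)
    show "(\<lambda>w. 0) \<in> {f \<in> carrier A. f [] = 0}" by (simp add: free_algebra_carrier)
    show "(\<lambda>w. f w + g w) \<in> {f \<in> carrier A. f [] = 0}"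
      if "f \<in> {f \<in> carrier A. f [] = 0}" "g \<in> {f \<in> carrier A. f [] = 0}" for f g
      using that free_algebra_add_closed[of f S g] by simp
    have "(f \<otimes>\<^bsub>A\<^esub> g) [] = f [] * g []" for f g by (simp add: free_algebra_simps)
    then show "f \<otimes>\<^bsub>A\<^esub> g \<in> {f \<in> carrier A. f [] = 0}" "g \<otimes>\<^bsub>A\<^esub> f \<in> {f \<in> carrier A. f [] = 0}"
      if "f \<in> carrier A" "g \<in> {f \<in> carrier A. f [] = 0}" for f g
      using that free_algebra_mult_closed[of f S g] free_algebra_mult_closed[of g S f] by simp_all
  qed blast
  moreover have "u_relations L S \<subseteq> {f \<in> carrier A. f [] = 0}"
  proof
    fix f assume f: "f \<in> u_relations L S"
    then have "f [] = 0" using char_pos unfolding u_relations_def by (auto simp: monomial_word_def)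
    then show "f \<in> {f \<in> carrier A. f [] = 0}" using f relations_in_carrier by blast
  qed
  ultimately have "u_ideal L S \<subseteq> {f \<in> carrier A. f [] = 0}"
    unfolding u_ideal_def by (rule A.genideal_minimal)
  then show "f \<in> u_ideal L S \<Longrightarrow> f [] = 0" by blast
qed

lemma class_eq_constant_term:
  assumes "f \<in> carrier A" "h \<in> carrier A" "cls f = cls h" shows "f [] = h []"
proof -
  have "f \<in> cls f" unfolding class_in_def by (rule I.a_rcos_self[OF assms(1)])
  then have "f \<in> a_r_coset A (u_ideal L S) h" using assms(3) by (simp add: class_in_def)
  then obtain i where "i \<in> u_ideal L S" "f = i \<oplus>\<^bsub>A\<^esub> h" unfolding a_r_coset_def' by blast
  then show ?thesis using ideal_constant_term by (simp add: free_algebra_simps)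
qed

lemma augmentation_iff: "f \<in> carrier A \<Longrightarrow> cls f \<in> augmentation \<longleftrightarrow> f [] = 0"
proof
  assume f: "f \<in> carrier A" and "cls f \<in> augmentation"
  then obtain h where "h \<in> carrier A" "h [] = 0" "cls f = cls h" unfolding augmentation_ideal_def by blast
  then show "f [] = 0" using class_eq_constant_term[OF f] by metis
qed (auto simp: augmentation_ideal_def)

lemma left_idealD:
  assumes "left_ideal U I"
  shows "I \<subseteq> carrier U" "\<zero>\<^bsub>U\<^esub> \<in> I" "a \<in> I \<Longrightarrow> b \<in> I \<Longrightarrow> a \<oplus>\<^bsub>U\<^esub> b \<in> I"
    "a \<in> carrier U \<Longrightarrow> b \<in> I \<Longrightarrow> a \<otimes>\<^bsub>U\<^esub> b \<in> I"
proof -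
  have add: "additive_subgroup I U" using assms by (simp add: left_ideal_def)
  show "I \<subseteq> carrier U" by (rule additive_subgroup.a_subset[OF add])
  show "\<zero>\<^bsub>U\<^esub> \<in> I" by (rule additive_subgroup.zero_closed[OF add])
  show "a \<in> I \<Longrightarrow> b \<in> I \<Longrightarrow> a \<oplus>\<^bsub>U\<^esub> b \<in> I" by (rule additive_subgroup.a_closed[OF add])
  show "a \<in> carrier U \<Longrightarrow> b \<in> I \<Longrightarrow> a \<otimes>\<^bsub>U\<^esub> b \<in> I" using assms by (simp add: left_ideal_def)
qed

lemma left_idealI:
  assumes sub: "I \<subseteq> carrier U" and zero: "\<zero>\<^bsub>U\<^esub> \<in> I"
    and add: "\<And>a b. a \<in> I \<Longrightarrow> b \<in> I \<Longrightarrow> a \<oplus>\<^bsub>U\<^esub> b \<in> I"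
    and mult: "\<And>a b. a \<in> carrier U \<Longrightarrow> b \<in> I \<Longrightarrow> a \<otimes>\<^bsub>U\<^esub> b \<in> I"
  shows "left_ideal U I"
  unfolding left_ideal_def
proof
  show "additive_subgroup I U"
  proof (rule additive_subgroup.intro, rule group.subgroupI[OF U.a_group])
    show "I \<subseteq> carrier (add_monoid U)" using sub by simp
    show "I \<noteq> {}" using zero by blast
    show "inv\<^bsub>add_monoid U\<^esub> a \<in> I" if "a \<in> I" for a
    proof -
      have "\<ominus>\<^bsub>U\<^esub> a = (\<ominus>\<^bsub>U\<^esub> \<one>\<^bsub>U\<^esub>) \<otimes>\<^bsub>U\<^esub> a" using that sub by (auto simp: U.l_minus)
      then have "\<ominus>\<^bsub>U\<^esub> a \<in> I" using mult[of "\<ominus>\<^bsub>U\<^esub> \<one>\<^bsub>U\<^esub>" a] that by simp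
      then show ?thesis by (simp add: a_inv_def)
    qed
    show "a \<otimes>\<^bsub>add_monoid U\<^esub> b \<in> I" if "a \<in> I" "b \<in> I" for a b using add[OF that] by simp
  qed
  show "\<forall>a\<in>carrier U. \<forall>x\<in>I. a \<otimes>\<^bsub>U\<^esub> x \<in> I" using mult by simp
qed

lemma left_ideal_one:
  assumes "left_ideal U I" "\<one>\<^bsub>U\<^esub> \<in> I" shows "I = carrier U"
proof
  show "I \<subseteq> carrier U" by (rule left_idealD(1)[OF assms(1)])
  show "carrier U \<subseteq> I"
  proof
    fix a assume "a \<in> carrier U"
    with left_idealD(4)[OF assms(1) this assms(2)] show "a \<in> I" by simp
  qed
qed

lemma left_ideal_augmentation: "left_ideal U augmentation"
proof (rule left_idealI)
  show "augmentation \<subseteq> carrier U" unfolding augmentation_ideal_def using class_closed by blast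
  show "\<zero>\<^bsub>U\<^esub> \<in> augmentation"
    using augmentation_iff[of "\<lambda>w. 0"] class_zero by (simp add: free_algebra_carrier)
  show "a \<oplus>\<^bsub>U\<^esub> b \<in> augmentation" if ab: "a \<in> augmentation" "b \<in> augmentation" for a b
  proof -
    from ab obtain f h where f: "f \<in> carrier A" "f [] = 0" "a = cls f"
      and h: "h \<in> carrier A" "h [] = 0" "b = cls h" unfolding augmentation_ideal_def by blast
    then show ?thesis
      using augmentation_iff[OF free_algebra_add_closed[OF f(1) h(1)]] by (simp add: class_add)
  qed
  show "a \<otimes>\<^bsub>U\<^esub> b \<in> augmentation" if ab: "a \<in> carrier U" "b \<in> augmentation" for a b
  proof -
    from ab obtain f h where f: "f \<in> carrier A" "a = cls f"
      and h: "h \<in> carrier A" "h [] = 0" "b = cls h" unfolding augmentation_ideal_def using carrier_U by blast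
    have "(f \<otimes>\<^bsub>A\<^esub> h) [] = 0" by (simp add: free_algebra_simps h(2))
    then have "cls (f \<otimes>\<^bsub>A\<^esub> h) \<in> augmentation" using augmentation_iff[OF A.m_closed[OF f(1) h(1)]] by blast
    then show ?thesis by (simp add: class_mult[OF f(1) h(1)] f(2) h(3))
  qed
qed

text \<open>An element outside of the augmentation ideal has a nonzero constant term, so modulo the
  augmentation ideal it is a unit.\<close>

lemma maximal_left_ideal_augmentation: "maximal_left_ideal U augmentation"
  unfolding maximal_left_ideal_def
proof (intro conjI allI impI)
  show "left_ideal U augmentation" by (rule left_ideal_augmentation)
  have "\<one>\<^bsub>U\<^esub> \<notin> augmentation"
    using augmentation_iff[OF scaled_word_carrier[of "[]" S 1]] class_one by (simp add: scaled_word_def)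
  then show "augmentation \<noteq> carrier U" by auto
  fix K assume K: "left_ideal U K \<and> augmentation \<subseteq> K"
  note Kd = left_idealD[OF conjunct1[OF K]]
  show "K = augmentation \<or> K = carrier U"
  proof (rule ccontr)
    assume contr: "\<not> (K = augmentation \<or> K = carrier U)"
    then obtain a where a: "a \<in> K" "a \<notin> augmentation" using K by blast
    then obtain f where f: "f \<in> carrier A" "a = cls f" using Kd(1) carrier_U by blast
    then have nz: "f [] \<noteq> 0" using a augmentation_iff by blast
    \<comment> \<open>\<open>1 = g + c f\<close>, where \<open>g\<close> lies in the augmentation ideal and \<open>c f\<close> in \<open>K\<close>.\<close>
    define c where "c = inverse (f [])"
    define g where "g w = scaled_word 1 [] w - c * f w" for w
    have cf: "(\<lambda>w. c * f w) \<in> carrier A"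
      using A.m_closed[OF scaled_word_carrier[of "[]" S c] f(1)] by (simp add: scaled_one_mult)
    have g: "g \<in> carrier A" "g [] = 0"
      using diff_closed[OF scaled_word_carrier[of "[]" S 1] cf] nz
      by (simp_all add: g_def[abs_def] scaled_word_def c_def)
    have "cls (\<lambda>w. c * f w) = cls (scaled_word c []) \<otimes>\<^bsub>U\<^esub> a"
      using class_mult[OF scaled_word_carrier[of "[]" S c] f(1)] by (simp add: scaled_one_mult f(2))
    then have 1: "cls (\<lambda>w. c * f w) \<in> K" using Kd(4) a(1) by (simp add: class_closed scaled_word_carrier)
    have 2: "cls g \<in> K" using g augmentation_iff K by blast
    have "cls (\<lambda>w. g w + c * f w) \<in> K" using class_add[OF g(1) cf] Kd(3)[OF 2 1] by simp
    then have "\<one>\<^bsub>U\<^esub> \<in> K" by (simp add: g_def class_one)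
    then show False using left_ideal_one K contr by blast
  qed
qed

text \<open>By commutativity the elements \<open>a\<close> with \<open>x a \<in> I\<close> form a left ideal \<open>K\<close> that contains \<open>I\<close>. If \<open>K\<close> is
  everything, then \<open>x \<in> I\<close>. If \<open>K = I\<close>, then powers of \<open>x\<close> in \<open>I\<close> can be divided by \<open>x\<close> inside \<open>I\<close>;
  starting from \<open>x ^ p = 0\<close> this leads to \<open>1 \<in> I\<close>, which is absurd.\<close>

lemma letter_in_maximal_left_ideal:
  assumes I: "maximal_left_ideal U I" and x: "x \<in> S"
  shows "letter x \<in> I"
proof -
  have lI: "left_ideal U I" and neq: "I \<noteq> carrier U"
    and max: "\<And>K. left_ideal U K \<Longrightarrow> I \<subseteq> K \<Longrightarrow> K = I \<or> K = carrier U"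
    using I unfolding maximal_left_ideal_def by auto
  note Id = left_idealD[OF lI] and lx = letter_closed[OF x]
  define K where "K = {a \<in> carrier U. letter x \<otimes>\<^bsub>U\<^esub> a \<in> I}"
  have "left_ideal U K"
  proof (rule left_idealI)
    show "a \<otimes>\<^bsub>U\<^esub> b \<in> K" if "a \<in> carrier U" "b \<in> K" for a b
    proof -
      have "letter x \<otimes>\<^bsub>U\<^esub> (a \<otimes>\<^bsub>U\<^esub> b) = a \<otimes>\<^bsub>U\<^esub> (letter x \<otimes>\<^bsub>U\<^esub> b)"
        using that lx U_commute[OF lx, of a] by (simp add: K_def U.m_assoc[symmetric])
      then show ?thesis using that Id(4) by (simp add: K_def)
    qed
  qed (use Id lx in \<open>auto simp: K_def U.r_distr\<close>)
  moreover have "I \<subseteq> K" using Id lx by (auto simp: K_def)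
  ultimately consider "K = I" | "K = carrier U" using max by blast
  then show ?thesis
  proof cases
    case 1
    have pow: "cls (scaled_word 1 (replicate n x)) \<in> I \<Longrightarrow> \<one>\<^bsub>U\<^esub> \<in> I" for n
    proof (induction n)
      case 0
      then show ?case by (simp add: class_one)
    next
      case (Suc n)
      have w: "replicate n x \<in> lists S" using x by auto
      have "cls (scaled_word 1 (replicate n x)) \<in> K"
        using Suc.prems w by (simp add: K_def class_scaled_Cons[OF x w] class_closed scaled_word_carrier)
      then show ?case using 1 Suc.IH by simp
    qed
    have "\<one>\<^bsub>U\<^esub> \<in> I" using pow[of "CHAR('k)"] letter_nilpotent[OF x] Id(2) by simp
    then show ?thesis using left_ideal_one[OF lI] neq by blast
  next
    case 2
    then have "\<one>\<^bsub>U\<^esub> \<in> K" by simp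
    then show ?thesis using lx by (simp add: K_def)
  qed
qed

text \<open>The augmentation ideal is one of the maximal left ideals, and it lies in all of them, as it is
  generated by the letters.\<close>

theorem jacobson_radical_eq: "jacobson_radical U = augmentation"
proof
  show "jacobson_radical U \<subseteq> augmentation"
    unfolding jacobson_radical_def using maximal_left_ideal_augmentation by blast
  show "augmentation \<subseteq> jacobson_radical U"
  proof
    fix a assume "a \<in> augmentation"
    then obtain f where f: "f \<in> carrier A" "f [] = 0" "a = cls f" unfolding augmentation_ideal_def by blast
    have "cls f \<in> I" if I: "maximal_left_ideal U I" for I
    proof -
      have lI: "left_ideal U I" using I unfolding maximal_left_ideal_def by blast
      note Id = left_idealD[OF lI]
      show ?thesis
        using f(1)
      proof (induction rule: free_algebra_induct)
        case zero
        then show ?case using Id(2) by (simp add: class_zero)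
      next
        case (word v)
        then obtain x v' where v: "v = x # v'" using f(2) by (cases v) auto
        then have x: "x \<in> S" "v' \<in> lists S" using word by auto
        have "cls (scaled_word (f v) v') \<otimes>\<^bsub>U\<^esub> letter x \<in> I"
          using Id(4) letter_in_maximal_left_ideal[OF I x(1)] x by (simp add: class_closed scaled_word_carrier)
        then show ?case
          unfolding v using x U_commute[OF letter_closed[OF x(1)], of "cls (scaled_word (f v) v')"]
          by (simp add: class_scaled_Cons[OF x] class_closed scaled_word_carrier v)
      next
        case (add g h)
        then show ?case using Id(3) by (simp add: class_add)
      qed
    qed
    then show "a \<in> jacobson_radical U"
      unfolding jacobson_radical_def using f class_closed by blast
  qed
qed

end

section \<open>Radicals and socles\<close>

primrec power_product :: "(nat \<Rightarrow> 'm \<Rightarrow> 'm) \<Rightarrow> (nat \<Rightarrow> nat) \<Rightarrow> nat list \<Rightarrow> 'm \<Rightarrow> 'm" where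
  "power_product g e [] m = m"
| "power_product g e (s # ss) m = (g s ^^ e s) (power_product g e ss m)"

lemma foldr_power_product: "foldr (\<lambda>s T. (g s ^^ e s) \<circ> T) ss id m = power_product g e ss m"
  by (induction ss) simp_all

lemma power_product_cong:
  "(\<And>s. s \<in> set ss \<Longrightarrow> e s = e' s) \<Longrightarrow> power_product g e ss m = power_product g e' ss m"
  by (induction ss) simp_all

text \<open>The monomial \<open>X\<^sup>a\<close> acting on the module, composed in the order used by \<open>Theta_power\<close>.\<close>

definition monomial_op :: "('g \<Rightarrow> 'm \<Rightarrow> 'm) \<Rightarrow> 'g list \<Rightarrow> nat list \<Rightarrow> 'm \<Rightarrow> 'm" where
  "monomial_op \<rho> X a = power_product (\<lambda>s. \<rho> (X ! s)) (\<lambda>s. a ! s) [0..<length a]"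

lemma funpow_commute_apply:
  assumes "\<And>m. S (T m) = T (S m)" shows "S ((T ^^ k) m) = (T ^^ k) (S m)"
  by (induction k) (simp_all add: assms)

lemma power_product_commuting:
  fixes g :: "nat \<Rightarrow> 'm \<Rightarrow> 'm"
  assumes "\<And>s t m. s \<in> set ss \<Longrightarrow> t \<in> set ss \<Longrightarrow> g s (g t m) = g t (g s m)"
    and "distinct ss" "s \<in> set ss"
    and e': "e' s = Suc (e s)" "\<And>t. t \<in> set ss \<Longrightarrow> t \<noteq> s \<Longrightarrow> e' t = e t"
  shows "g s (power_product g e ss m) = power_product g e' ss m"
  using assms
proof (induction ss)
  case (Cons u ss)
  show ?case
  proof (cases "u = s")
    case True
    have "power_product g e ss m = power_product g e' ss m"
    proof (rule power_product_cong)
      fix t assume t: "t \<in> set ss"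
      then have "t \<noteq> s" using Cons.prems(2) True by auto
      then show "e t = e' t" using Cons.prems(5)[of t] t by simp
    qed
    then show ?thesis using True e'(1) by simp
  next
    case False
    have "g s ((g u ^^ e u) n) = (g u ^^ e u) (g s n)" for n
      by (rule funpow_commute_apply) (use Cons.prems in simp)
    then show ?thesis using False Cons by simp
  qed
qed simp

lemma monomial_op_step:
  assumes comm: "\<And>x y m. x \<in> set X \<Longrightarrow> y \<in> set X \<Longrightarrow> \<rho> x (\<rho> y m) = \<rho> y (\<rho> x m)"
    and len: "length a = length X" and s: "s < length X"
  shows "\<rho> (X ! s) (monomial_op \<rho> X a m) = monomial_op \<rho> X (a[s := Suc (a ! s)]) m"
  unfolding monomial_op_def length_list_update
  by (rule power_product_commuting[where g = "\<lambda>t. \<rho> (X ! t)"])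
     (use comm len s in \<open>auto simp: nth_list_update\<close>)

lemma monomial_op_zero: "monomial_op \<rho> X (replicate n 0) m = m"
proof -
  have "power_product g (\<lambda>s. replicate n 0 ! s) ss m = m" if "\<forall>s\<in>set ss. s < n" for g ss
    using that by (induction ss) simp_all
  then show ?thesis by (simp add: monomial_op_def)
qed

definition monomial_word_of :: "'g list \<Rightarrow> nat list \<Rightarrow> 'g list" where
  "monomial_word_of X a = concat (map (\<lambda>s. replicate (a ! s) (X ! s)) [0..<length a])"

lemma length_monomial_word_of: "length (monomial_word_of X a) = sum_list a"
  by (simp add: monomial_word_of_def length_concat comp_def map_nth)

lemma set_monomial_word_of: "length a = length X \<Longrightarrow> set (monomial_word_of X a) \<subseteq> set X"
  by (auto simp: monomial_word_of_def)

text \<open>Powers of the radical act by sums of operators \<open>X\<^sup>a f\<close>, with \<open>a\<close> of a fixed degree and \<open>f\<close> in the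
  enveloping algebra of the elementary subalgebra; this is the closure under addition used for them.\<close>

inductive op_sum :: "('m \<Rightarrow> 'm::ab_group_add) set \<Rightarrow> ('m \<Rightarrow> 'm) \<Rightarrow> bool" for G where
  zero: "op_sum G (\<lambda>m. 0)"
| gen: "T \<in> G \<Longrightarrow> op_sum G T"
| add: "op_sum G T \<Longrightarrow> op_sum G T' \<Longrightarrow> op_sum G (\<lambda>m. T m + T' m)"

lemma op_sum_sum: "(\<And>i. i \<in> I \<Longrightarrow> op_sum G (T i)) \<Longrightarrow> op_sum G (\<lambda>m. \<Sum>i\<in>I. T i m)"
proof (induction I rule: infinite_finite_induct)
  case (insert i I)
  then show ?case by (simp add: op_sum.add)
qed (simp_all add: op_sum.zero)

text \<open>A module over the restricted enveloping algebra, regarded as a representation \<open>gen\<close> of the Lie algebra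
  together with the action \<open>act\<close> of the free algebra on its elements.\<close>

locale restricted_module = restricted_geometry L r
  for L :: "('k::field, 'g::ab_group_add) lie" and r :: nat +
  fixes M :: "('k, 'g, 'm::ab_group_add) umod"
  assumes umodule: "u_module L M"
begin

sublocale full: enveloping L UNIV
  by unfold_locales simp_all

sublocale descent_setting L r "mscale M" "mbasis M"
  using umodule by (simp add: descent_setting_def u_module_def restricted_geometry_axioms)

abbreviation act :: "('g list \<Rightarrow> 'k) \<Rightarrow> 'm \<Rightarrow> 'm" where
  "act f m \<equiv> mact M (u_class L f) m"

lemma u_class_eq: "u_class L f = class_in L UNIV f"
  by (simp add: u_class_def class_in_def)

lemma u_class_closed: "f \<in> carrier (free_algebra UNIV) \<Longrightarrow> u_class L f \<in> carrier (u_algebra L UNIV)"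
  unfolding u_class_eq by (rule full.class_closed)

lemmas module_laws = umodule[unfolded u_module_def, THEN conjunct2, THEN conjunct1]
  umodule[unfolded u_module_def, THEN conjunct2, THEN conjunct2, THEN conjunct1]
  umodule[unfolded u_module_def, THEN conjunct2, THEN conjunct2, THEN conjunct2, THEN conjunct1]
  umodule[unfolded u_module_def, THEN conjunct2, THEN conjunct2, THEN conjunct2, THEN conjunct2]

lemma act_add: "f \<in> carrier (free_algebra UNIV) \<Longrightarrow> act f (m + n) = act f m + act f n"
  using module_laws(1) u_class_closed by simp

lemma act_sum_left:
  "f \<in> carrier (free_algebra UNIV) \<Longrightarrow> h \<in> carrier (free_algebra UNIV) \<Longrightarrow>
     act (\<lambda>w. f w + h w) m = act f m + act h m"
  using module_laws(2) full.class_closed by (simp add: u_class_eq full.class_add)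

lemma act_mult:
  "f \<in> carrier (free_algebra UNIV) \<Longrightarrow> h \<in> carrier (free_algebra UNIV) \<Longrightarrow>
     act (f \<otimes>\<^bsub>free_algebra UNIV\<^esub> h) m = act f (act h m)"
  using module_laws(2) full.class_closed by (simp add: u_class_eq full.class_mult)

lemma act_constant: "act (scaled_word c []) m = mscale M c m"
proof -
  have word: "(scaled_word c [] :: 'g list \<Rightarrow> 'k) = (\<lambda>w. c * monomial_word [] w)"
    by (auto simp: scaled_word_def monomial_word_def)
  show ?thesis unfolding word by (rule module_laws(4)[THEN spec, THEN spec])
qed

lemma act_scaled:
  assumes "f \<in> carrier (free_algebra UNIV)"
  shows "act (\<lambda>w. c * f w) m = mscale M c (act f m)" "act (\<lambda>w. c * f w) m = act f (mscale M c m)"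
  using act_mult[OF scaled_word_carrier[of "[]" UNIV c] assms, of m]
    act_mult[OF assms scaled_word_carrier[of "[]" UNIV c], of m]
  by (simp_all add: scaled_one_mult mult_scaled_one act_constant)

lemma act_scale: "f \<in> carrier (free_algebra UNIV) \<Longrightarrow> act f (mscale M c m) = mscale M c (act f m)"
  using act_scaled[of f c m] by simp

lemma act_zero: "f \<in> carrier (free_algebra UNIV) \<Longrightarrow> act f 0 = 0"
  using act_scale[of f 0 0] by simp

lemma act_zero_left: "act (\<lambda>w. 0) m = 0"
  using act_scaled(1)[of "\<lambda>w. 0" 0 m] by (simp add: free_algebra_carrier)

definition gen :: "'g \<Rightarrow> 'm \<Rightarrow> 'm" where
  "gen x = act (scaled_word 1 [x])"

lemma gen_eq: "mact M (u_gen L x) m = gen x m"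
  by (simp add: gen_def u_gen_def monomial_word_eq)

lemma word_carrier: "scaled_word c v \<in> carrier (free_algebra (UNIV :: 'g set))"
  by (rule scaled_word_carrier) simp

lemma gen_linear: "gen x (m + n) = gen x m + gen x n" "gen x (mscale M c m) = mscale M c (gen x m)"
  by (simp_all add: gen_def act_add act_scale word_carrier)

lemma gen_add_left: "gen (x + y) m = gen x m + gen y m"
  unfolding gen_def u_class_eq full.class_word_add[OF UNIV_I UNIV_I]
  using module_laws(2) full.class_closed[OF word_carrier] by simp

lemma scaled_word_scale: "scaled_word c v = (\<lambda>w. c * scaled_word 1 v w)"
  by (auto simp: scaled_word_def)

lemma gen_scale_left: "gen (lscale L c x) m = mscale M c (gen x m)"
proof -
  have "gen (lscale L c x) m = act (scaled_word c [x]) m"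
    unfolding gen_def u_class_eq full.class_word_scale[OF UNIV_I] ..
  also have "\<dots> = mscale M c (gen x m)"
    unfolding gen_def by (subst scaled_word_scale) (rule act_scaled(1)[OF word_carrier])
  finally show ?thesis .
qed

lemma gen_sum_left: "finite I \<Longrightarrow> gen (\<Sum>i\<in>I. lscale L (c i) (x i)) m = (\<Sum>i\<in>I. mscale M (c i) (gen (x i) m))"
proof (induction I rule: finite_induct)
  case empty
  then show ?case using gen_scale_left[of 0 0 m] by simp
next
  case (insert i I)
  then show ?case by (simp add: gen_add_left gen_scale_left)
qed

lemma act_Cons: "act (scaled_word c (x # v)) m = gen x (act (scaled_word c v) m)"
  using act_mult[OF word_carrier[of 1 "[x]"] word_carrier[of c v], of m]
  by (simp add: scaled_word_mult gen_def)

lemma act_one: "act (scaled_word 1 []) m = m"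
  by (simp add: act_constant)

lemma module_hom_gen: "module_hom (mscale M) (mscale M) (gen x)"
  by unfold_locales (simp_all add: gen_linear)

lemma monomial_op_linear:
  "monomial_op gen X a (m + n) = monomial_op gen X a m + monomial_op gen X a n"
  "monomial_op gen X a (mscale M c m) = mscale M c (monomial_op gen X a m)"
proof -
  have pow: "(gen x ^^ k) (m + n) = (gen x ^^ k) m + (gen x ^^ k) n"
      "(gen x ^^ k) (mscale M c m) = mscale M c ((gen x ^^ k) m)" for x k m n
    by (induction k) (simp_all add: gen_linear)
  have "power_product (\<lambda>s. gen (X ! s)) e ss (m + n) =
      power_product (\<lambda>s. gen (X ! s)) e ss m + power_product (\<lambda>s. gen (X ! s)) e ss n"
    "power_product (\<lambda>s. gen (X ! s)) e ss (mscale M c m) =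
      mscale M c (power_product (\<lambda>s. gen (X ! s)) e ss m)" for e ss
    by (induction ss) (simp_all add: pow)
  then show "monomial_op gen X a (m + n) = monomial_op gen X a m + monomial_op gen X a n"
    "monomial_op gen X a (mscale M c m) = mscale M c (monomial_op gen X a m)"
    by (simp_all add: monomial_op_def)
qed

lemma module_hom_monomial_op: "module_hom (mscale M) (mscale M) (monomial_op gen X a)"
  by unfold_locales (simp_all add: monomial_op_linear)

lemma monomial_op_act: "monomial_op gen X a m = act (scaled_word 1 (monomial_word_of X a)) m"
proof -
  have pow: "(gen x ^^ k) (act (scaled_word 1 v) m) = act (scaled_word 1 (replicate k x @ v)) m" for x k v
    by (induction k) (simp_all add: act_Cons)
  have "power_product (\<lambda>s. gen (X ! s)) e ss m =
      act (scaled_word 1 (concat (map (\<lambda>s. replicate (e s) (X ! s)) ss))) m" for e ss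
    by (induction ss) (simp_all add: act_one pow)
  then show ?thesis unfolding monomial_op_def monomial_word_of_def .
qed

text \<open>The action is linear in the Lie algebra element, so \<open>\<Theta>\<^sub>s\<close> is the action of the \<open>s\<close>-th frame vector.\<close>

lemma Theta_eq: "Theta L M s t X = gen (X ! s) (t X)"
proof -
  have "Theta L M s t X = (\<Sum>x\<in>lbasis L. mscale M (lv.coordinate (X ! s) x) (gen x (t X)))"
    by (simp add: Theta_def gen_eq coord_fun_eq)
  also have "\<dots> = gen (\<Sum>x\<in>lbasis L. lscale L (lv.coordinate (X ! s) x) x) (t X)"
    by (rule gen_sum_left[OF lv.finite_Basis, symmetric])
  finally show ?thesis by (simp add: lv.coordinate_expansion)
qed

lemma Theta_power_eq: "Theta_power L M a t X = monomial_op gen X a (t X)"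
proof -
  have pow: "(Theta L M s ^^ k) t X = (gen (X ! s) ^^ k) (t X)" for s k t
    by (induction k) (simp_all add: Theta_eq)
  have "power_product (Theta L M) e ss t X = power_product (\<lambda>s. gen (X ! s)) e ss (t X)" for e ss
    by (induction ss) (simp_all add: pow)
  then show ?thesis unfolding Theta_power_def monomial_op_def foldr_power_product .
qed

end

locale framed_module = restricted_module L r M
  for L :: "('k::field, 'g::ab_group_add) lie" and r :: nat and M :: "('k, 'g, 'm::ab_group_add) umod" +
  fixes X :: "'g list"
  assumes X: "X \<in> elementary_frames L r"
begin

abbreviation \<epsilon> :: "'g set" where "\<epsilon> \<equiv> frame_span L X"

lemma elementary: "elementary_subalgebra L \<epsilon>"
  using X elementary_frames_iff by (simp add: elementary_subalgebras_def)

lemma length_X: "length X = r" and X_frame: "X \<in> frames L r"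
  using X elementary_frames_iff frames_iff by auto

lemma subspace_\<epsilon>: "lv.subspace \<epsilon>"
  by (simp add: frame_span_def)

sublocale el: elementary_enveloping L \<epsilon>
  using elementary lv.subspace_0[OF subspace_\<epsilon>] lv.subspace_add[OF subspace_\<epsilon>]
    lv.subspace_scale[OF subspace_\<epsilon>] char_pos
  unfolding elementary_subalgebra_def by unfold_locales simp_all

lemma set_X: "set X \<subseteq> \<epsilon>"
  unfolding frame_span_def by (rule lv.span_superset)

lemma carrier_subset: "f \<in> carrier (free_algebra \<epsilon>) \<Longrightarrow> f \<in> carrier (free_algebra UNIV)"
  by (simp add: free_algebra_carrier)

lemma same_mult: "f \<otimes>\<^bsub>free_algebra \<epsilon>\<^esub> h = f \<otimes>\<^bsub>free_algebra UNIV\<^esub> h"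
  by (simp add: free_algebra_simps)

text \<open>The relations of the subalgebra are among those of the whole Lie algebra, and the ideal of the latter
  cuts out an ideal of the smaller free algebra.\<close>

lemma u_ideal_subset: "u_ideal L \<epsilon> \<subseteq> u_ideal L UNIV"
proof -
  let ?K = "u_ideal L UNIV \<inter> carrier (free_algebra \<epsilon>)"
  have "ideal ?K (free_algebra \<epsilon>)"
  proof (rule free_algebra_idealI)
    show "(\<lambda>w. 0) \<in> ?K"
      using full.I.zero_closed by (simp add: free_algebra_simps free_algebra_carrier)
    show "(\<lambda>w. f w + g w) \<in> ?K" if "f \<in> ?K" "g \<in> ?K" for f g
      using that full.I.a_closed[of f g] free_algebra_add_closed[of f \<epsilon> g] by (simp add: free_algebra_simps)
    show "f \<otimes>\<^bsub>free_algebra \<epsilon>\<^esub> g \<in> ?K" if "f \<in> carrier (free_algebra \<epsilon>)" "g \<in> ?K" for f g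
      using that full.I.I_l_closed[of g f] carrier_subset[of f] free_algebra_mult_closed[of f \<epsilon> g]
      by (simp add: same_mult)
    show "g \<otimes>\<^bsub>free_algebra \<epsilon>\<^esub> f \<in> ?K" if "f \<in> carrier (free_algebra \<epsilon>)" "g \<in> ?K" for f g
      using that full.I.I_r_closed[of g f] carrier_subset[of f] free_algebra_mult_closed[of g \<epsilon> f]
      by (simp add: same_mult)
  qed blast
  moreover have "u_relations L \<epsilon> \<subseteq> u_relations L UNIV" unfolding u_relations_def by blast
  then have "u_relations L \<epsilon> \<subseteq> ?K" using full.relation_in_ideal el.relations_in_carrier by blast
  ultimately have "u_ideal L \<epsilon> \<subseteq> ?K" unfolding u_ideal_def[of L \<epsilon>] by (rule el.A.genideal_minimal)
  then show ?thesis by blast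
qed

lemma restrict_act_class:
  assumes f: "f \<in> carrier (free_algebra \<epsilon>)"
  shows "restrict_act L M (class_in L \<epsilon> f) m = act f m"
proof -
  have "u_ideal L UNIV <+>\<^bsub>free_algebra UNIV\<^esub> class_in L \<epsilon> f = u_class L f"
  proof
    show "u_ideal L UNIV <+>\<^bsub>free_algebra UNIV\<^esub> class_in L \<epsilon> f \<subseteq> u_class L f"
    proof
      fix h assume "h \<in> u_ideal L UNIV <+>\<^bsub>free_algebra UNIV\<^esub> class_in L \<epsilon> f"
      then obtain i k where i: "i \<in> u_ideal L UNIV" and k: "k \<in> u_ideal L \<epsilon>"
        and h: "h = (\<lambda>w. i w + (k w + f w))"
        unfolding set_add_def' class_in_def a_r_coset_def' by (auto simp: free_algebra_simps)
      have "(\<lambda>w. i w + k w) \<in> u_ideal L UNIV"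
        using full.I.a_closed[OF i, of k] k u_ideal_subset by (auto simp: free_algebra_simps)
      moreover have "h = (\<lambda>w. i w + k w) \<oplus>\<^bsub>free_algebra UNIV\<^esub> f" by (simp add: h free_algebra_simps add.assoc)
      ultimately show "h \<in> u_class L f" unfolding u_class_def a_r_coset_def' by blast
    qed
    show "u_class L f \<subseteq> u_ideal L UNIV <+>\<^bsub>free_algebra UNIV\<^esub> class_in L \<epsilon> f"
    proof
      fix h assume "h \<in> u_class L f"
      then obtain i where i: "i \<in> u_ideal L UNIV" "h = i \<oplus>\<^bsub>free_algebra UNIV\<^esub> f"
        unfolding u_class_def a_r_coset_def' by blast
      have "f \<in> class_in L \<epsilon> f" unfolding class_in_def by (rule el.I.a_rcos_self[OF f])
      with i show "h \<in> u_ideal L UNIV <+>\<^bsub>free_algebra UNIV\<^esub> class_in L \<epsilon> f"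
        unfolding set_add_def' by blast
    qed
  qed
  then show ?thesis by (simp add: restrict_act_def)
qed

lemma act_commute:
  assumes f: "f \<in> carrier (free_algebra \<epsilon>)" and h: "h \<in> carrier (free_algebra \<epsilon>)"
  shows "act f (act h m) = act h (act f m)"
proof -
  have fh: "f \<otimes>\<^bsub>free_algebra \<epsilon>\<^esub> h \<in> carrier (free_algebra \<epsilon>)" "h \<otimes>\<^bsub>free_algebra \<epsilon>\<^esub> f \<in> carrier (free_algebra \<epsilon>)"
    using f h free_algebra_mult_closed by blast+
  have "class_in L \<epsilon> (f \<otimes>\<^bsub>free_algebra \<epsilon>\<^esub> h) = class_in L \<epsilon> (h \<otimes>\<^bsub>free_algebra \<epsilon>\<^esub> f)"
    using el.class_commute[OF f h] by (simp add: el.class_mult f h)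
  then have "act (f \<otimes>\<^bsub>free_algebra \<epsilon>\<^esub> h) m = act (h \<otimes>\<^bsub>free_algebra \<epsilon>\<^esub> f) m"
    using restrict_act_class[OF fh(1)] restrict_act_class[OF fh(2)] by metis
  then show ?thesis
    using act_mult[OF carrier_subset[OF f] carrier_subset[OF h]] act_mult[OF carrier_subset[OF h] carrier_subset[OF f]]
    by (simp add: same_mult)
qed

lemma letter_carrier: "x \<in> \<epsilon> \<Longrightarrow> scaled_word 1 [x] \<in> carrier (free_algebra \<epsilon>)"
  by (simp add: scaled_word_carrier)

lemma gen_commute: "x \<in> \<epsilon> \<Longrightarrow> y \<in> \<epsilon> \<Longrightarrow> gen x (gen y m) = gen y (gen x m)"
  unfolding gen_def by (intro act_commute letter_carrier)

lemma monomial_word_carrier: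
  "length a = r \<Longrightarrow> scaled_word 1 (monomial_word_of X a) \<in> carrier (free_algebra \<epsilon>)"
  using set_monomial_word_of[of a X] set_X length_X by (intro scaled_word_carrier) auto

lemma act_monomial_op:
  "f \<in> carrier (free_algebra \<epsilon>) \<Longrightarrow> length a = r \<Longrightarrow>
     act f (monomial_op gen X a m) = monomial_op gen X a (act f m)"
  unfolding monomial_op_act by (intro act_commute monomial_word_carrier)

lemma gen_monomial_op:
  "length a = r \<Longrightarrow> s < r \<Longrightarrow> gen (X ! s) (monomial_op gen X a m) = monomial_op gen X (a[s := Suc (a ! s)]) m"
  by (rule monomial_op_step) (use gen_commute set_X length_X in auto)

definition degree_ops :: "nat \<Rightarrow> ('m \<Rightarrow> 'm) set" where
  "degree_ops j = {\<lambda>m. monomial_op gen X a (act f m) | a f. a \<in> exponents r j \<and> f \<in> carrier (free_algebra \<epsilon>)}"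

lemma exponents_step: "a \<in> exponents r j \<Longrightarrow> s < r \<Longrightarrow> a[s := Suc (a ! s)] \<in> exponents r (Suc j)"
proof -
  assume a: "a \<in> exponents r j" and s: "s < r"
  then have len: "length a = r" "sum_list a = j" by (auto simp: exponents_def)
  have "a ! s \<le> sum_list a" using elem_le_sum_list[of s a] len s by simp
  then have "sum_list (a[s := Suc (a ! s)]) = Suc j" using len s by (simp add: sum_list_update)
  then show ?thesis using len by (simp add: exponents_def)
qed

text \<open>An element of the augmentation ideal is a sum of words \<open>x v\<close>. Expanding \<open>x\<close> in the frame and moving
  each \<open>X\<^sub>s\<close> next to the monomial raises one exponent; the rest \<open>v\<close> is moved past the monomial.\<close>

lemma augmentation_raises_degree:
  assumes f: "f \<in> carrier (free_algebra \<epsilon>)" "f [] = 0" and T: "op_sum (degree_ops j) T"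
  shows "op_sum (degree_ops (Suc j)) (\<lambda>m. act f (T m))"
  using T
proof induction
  case zero
  then show ?case using act_zero[OF carrier_subset[OF f(1)]] by (simp add: op_sum.zero)
next
  case (add T T')
  then show ?case using act_add[OF carrier_subset[OF f(1)]] by (simp add: op_sum.add)
next
  case (gen T)
  then obtain a g where a: "a \<in> exponents r j" and g: "g \<in> carrier (free_algebra \<epsilon>)"
    and T: "T = (\<lambda>m. monomial_op gen X a (act g m))" unfolding degree_ops_def by blast
  have len: "length a = r" using a by (simp add: exponents_def)
  show ?case
    using f(1)
  proof (induction rule: free_algebra_induct)
    case zero
    then show ?case by (simp add: act_zero_left op_sum.zero)
  next
    case (add g h)
    then show ?case
      using act_sum_left[OF carrier_subset[OF add.hyps(1)] carrier_subset[OF add.hyps(2)]] by (simp add: op_sum.add)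
  next
    case (word v)
    then obtain x v' where v: "v = x # v'" using f(2) by (cases v) auto
    then have x: "x \<in> \<epsilon>" and v': "v' \<in> lists \<epsilon>" using word by auto
    from x obtain q where q: "x = (\<Sum>s<r. lscale L (q s) (X ! s))" using frame_span_iff[OF length_X] by blast
    define h where "h s = scaled_word (q s * f v) v' \<otimes>\<^bsub>free_algebra \<epsilon>\<^esub> g" for s
    have sw: "scaled_word c v' \<in> carrier (free_algebra \<epsilon>)" for c using v' by (rule scaled_word_carrier)
    have h: "h s \<in> carrier (free_algebra \<epsilon>)" for s unfolding h_def using sw g by (rule free_algebra_mult_closed)
    have step: "mscale M (q s) (gen (X ! s) (act (scaled_word (f v) v') (T m))) =
        monomial_op gen X (a[s := Suc (a ! s)]) (act (h s) m)" if s: "s < r" for s m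
    proof -
      have "act (h s) m = mscale M (q s) (act (scaled_word (f v) v') (act g m))"
      proof -
        have "scaled_word (q s * f v) v' = (\<lambda>w. q s * scaled_word (f v) v' w)" by (auto simp: scaled_word_def)
        then have "act (scaled_word (q s * f v) v') n = mscale M (q s) (act (scaled_word (f v) v') n)" for n
          using act_scaled(1)[OF carrier_subset[OF sw]] by simp
        then show ?thesis
          unfolding h_def same_mult by (simp add: act_mult[OF carrier_subset[OF sw] carrier_subset[OF g]])
      qed
      then have "monomial_op gen X (a[s := Suc (a ! s)]) (act (h s) m) =
          gen (X ! s) (monomial_op gen X a (mscale M (q s) (act (scaled_word (f v) v') (act g m))))"
        by (simp add: gen_monomial_op[OF len s])
      also have "\<dots> = mscale M (q s) (gen (X ! s) (monomial_op gen X a (act (scaled_word (f v) v') (act g m))))"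
        by (simp add: module_hom.scale[OF module_hom_monomial_op] gen_linear)
      finally show ?thesis by (simp add: T act_monomial_op[OF sw len])
    qed
    have "(\<lambda>m. act (scaled_word (f v) v) (T m)) =
        (\<lambda>m. \<Sum>s<r. monomial_op gen X (a[s := Suc (a ! s)]) (act (h s) m))"
    proof
      fix m
      have "act (scaled_word (f v) v) (T m) = gen x (act (scaled_word (f v) v') (T m))"
        unfolding v by (simp add: act_Cons)
      also have "\<dots> = (\<Sum>s<r. mscale M (q s) (gen (X ! s) (act (scaled_word (f v) v') (T m))))"
        unfolding q by (rule gen_sum_left) simp
      finally show "act (scaled_word (f v) v) (T m) =
          (\<Sum>s<r. monomial_op gen X (a[s := Suc (a ! s)]) (act (h s) m))"
        by (simp add: step)
    qed
    moreover have "op_sum (degree_ops (Suc j))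
        (\<lambda>m. \<Sum>s<r. monomial_op gen X (a[s := Suc (a ! s)]) (act (h s) m))"
    proof (rule op_sum_sum, rule op_sum.gen)
      fix s assume "s \<in> {..<r}"
      then show "(\<lambda>m. monomial_op gen X (a[s := Suc (a ! s)]) (act (h s) m)) \<in> degree_ops (Suc j)"
        using exponents_step[OF a, of s] h unfolding degree_ops_def by blast
    qed
    ultimately show ?case by simp
  qed
qed

abbreviation J_power :: "nat \<Rightarrow> ('g list \<Rightarrow> 'k) set set" where
  "J_power j \<equiv> ideal_power (u_algebra L \<epsilon>) (jacobson_radical (u_algebra L \<epsilon>)) j"

lemma J_power_closed: "c \<in> J_power j \<Longrightarrow> c \<in> carrier (u_algebra L \<epsilon>)"
proof (induction j arbitrary: c)
  case (Suc j)
  from Suc.prems have "c \<in> ideal_prod (u_algebra L \<epsilon>) (jacobson_radical (u_algebra L \<epsilon>)) (J_power j)" by simp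
  then show ?case
  proof induction
    case (prod a b)
    then show ?case using Suc.IH by (simp add: jacobson_radical_def)
  qed simp
qed simp

text \<open>Every element of the \<open>j\<close>-th power of the radical acts as a sum of operators \<open>X\<^sup>a f\<close> with \<open>a\<close> of
  degree \<open>j\<close>.\<close>

lemma J_power_op: "c \<in> J_power j \<Longrightarrow> op_sum (degree_ops j) (restrict_act L M c)"
proof (induction j arbitrary: c)
  case 0
  then obtain f where f: "f \<in> carrier (free_algebra \<epsilon>)" "c = class_in L \<epsilon> f" using el.carrier_U by auto
  have "restrict_act L M c = (\<lambda>m. monomial_op gen X (replicate r 0) (act f m))"
    by (simp add: f(2) restrict_act_class[OF f(1)] monomial_op_zero fun_eq_iff)
  moreover have "replicate r 0 \<in> exponents r 0" by (simp add: exponents_def)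
  ultimately show ?case using f(1) by (intro op_sum.gen) (auto simp: degree_ops_def)
next
  case (Suc j)
  from Suc.prems have "c \<in> ideal_prod (u_algebra L \<epsilon>) (jacobson_radical (u_algebra L \<epsilon>)) (J_power j)" by simp
  then show ?case
  proof induction
    case (prod a b)
    then obtain f where f: "f \<in> carrier (free_algebra \<epsilon>)" "f [] = 0" "a = class_in L \<epsilon> f"
      unfolding el.jacobson_radical_eq augmentation_ideal_def by blast
    obtain h where h: "h \<in> carrier (free_algebra \<epsilon>)" "b = class_in L \<epsilon> h"
      using el.carrier_U[OF J_power_closed[OF prod(2)]] by blast
    have "a \<otimes>\<^bsub>u_algebra L \<epsilon>\<^esub> b = class_in L \<epsilon> (f \<otimes>\<^bsub>free_algebra \<epsilon>\<^esub> h)"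
      by (simp add: f(3) h(2) el.class_mult[OF f(1) h(1)])
    then have "restrict_act L M (a \<otimes>\<^bsub>u_algebra L \<epsilon>\<^esub> b) = (\<lambda>m. act f (restrict_act L M b m))"
      using restrict_act_class[OF free_algebra_mult_closed[OF f(1) h(1)]]
        act_mult[OF carrier_subset[OF f(1)] carrier_subset[OF h(1)]]
      by (simp add: fun_eq_iff h(2) restrict_act_class[OF h(1)] same_mult)
    then show ?case using augmentation_raises_degree[OF f(1,2) Suc.IH[OF prod(2)]] by simp
  next
    case (sum a b)
    from sum.hyps have ab: "a \<in> J_power (Suc j)" "b \<in> J_power (Suc j)" by simp_all
    obtain f h where f: "f \<in> carrier (free_algebra \<epsilon>)" "a = class_in L \<epsilon> f"
      and h: "h \<in> carrier (free_algebra \<epsilon>)" "b = class_in L \<epsilon> h"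
      using el.carrier_U J_power_closed ab by metis
    have "a \<oplus>\<^bsub>u_algebra L \<epsilon>\<^esub> b = class_in L \<epsilon> (\<lambda>w. f w + h w)"
      by (simp add: f(2) h(2) el.class_add[OF f(1) h(1)])
    then have "restrict_act L M (a \<oplus>\<^bsub>u_algebra L \<epsilon>\<^esub> b) = (\<lambda>m. restrict_act L M a m + restrict_act L M b m)"
      using restrict_act_class[OF free_algebra_add_closed[OF f(1) h(1)]]
        act_sum_left[OF carrier_subset[OF f(1)] carrier_subset[OF h(1)]]
      by (simp add: fun_eq_iff f(2) h(2) restrict_act_class[OF f(1)] restrict_act_class[OF h(1)])
    then show ?case using sum.IH by (simp add: op_sum.add)
  qed
qed

lemma word_in_J_power: "v \<in> lists \<epsilon> \<Longrightarrow> class_in L \<epsilon> (scaled_word 1 v) \<in> J_power (length v)"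
proof (induction v rule: lists.induct)
  case Nil
  then show ?case by (simp add: el.class_closed scaled_word_carrier)
next
  case (Cons x v)
  have "class_in L \<epsilon> (scaled_word 1 [x]) \<in> jacobson_radical (u_algebra L \<epsilon>)"
    unfolding el.jacobson_radical_eq using el.augmentation_iff[OF letter_carrier[OF Cons(1)]]
    by (simp add: scaled_word_def)
  from ideal_prod.prod[OF this Cons(3)] show ?case
    by (simp add: el.class_scaled_Cons[OF Cons(1,2)])
qed

lemma monomial_op_restrict_act:
  assumes a: "a \<in> exponents r j"
  shows "\<exists>c\<in>J_power j. \<forall>m. restrict_act L M c m = monomial_op gen X a m"
proof -
  have len: "length a = r" "sum_list a = j" using a by (auto simp: exponents_def)
  let ?v = "monomial_word_of X a"
  have "?v \<in> lists \<epsilon>" using set_monomial_word_of[of a X] set_X length_X len(1) by auto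
  then have "class_in L \<epsilon> (scaled_word 1 ?v) \<in> J_power j"
    using word_in_J_power[of ?v] by (simp add: length_monomial_word_of len(2))
  then show ?thesis
    using restrict_act_class[OF monomial_word_carrier[OF len(1)]] monomial_op_act by (metis)
qed

text \<open>Operators \<open>X\<^sup>a f\<close> have values in the image of \<open>X\<^sup>a\<close>; conversely \<open>X\<^sup>a\<close> itself comes from a word of
  length \<open>j\<close>, which lies in the \<open>j\<close>-th power of the radical.\<close>

theorem Rad_eq:
  "Rad L M j \<epsilon> = mv.span {monomial_op gen X a m | a m. a \<in> exponents r j}"
proof
  show "Rad L M j \<epsilon> \<subseteq> mv.span {monomial_op gen X a m | a m. a \<in> exponents r j}"
    unfolding Rad_def
  proof (rule mv.span_minimal[OF _ mv.subspace_span], safe)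
    fix c m assume "c \<in> J_power j"
    from J_power_op[OF this] show "restrict_act L M c m \<in> mv.span {monomial_op gen X a m | a m. a \<in> exponents r j}"
    proof induction
      case zero
      then show ?case by (rule mv.span_zero)
    next
      case (gen T)
      then show ?case unfolding degree_ops_def by (auto intro!: mv.span_base)
    next
      case (add T T')
      then show ?case by (intro mv.span_add)
    qed
  qed
  show "mv.span {monomial_op gen X a m | a m. a \<in> exponents r j} \<subseteq> Rad L M j \<epsilon>"
    unfolding Rad_def
  proof (rule mv.span_mono, safe)
    fix a m assume "a \<in> exponents r j"
    from monomial_op_restrict_act[OF this] show "\<exists>c n. monomial_op gen X a m = restrict_act L M c n \<and> c \<in> J_power j"
      by metis
  qed
qed

text \<open>By commutativity \<open>X\<^sup>a f = f X\<^sup>a\<close>, so what is killed by all \<open>X\<^sup>a\<close> is killed by the power of the radical.\<close>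

theorem Soc_eq: "Soc L M j \<epsilon> = {m. \<forall>a\<in>exponents r j. monomial_op gen X a m = 0}"
proof
  show "Soc L M j \<epsilon> \<subseteq> {m. \<forall>a\<in>exponents r j. monomial_op gen X a m = 0}"
  proof (safe)
    fix m a assume "m \<in> Soc L M j \<epsilon>" "a \<in> exponents r j"
    then show "monomial_op gen X a m = 0"
      using monomial_op_restrict_act[of a j] unfolding Soc_def by auto
  qed
  show "{m. \<forall>a\<in>exponents r j. monomial_op gen X a m = 0} \<subseteq> Soc L M j \<epsilon>"
  proof
    fix m assume m: "m \<in> {m. \<forall>a\<in>exponents r j. monomial_op gen X a m = 0}"
    have "T m = 0" if "op_sum (degree_ops j) T" for T
      using that
    proof induction
      case (gen T)
      then obtain a f where a: "a \<in> exponents r j" and f: "f \<in> carrier (free_algebra \<epsilon>)"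
        and T: "T = (\<lambda>m. monomial_op gen X a (act f m))" unfolding degree_ops_def by blast
      have "length a = r" using a by (simp add: exponents_def)
      then have "T m = act f (monomial_op gen X a m)" by (simp add: T act_monomial_op[OF f])
      then show ?case using m a act_zero[OF carrier_subset[OF f]] by simp
    qed simp_all
    then show "m \<in> Soc L M j \<epsilon>" unfolding Soc_def using J_power_op by blast
  qed
qed

end

section \<open>Image and kernel bundles\<close>

lemma (in tensor_sheaf) section_on_hom:
  assumes h: "module_hom sc sc h" and U: "is_open U" and s: "section_on U s"
  shows "section_on U (\<lambda>x. h (s x))"
proof -
  have "h (s x) = (\<Sum>b\<in>B. sc (vs.coordinate (s x) b) (h b))" for x
  proof -
    have "h (s x) = h (\<Sum>b\<in>B. sc (vs.coordinate (s x) b) b)" by (simp add: vs.coordinate_expansion)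
    then show ?thesis by (simp add: module_hom.sum[OF h] module_hom.scale[OF h])
  qed
  moreover have "section_on U (\<lambda>x. \<Sum>b\<in>B. sc (vs.coordinate (s x) b) (h b))"
    using s unfolding section_on_def[of U s]
    by (intro section_on_sum section_on_scale section_on_const U) blast
  ultimately show ?thesis by simp
qed

lemma finite_exponents: "finite (exponents r j)"
proof (rule finite_subset)
  show "exponents r j \<subseteq> {a. set a \<subseteq> {..j} \<and> length a = r}"
    using member_le_sum_list by (force simp: exponents_def)
  show "finite {a. set a \<subseteq> {..j} \<and> length a = r}" by (rule finite_lists_length_eq) simp
qed

context restricted_module
begin

lemma framed: "X \<in> elementary_frames L r \<Longrightarrow> framed_module L r M X"
  by (simp add: framed_module_def framed_module_axioms_def restricted_module_axioms)

lemma section_on_gen: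
  assumes U: "fs.is_open U" and t: "ft.section_on U t" and s: "s < r"
  shows "ft.section_on U (\<lambda>X. gen (X ! s) (t X))"
proof -
  have "gen (X ! s) (t X) = (\<Sum>x\<in>lbasis L. mscale M (coord_fun L x s X) (gen x (t X)))" for X
    using Theta_eq[of s t X] by (simp add: Theta_def gen_eq)
  moreover have "coord_fun L x s \<in> polynomials (coord_funs L r)" if "x \<in> lbasis L" for x
    using that s by (intro polynomials.coord) (auto simp: coord_funs_def)
  then have "ft.section_on U (\<lambda>X. \<Sum>x\<in>lbasis L. mscale M (coord_fun L x s X) (gen x (t X)))"
    by (intro ft.section_on_sum ft.section_on_scale polynomial_regular_on U
        ft.section_on_hom[OF module_hom_gen U t])
  ultimately show ?thesis by simp
qed

lemma section_on_monomial_op: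
  assumes U: "fs.is_open U" and t: "ft.section_on U t" and a: "length a = r"
  shows "ft.section_on U (\<lambda>X. monomial_op gen X a (t X))"
proof -
  have "ft.section_on U (\<lambda>X. power_product (\<lambda>s. gen (X ! s)) e ss (t X))" if "\<forall>s\<in>set ss. s < r" for e ss
    using that
  proof (induction ss)
    case Nil
    then show ?case using t by simp
  next
    case (Cons s ss)
    have "ft.section_on U (\<lambda>X. (gen (X ! s) ^^ k) (power_product (\<lambda>s. gen (X ! s)) e ss (t X)))" for k
    proof (induction k)
      case 0
      then show ?case using Cons by simp
    next
      case (Suc k)
      have "ft.section_on U (\<lambda>X. gen (X ! s) ((gen (X ! s) ^^ k) (power_product (\<lambda>s. gen (X ! s)) e ss (t X))))"
        by (rule section_on_gen[OF U Suc]) (use Cons.prems in simp)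
      then show ?case by simp
    qed
    then show ?case by simp
  qed
  then show ?thesis unfolding monomial_op_def using a by simp
qed

lemma Rad_span:
  assumes X: "X \<in> elementary_frames L r"
  shows "Rad L M j (frame_span L X) =
    mv.span ((\<lambda>p. monomial_op gen X (fst p) (snd p)) ` (exponents r j \<times> mbasis M))"
proof -
  interpret framed_module L r M X by (rule framed[OF X])
  let ?S = "mv.span ((\<lambda>p. monomial_op gen X (fst p) (snd p)) ` (exponents r j \<times> mbasis M))"
  have "monomial_op gen X a m \<in> ?S" if "a \<in> exponents r j" for a m
  proof -
    have "monomial_op gen X a m = monomial_op gen X a (\<Sum>b\<in>mbasis M. mscale M (mv.coordinate m b) b)"
      by (simp add: mv.coordinate_expansion)
    also have "\<dots> = (\<Sum>b\<in>mbasis M. mscale M (mv.coordinate m b) (monomial_op gen X a b))"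
      by (simp add: module_hom.sum[OF module_hom_monomial_op] module_hom.scale[OF module_hom_monomial_op])
    also have "\<dots> \<in> ?S"
    proof (intro mv.span_sum mv.span_scale mv.span_base)
      fix b assume "b \<in> mbasis M"
      then show "monomial_op gen X a b \<in> (\<lambda>p. monomial_op gen X (fst p) (snd p)) ` (exponents r j \<times> mbasis M)"
        using that by (intro image_eqI[of _ _ "(a, b)"]) simp_all
    qed
    finally show ?thesis .
  qed
  then have "mv.span {monomial_op gen X a m | a m. a \<in> exponents r j} \<subseteq> ?S"
    by (intro mv.span_minimal mv.subspace_span) auto
  moreover have "?S \<subseteq> mv.span {monomial_op gen X a m | a m. a \<in> exponents r j}"
    by (rule mv.span_mono) auto
  ultimately show ?thesis unfolding Rad_eq by blast
qed

lemma Soc_kernel: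
  "X \<in> elementary_frames L r \<Longrightarrow>
     Soc L M j (frame_span L X) = {m. \<forall>a\<in>exponents r j. monomial_op gen X a m = 0}"
  by (rule framed_module.Soc_eq[OF framed])

lemma local_sectionD:
  assumes "local_section U \<sigma>"
  shows "es.is_open U" "\<epsilon> \<in> U \<Longrightarrow> \<sigma> \<epsilon> \<in> elementary_frames L r" "\<epsilon> \<in> U \<Longrightarrow> frame_span L (\<sigma> \<epsilon>) = \<epsilon>"
  using assms unfolding local_section_def by auto

lemma section_on_monomial_op_local_section:
  assumes \<sigma>: "local_section U \<sigma>" and a: "length a = r"
  shows "et.section_on U (\<lambda>\<epsilon>. monomial_op gen (\<sigma> \<epsilon>) a m)"
proof -
  let ?V = "elementary_frames L r"
  have V: "fs.is_open ?V" using openin_topspace[of "zariski (frame_variety L r)"] topspace_frame_variety by simp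
  have "et.section_on {\<epsilon> \<in> U. \<sigma> \<epsilon> \<in> ?V} (\<lambda>\<epsilon>. monomial_op gen (\<sigma> \<epsilon>) a m)"
    by (rule section_on_local_section[OF \<sigma> V section_on_monomial_op[OF V ft.section_on_const[OF V] a]])
  moreover have "{\<epsilon> \<in> U. \<sigma> \<epsilon> \<in> ?V} = U" using local_sectionD(2)[OF \<sigma>] by blast
  ultimately show ?thesis by simp
qed

text \<open>Along a local section of the torsor the radical is spanned by finitely many regular sections, the
  values of the monomials on a basis of \<open>M\<close>; then constancy of the rank applies.\<close>

lemma locally_framed_Rad:
  assumes const: "constant_radical_rank L M r j"
  shows "et.locally_framed (Rad L M j)"
  unfolding et.locally_framed_def topspace_elementary_variety
proof
  fix \<epsilon>0 assume \<epsilon>0: "\<epsilon>0 \<in> elementary_subalgebras L r"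
  obtain U \<sigma> where U: "\<epsilon>0 \<in> U" and \<sigma>: "local_section U \<sigma>" using local_section_exists[OF \<epsilon>0] by blast
  note oU = local_sectionD(1)[OF \<sigma>]
  have UE: "\<epsilon> \<in> elementary_subalgebras L r" if "\<epsilon> \<in> U" for \<epsilon>
    using that oU openin_subset topspace_elementary_variety by blast
  have "\<exists>W c. \<epsilon>0 \<in> W \<and> W \<subseteq> U \<and> (\<forall>i<mv.dim (Rad L M j \<epsilon>0). c i \<in> exponents r j \<times> mbasis M) \<and>
    et.frame_on (Rad L M j) W (mv.dim (Rad L M j \<epsilon>0))
      (\<lambda>i. (\<lambda>\<epsilon>. monomial_op gen (\<sigma> \<epsilon>) (fst (c i)) (snd (c i))))"
  proof (rule et.frame_of_constant_rank_span[OF oU U,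
        where g = "\<lambda>p \<epsilon>. monomial_op gen (\<sigma> \<epsilon>) (fst p) (snd p)"])
    show "et.section_on U (\<lambda>\<epsilon>. monomial_op gen (\<sigma> \<epsilon>) (fst p) (snd p))"
      if "p \<in> exponents r j \<times> mbasis M" for p
      by (rule section_on_monomial_op_local_section[OF \<sigma>]) (use that in \<open>auto simp: exponents_def\<close>)
    show "Rad L M j \<epsilon> = mv.span ((\<lambda>p. monomial_op gen (\<sigma> \<epsilon>) (fst p) (snd p)) ` (exponents r j \<times> mbasis M))"
      if "\<epsilon> \<in> U" for \<epsilon>
      using Rad_span[OF local_sectionD(2)[OF \<sigma> that]] local_sectionD(3)[OF \<sigma> that] by simp
    show "mv.dim (Rad L M j \<epsilon>) = mv.dim (Rad L M j \<epsilon>0)" if "\<epsilon> \<in> U" for \<epsilon>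
      using const UE[OF that] \<epsilon>0 unfolding constant_radical_rank_def by blast
  qed
  then show "\<exists>U n e. \<epsilon>0 \<in> U \<and> et.frame_on (Rad L M j) U n e" by blast
qed

lemma locally_framed_Soc:
  assumes const: "constant_socle_rank L M r j"
  shows "et.locally_framed (Soc L M j)"
  unfolding et.locally_framed_def topspace_elementary_variety
proof
  fix \<epsilon>0 assume \<epsilon>0: "\<epsilon>0 \<in> elementary_subalgebras L r"
  obtain U \<sigma> where U: "\<epsilon>0 \<in> U" and \<sigma>: "local_section U \<sigma>" using local_section_exists[OF \<epsilon>0] by blast
  note oU = local_sectionD(1)[OF \<sigma>]
  have UE: "\<epsilon> \<in> elementary_subalgebras L r" if "\<epsilon> \<in> U" for \<epsilon>
    using that oU openin_subset topspace_elementary_variety by blast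
  have "\<exists>W e. \<epsilon>0 \<in> W \<and> W \<subseteq> U \<and> et.frame_on (Soc L M j) W (mv.dim (Soc L M j \<epsilon>0)) e"
  proof (rule et.frame_of_constant_rank_kernel[OF oU U finite_exponents,
        where T = "\<lambda>a \<epsilon>. monomial_op gen (\<sigma> \<epsilon>) a"])
    show "module_hom (mscale M) (mscale M) (monomial_op gen (\<sigma> \<epsilon>) a)" for a \<epsilon>
      by (rule module_hom_monomial_op)
    show "et.section_on U (\<lambda>\<epsilon>. monomial_op gen (\<sigma> \<epsilon>) a m)" if "a \<in> exponents r j" for a m
      by (rule section_on_monomial_op_local_section[OF \<sigma>]) (use that in \<open>simp add: exponents_def\<close>)
    show "Soc L M j \<epsilon> = {m. \<forall>a\<in>exponents r j. monomial_op gen (\<sigma> \<epsilon>) a m = 0}" if "\<epsilon> \<in> U" for \<epsilon>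
      using Soc_kernel[OF local_sectionD(2)[OF \<sigma> that]] local_sectionD(3)[OF \<sigma> that] by simp
    show "mv.dim (Soc L M j \<epsilon>) = mv.dim (Soc L M j \<epsilon>0)" if "\<epsilon> \<in> U" for \<epsilon>
      using const UE[OF that] \<epsilon>0 unfolding constant_socle_rank_def by blast
  qed
  then show "\<exists>U n e. \<epsilon>0 \<in> U \<and> et.frame_on (Soc L M j) U n e" by blast
qed

lemma open_frames: "fs.is_open V \<Longrightarrow> X \<in> V \<Longrightarrow> X \<in> elementary_frames L r"
  using openin_subset topspace_frame_variety by blast

text \<open>Sections of the kernel sheaf are characterised by their values.\<close>

lemma Ker_frames_eq: "Ker_frames L M r j = ft.subspace_sheaf (pull (Soc L M j))"
proof
  fix V
  show "Ker_frames L M r j V = ft.subspace_sheaf (pull (Soc L M j)) V"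
  proof (cases "fs.is_open V")
    case V: True
    have "(\<forall>a\<in>exponents r j. Theta_power L M a t = (\<lambda>X. 0)) \<longleftrightarrow> (\<forall>X\<in>V. t X \<in> Soc L M j (frame_span L X))"
      if t: "t \<in> tensor_sections (mscale M) (mbasis M) (frame_variety L r) V" for t
    proof -
      have out: "monomial_op gen X a (t X) = 0" if "X \<notin> V" for X a
        using t that module_hom.zero[OF module_hom_monomial_op] by (simp add: ft.tensor_sections_iff)
      have "(\<forall>a\<in>exponents r j. Theta_power L M a t = (\<lambda>X. 0)) \<longleftrightarrow>
          (\<forall>a\<in>exponents r j. \<forall>X. monomial_op gen X a (t X) = 0)"
        by (simp add: fun_eq_iff Theta_power_eq)
      also have "\<dots> \<longleftrightarrow> (\<forall>X\<in>V. \<forall>a\<in>exponents r j. monomial_op gen X a (t X) = 0)" using out by blast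
      also have "\<dots> \<longleftrightarrow> (\<forall>X\<in>V. t X \<in> Soc L M j (frame_span L X))"
        using Soc_kernel open_frames[OF V] by (intro ball_cong refl) simp
      finally show ?thesis .
    qed
    then show ?thesis using V unfolding Ker_frames_def ft.subspace_sheaf_def by (simp cong: conj_cong)
  qed (simp add: Ker_frames_def ft.subspace_sheaf_def)
qed

text \<open>Among the sections \<open>X\<^sup>a b\<close>, for \<open>b\<close> in a basis of \<open>M\<close>, a frame of the radical can be chosen. The
  coefficients of \<open>t\<close> in this frame, collected according to \<open>a\<close>, are the preimages \<open>u\<^sub>a\<close>.\<close>

lemma local_image_section:
  assumes const: "constant_radical_rank L M r j" and V: "fs.is_open V" and X: "X \<in> V"
    and t: "t \<in> tensor_sections (mscale M) (mbasis M) (frame_variety L r) V"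
      "\<And>X. X \<in> V \<Longrightarrow> t X \<in> Rad L M j (frame_span L X)"
  shows "\<exists>W u. fs.is_open W \<and> X \<in> W \<and> W \<subseteq> V \<and>
    (\<forall>a\<in>exponents r j. u a \<in> tensor_sections (mscale M) (mbasis M) (frame_variety L r) W) \<and>
    restr W t = (\<lambda>X'. \<Sum>a\<in>exponents r j. Theta_power L M a (u a) X')"
proof -
  let ?d = "mv.dim (Rad L M j (frame_span L X))"
  have EF: "Y \<in> elementary_frames L r" if "Y \<in> V" for Y using open_frames[OF V that] .
  have "\<exists>W c. X \<in> W \<and> W \<subseteq> V \<and> (\<forall>i<?d. c i \<in> exponents r j \<times> mbasis M) \<and>
    ft.frame_on (pull (Rad L M j)) W ?d (\<lambda>i. (\<lambda>X. monomial_op gen X (fst (c i)) (snd (c i))))"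
  proof (rule ft.frame_of_constant_rank_span[OF V X,
        where g = "\<lambda>p X. monomial_op gen X (fst p) (snd p)"])
    show "ft.section_on V (\<lambda>X. monomial_op gen X (fst p) (snd p))"
      if "p \<in> exponents r j \<times> mbasis M" for p
      by (rule section_on_monomial_op[OF V ft.section_on_const[OF V]]) (use that in \<open>auto simp: exponents_def\<close>)
    show "Rad L M j (frame_span L Y) =
        mv.span ((\<lambda>p. monomial_op gen Y (fst p) (snd p)) ` (exponents r j \<times> mbasis M))"
      if "Y \<in> V" for Y by (rule Rad_span[OF EF[OF that]])
    show "mv.dim (Rad L M j (frame_span L Y)) = ?d" if "Y \<in> V" for Y
      using const EF[OF that] EF[OF X] elementary_frames_iff unfolding constant_radical_rank_def by blast
  qed
  then obtain W c where W: "X \<in> W" "W \<subseteq> V" and c: "\<forall>i<?d. c i \<in> exponents r j \<times> mbasis M"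
    and fr: "ft.frame_on (pull (Rad L M j)) W ?d (\<lambda>i. (\<lambda>X. monomial_op gen X (fst (c i)) (snd (c i))))"
    by (elim exE conjE) (rule that)
  have oW: "fs.is_open W" using fr unfolding ft.frame_on_def by blast
  have "ft.section_on W t" using t(1) ft.tensor_sections_iff ft.section_on_subset[OF _ oW W(2)] by blast
  from ft.frame_coefficients[OF fr oW order_refl this] t(2) W(2)
  obtain f where f: "\<forall>i<?d. f i \<in> regular (frame_variety L r) W"
    and tf: "\<forall>Y\<in>W. t Y = (\<Sum>i<?d. mscale M (f i Y) (monomial_op gen Y (fst (c i)) (snd (c i))))" by blast
  define u where "u a Y = (\<Sum>i<?d. mscale M (if fst (c i) = a then f i Y else 0) (snd (c i)))" for a Y
  have "u a \<in> tensor_sections (mscale M) (mbasis M) (frame_variety L r) W" for a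
    unfolding ft.tensor_sections_iff
  proof
    show "ft.section_on W (u a)"
      unfolding u_def[abs_def]
    proof (intro ft.section_on_sum ft.section_on_scale ft.section_on_const oW)
      fix i assume "i \<in> {..<?d}"
      then have "fs.regular_on W (f i)" using f fs.regular_iff by blast
      then show "fs.regular_on W (\<lambda>Y. if fst (c i) = a then f i Y else 0)"
        using fs.regular_on_const[OF oW, of 0] by (cases "fst (c i) = a") simp_all
    qed
    show "\<forall>Y. Y \<notin> W \<longrightarrow> u a Y = 0"
      unfolding u_def using f fs.regular_iff by (auto intro!: sum.neutral)
  qed
  moreover have "restr W t = (\<lambda>Y. \<Sum>a\<in>exponents r j. Theta_power L M a (u a) Y)"
  proof
    fix Y
    note hom = module_hom_monomial_op[of Y]
    have "(\<Sum>a\<in>exponents r j. Theta_power L M a (u a) Y) =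
      (\<Sum>a\<in>exponents r j. \<Sum>i<?d. mscale M (if fst (c i) = a then f i Y else 0) (monomial_op gen Y a (snd (c i))))"
      by (simp add: Theta_power_eq u_def module_hom.sum[OF hom] module_hom.scale[OF hom])
    also have "\<dots> = (\<Sum>i<?d. \<Sum>a\<in>exponents r j.
        if a = fst (c i) then mscale M (f i Y) (monomial_op gen Y a (snd (c i))) else 0)"
      by (subst sum.swap) (intro sum.cong refl, auto)
    also have "\<dots> = (\<Sum>i<?d. mscale M (f i Y) (monomial_op gen Y (fst (c i)) (snd (c i))))"
      using c finite_exponents by (intro sum.cong refl) (auto simp: mem_Times_iff)
    also have "\<dots> = restr W t Y"
      using tf f by (cases "Y \<in> W") (auto simp: restr_def fs.regular_iff intro!: sum.neutral)
    finally show "restr W t Y = (\<Sum>a\<in>exponents r j. Theta_power L M a (u a) Y)" by simp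
  qed
  ultimately show ?thesis using oW W by blast
qed

text \<open>Constancy of the rank is essential here: in general a section of \<open>M \<otimes> \<O>\<close> whose values lie in the
  pointwise images need not be in the image sheaf.\<close>

lemma Im_frames_eq:
  assumes const: "constant_radical_rank L M r j"
  shows "Im_frames L M r j = ft.subspace_sheaf (pull (Rad L M j))"
proof
  fix V
  show "Im_frames L M r j V = ft.subspace_sheaf (pull (Rad L M j)) V"
  proof (cases "fs.is_open V")
    case V: True
    define loc where "loc t X W u \<longleftrightarrow> fs.is_open W \<and> X \<in> W \<and> W \<subseteq> V \<and>
        (\<forall>a\<in>exponents r j. u a \<in> tensor_sections (mscale M) (mbasis M) (frame_variety L r) W) \<and>
        restr W t = (\<lambda>X'. \<Sum>a\<in>exponents r j. Theta_power L M a (u a) X')" for t X W u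
    have "(\<forall>X\<in>V. \<exists>W u. loc t X W u) \<longleftrightarrow> (\<forall>X\<in>V. t X \<in> Rad L M j (frame_span L X))"
      if t: "t \<in> tensor_sections (mscale M) (mbasis M) (frame_variety L r) V" for t
    proof
      assume locs: "\<forall>X\<in>V. \<exists>W u. loc t X W u"
      show "\<forall>X\<in>V. t X \<in> Rad L M j (frame_span L X)"
      proof
        fix X assume X: "X \<in> V"
        then obtain W u where Wu: "loc t X W u" using locs by blast
        have eq: "restr W t = (\<lambda>X'. \<Sum>a\<in>exponents r j. Theta_power L M a (u a) X')" and XW: "X \<in> W"
          using Wu unfolding loc_def by blast+
        interpret framed_module L r M X by (rule framed[OF open_frames[OF V X]])
        have "t X = (\<Sum>a\<in>exponents r j. monomial_op gen X a (u a X))"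
          using fun_cong[OF eq, of X] XW by (simp add: restr_def Theta_power_eq)
        also have "\<dots> \<in> Rad L M j (frame_span L X)"
          unfolding Rad_eq by (intro mv.span_sum mv.span_base) blast
        finally show "t X \<in> Rad L M j (frame_span L X)" .
      qed
    next
      assume "\<forall>X\<in>V. t X \<in> Rad L M j (frame_span L X)"
      then show "\<forall>X\<in>V. \<exists>W u. loc t X W u"
        using local_image_section[OF const V _ t] unfolding loc_def by simp
    qed
    then show ?thesis
      using V unfolding Im_frames_def ft.subspace_sheaf_def loc_def[symmetric] by (simp cong: conj_cong)
  qed (simp add: Im_frames_def ft.subspace_sheaf_def)
qed

theorem image_bundle:
  assumes const: "constant_radical_rank L M r j"
  shows "vector_bundle (mscale M) (mbasis M) (elementary_variety L r) (Im_sheaf L M r j)"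
    and "\<epsilon> \<in> elementary_subalgebras L r \<Longrightarrow>
      fiber_naturally_identified (mscale M) (elementary_variety L r) (Im_sheaf L M r j) \<epsilon> (Rad L M j \<epsilon>)"
proof -
  note lf = locally_framed_Rad[OF const]
  have Im: "Im_sheaf L M r j = et.subspace_sheaf (Rad L M j)"
    unfolding Im_sheaf_def descent_def Im_frames_eq[OF const] by (rule descent_subspace_sheaf[OF lf])
  show "vector_bundle (mscale M) (mbasis M) (elementary_variety L r) (Im_sheaf L M r j)"
    unfolding Im by (rule et.vector_bundle_subspace_sheaf[OF lf])
  show "\<epsilon> \<in> elementary_subalgebras L r \<Longrightarrow>
      fiber_naturally_identified (mscale M) (elementary_variety L r) (Im_sheaf L M r j) \<epsilon> (Rad L M j \<epsilon>)"
    unfolding Im topspace_elementary_variety[symmetric] by (rule et.fiber_subspace_sheaf[OF lf])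
qed

theorem kernel_bundle:
  assumes const: "constant_socle_rank L M r j"
  shows "vector_bundle (mscale M) (mbasis M) (elementary_variety L r) (Ker_sheaf L M r j)"
    and "\<epsilon> \<in> elementary_subalgebras L r \<Longrightarrow>
      fiber_naturally_identified (mscale M) (elementary_variety L r) (Ker_sheaf L M r j) \<epsilon> (Soc L M j \<epsilon>)"
proof -
  note lf = locally_framed_Soc[OF const]
  have Ker: "Ker_sheaf L M r j = et.subspace_sheaf (Soc L M j)"
    unfolding Ker_sheaf_def descent_def Ker_frames_eq by (rule descent_subspace_sheaf[OF lf])
  show "vector_bundle (mscale M) (mbasis M) (elementary_variety L r) (Ker_sheaf L M r j)"
    unfolding Ker by (rule et.vector_bundle_subspace_sheaf[OF lf])
  show "\<epsilon> \<in> elementary_subalgebras L r \<Longrightarrow>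
      fiber_naturally_identified (mscale M) (elementary_variety L r) (Ker_sheaf L M r j) \<epsilon> (Soc L M j \<epsilon>)"
    unfolding Ker topspace_elementary_variety[symmetric] by (rule et.fiber_subspace_sheaf[OF lf])
qed

end

theorem corollary3p3:
  fixes L :: "('k::alg_closed_field, 'g::ab_group_add) lie"
    and M :: "('k, 'g, 'm::ab_group_add) umod"
    and r j :: nat
  assumes "CHAR('k) > 0"
    and "restricted_lie_algebra L"
    and "r > 0" and "j > 0" and "j \<le> (CHAR('k) - 1) * r"
    and "u_module L M"
  shows "(constant_radical_rank L M r j \<longrightarrow>
            vector_bundle (mscale M) (mbasis M) (elementary_variety L r) (Im_sheaf L M r j) \<and>
            (\<forall>\<epsilon>\<in>elementary_subalgebras L r.
               fiber_naturally_identified (mscale M) (elementary_variety L r)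
                 (Im_sheaf L M r j) \<epsilon> (Rad L M j \<epsilon>))) \<and>
         (constant_socle_rank L M r j \<longrightarrow>
            vector_bundle (mscale M) (mbasis M) (elementary_variety L r) (Ker_sheaf L M r j) \<and>
            (\<forall>\<epsilon>\<in>elementary_subalgebras L r.
               fiber_naturally_identified (mscale M) (elementary_variety L r)
                 (Ker_sheaf L M r j) \<epsilon> (Soc L M j \<epsilon>)))"
proof -
  have "finite_dimensional_vector_space (lscale L) (lbasis L)"
    using assms(2) by (simp add: restricted_lie_algebra_def)
  then interpret restricted_module L r M
    using assms by (simp add: restricted_module_def restricted_module_axioms_def restricted_geometry_def
        restricted_geometry_axioms_def lie_geometry_def)
  show ?thesis using image_bundle kernel_bundle by blast
qed

end
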